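(* Let $\Gamma=(V,E)$ be a finite connected planar quiver, $k$ a field of characteristic $0$, and let $I\subseteq R^2$ be an ideal of $k\Gamma$ generated by paths such that $k\Gamma/I$ is complete and acyclic. Then the classes of the elements of $(\overline{\mathfrak{B}}_2\setminus\overline{\mathfrak{B}}_E)\cup\overline{\mathfrak{B}}_{\mathbb{P}}$ form a $k$-basis of $HH^1(k\Gamma/I)$.
   Context: For a path $p$, $t(p),h(p)$ are its start and end vertex; paths multiply by left-to-right concatenation (product $0$ if they do not concatenate). $R$ is the ideal generated by $E$, $\overline{x}=x+I$. $\mathscr{Q}$ is the set of residue classes of paths not in $I$; for $\overline{s}\in\mathscr{Q}$ the class of $s\notin I$, $r\parallel\overline{s}$ means $t(r)=t(s)$, $h(r)=h(s)$. $k\Gamma/I$ is complete if for any two parallel paths $p,p'$, $p\in I$ implies $p'\in I$; acyclic if every path $p\notin I$ with $t(p)=h(p)$ is a vertex. $HH^1(k\Gamma/I)$ is the space of derivations of $k\Gamma/I$ modulo inner derivations. For $r\in E$, $\overline{s}\in\mathscr{Q}$, $r\parallel\overline{s}$, $\overline{D}_{r,\overline{s}}$ is the derivation of $k\Gamma/I$ induced by the unique $k$-linear map $D_{r,\overline{s}}:k\Gamma\to k\Gamma/I$ with $D(xy)=D(x)\overline{y}+\overline{x}D(y)$, $D_{r,\overline{s}}(r)=\overline{s}$ and vanishing on other arrows and vertices. $\overline{\mathfrak{B}}_2$ is the set of all such $\overline{D}_{r,\overline{s}}$; $\overline{\mathfrak{B}}_E=\{\overline{D}_{p,\overline{p}}\mid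 p\in E\}$. A planar quiver has a fixed embedding in $\mathbb{R}^2$; its faces are the connected components of $\mathbb{R}^2\setminus\Gamma$, one of which, $f_0$, is unbounded. For a face $f$ whose boundary consists of the ordered arrows $p_1,\dots,p_s$ (arrows bordering $f$ on both sides appear twice), $\overline{D}_{\mathbbm{p}_f}=\sum_i\epsilon_i\overline{D}_{p_i,\overline{p_i}}$ with $\epsilon_i=+1$ if $p_i$ runs clockwise viewed from the interior of $f$ and $-1$ otherwise. $\overline{\mathfrak{B}}_{\mathbb{P}}=\{\overline{D}_{\mathbbm{p}_f}\mid f\neq f_0\}$. *)

theory Defs
  imports "HOL-Complex_Analysis.Winding_Numbers"
begin

section \<open>Quivers and paths\<close>

record ('v,'a) quiver =
  qverts :: "'v set"
  qarrs  :: "'a set"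
  qsrc   :: "'a \<Rightarrow> 'v"   (* t(a) *)
  qtgt   :: "'a \<Rightarrow> 'v"   (* h(a) *)

definition quiver_wf :: "('v,'a) quiver \<Rightarrow> bool" where
  "quiver_wf Q \<longleftrightarrow> finite (qverts Q) \<and> finite (qarrs Q) \<and>
     (\<forall>a\<in>qarrs Q. qsrc Q a \<in> qverts Q \<and> qtgt Q a \<in> qverts Q)"

text \<open>Connectedness of the underlying (undirected) graph.\<close>
definition quiver_connected :: "('v,'a) quiver \<Rightarrow> bool" where
  "quiver_connected Q \<longleftrightarrow> (\<forall>u\<in>qverts Q. \<forall>v\<in>qverts Q.
     (u, v) \<in> (\<Union>a\<in>qarrs Q. {(qsrc Q a, qtgt Q a), (qtgt Q a, qsrc Q a)})\<^sup>*)"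

text \<open>A path is a start vertex together with a (possibly empty) list of composable
  arrows, read left to right; the empty list is the trivial path at the vertex.\<close>
type_synonym ('v,'a) qpath = "'v \<times> 'a list"

definition is_qpath :: "('v,'a) quiver \<Rightarrow> ('v,'a) qpath \<Rightarrow> bool" where
  "is_qpath Q p \<longleftrightarrow> fst p \<in> qverts Q \<and> set (snd p) \<subseteq> qarrs Q \<and>
     (snd p \<noteq> [] \<longrightarrow> qsrc Q (hd (snd p)) = fst p) \<and>
     (\<forall>i. Suc i < length (snd p) \<longrightarrow> qtgt Q (snd p ! i) = qsrc Q (snd p ! Suc i))"

definition pstart :: "('v,'a) qpath \<Rightarrow> 'v" where
  "pstart p = fst p"

definition pend :: "('v,'a) quiver \<Rightarrow> ('v,'a) qpath \<Rightarrow> 'v" where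
  "pend Q p = (if snd p = [] then fst p else qtgt Q (last (snd p)))"

definition qparallel :: "('v,'a) quiver \<Rightarrow> ('v,'a) qpath \<Rightarrow> ('v,'a) qpath \<Rightarrow> bool" where
  "qparallel Q p q \<longleftrightarrow> pstart p = pstart q \<and> pend Q p = pend Q q"

definition apath :: "('v,'a) quiver \<Rightarrow> 'a \<Rightarrow> ('v,'a) qpath" where
  "apath Q a = (qsrc Q a, [a])"

section \<open>The path algebra k\<Gamma>\<close>

text \<open>Elements of k\<Gamma>: finitely supported k-valued functions on paths.\<close>
definition kG :: "('v,'a) quiver \<Rightarrow> (('v,'a) qpath \<Rightarrow> 'k::field) set" where
  "kG Q = {x. finite {p. x p \<noteq> 0} \<and> (\<forall>p. x p \<noteq> 0 \<longrightarrow> is_qpath Q p)}"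

definition vert_at :: "('v,'a) quiver \<Rightarrow> ('v,'a) qpath \<Rightarrow> nat \<Rightarrow> 'v" where
  "vert_at Q p i = (if i = 0 then fst p else qtgt Q (snd p ! (i - 1)))"

text \<open>Multiplication = left-to-right concatenation, extended bilinearly.\<close>
definition pmult :: "('v,'a) quiver \<Rightarrow> (('v,'a) qpath \<Rightarrow> 'k::field)
     \<Rightarrow> (('v,'a) qpath \<Rightarrow> 'k) \<Rightarrow> (('v,'a) qpath \<Rightarrow> 'k)" where
  "pmult Q x y = (\<lambda>p. if is_qpath Q p then
      (\<Sum>i\<le>length (snd p). x (fst p, take i (snd p)) * y (vert_at Q p i, drop i (snd p)))
    else 0)"

text \<open>The basis element of k\<Gamma> given by a path.\<close>
definition pel :: "('v,'a) qpath \<Rightarrow> (('v,'a) qpath \<Rightarrow> 'k::field)" where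
  "pel p = (\<lambda>q. if q = p then 1 else 0)"

definition is_ideal :: "('v,'a) quiver \<Rightarrow> (('v,'a) qpath \<Rightarrow> 'k::field) set \<Rightarrow> bool" where
  "is_ideal Q J \<longleftrightarrow> J \<subseteq> kG Q \<and> (\<lambda>_. 0) \<in> J \<and>
     (\<forall>x\<in>J. \<forall>y\<in>J. (\<lambda>p. x p + y p) \<in> J) \<and>
     (\<forall>c. \<forall>x\<in>J. (\<lambda>p. c * x p) \<in> J) \<and>
     (\<forall>x\<in>J. \<forall>a\<in>kG Q. pmult Q a x \<in> J \<and> pmult Q x a \<in> J)"

definition gen_ideal :: "('v,'a) quiver \<Rightarrow> (('v,'a) qpath \<Rightarrow> 'k::field) set
     \<Rightarrow> (('v,'a) qpath \<Rightarrow> 'k) set" where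
  "gen_ideal Q S = \<Inter> {J. is_ideal Q J \<and> S \<subseteq> J}"

text \<open>R = ideal generated by the arrows; R^2 = R R = ideal generated by products.\<close>
definition Rad :: "('v,'a) quiver \<Rightarrow> (('v,'a) qpath \<Rightarrow> 'k::field) set" where
  "Rad Q = gen_ideal Q ((\<lambda>a. pel (apath Q a)) ` qarrs Q)"

definition Rad2 :: "('v,'a) quiver \<Rightarrow> (('v,'a) qpath \<Rightarrow> 'k::field) set" where
  "Rad2 Q = gen_ideal Q {pmult Q x y | x y. x \<in> Rad Q \<and> y \<in> Rad Q}"

definition path_generated :: "('v,'a) quiver \<Rightarrow> (('v,'a) qpath \<Rightarrow> 'k::field) set \<Rightarrow> bool" where
  "path_generated Q I \<longleftrightarrow> (\<exists>G. (\<forall>g\<in>G. is_qpath Q g) \<and> I = gen_ideal Q (pel ` G))"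

definition complete_rel :: "('v,'a) quiver \<Rightarrow> (('v,'a) qpath \<Rightarrow> 'k::field) set \<Rightarrow> bool" where
  "complete_rel Q I \<longleftrightarrow> (\<forall>p q. is_qpath Q p \<and> is_qpath Q q \<and> qparallel Q p q \<and>
      pel p \<in> I \<longrightarrow> pel q \<in> I)"

definition acyclic_rel :: "('v,'a) quiver \<Rightarrow> (('v,'a) qpath \<Rightarrow> 'k::field) set \<Rightarrow> bool" where
  "acyclic_rel Q I \<longleftrightarrow> (\<forall>p. is_qpath Q p \<and> pel p \<notin> I \<and> pstart p = pend Q p \<longrightarrow> snd p = [])"

section \<open>The quotient k\<Gamma>/I (residue classes as cosets)\<close>

definition cls :: "(('v,'a) qpath \<Rightarrow> 'k::field) set \<Rightarrow> (('v,'a) qpath \<Rightarrow> 'k)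
     \<Rightarrow> (('v,'a) qpath \<Rightarrow> 'k) set" where
  "cls I x = {y. \<exists>z\<in>I. y = (\<lambda>p. x p + z p)}"

definition qcar :: "('v,'a) quiver \<Rightarrow> (('v,'a) qpath \<Rightarrow> 'k::field) set
     \<Rightarrow> (('v,'a) qpath \<Rightarrow> 'k) set set" where
  "qcar Q I = cls I ` kG Q"

definition qrep :: "'b set \<Rightarrow> 'b" where
  "qrep X = (SOME x. x \<in> X)"

definition qadd :: "(('v,'a) qpath \<Rightarrow> 'k::field) set \<Rightarrow> (('v,'a) qpath \<Rightarrow> 'k) set
     \<Rightarrow> (('v,'a) qpath \<Rightarrow> 'k) set \<Rightarrow> (('v,'a) qpath \<Rightarrow> 'k) set" where
  "qadd I X Y = cls I (\<lambda>p. qrep X p + qrep Y p)"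

definition qsmult :: "(('v,'a) qpath \<Rightarrow> 'k::field) set \<Rightarrow> 'k
     \<Rightarrow> (('v,'a) qpath \<Rightarrow> 'k) set \<Rightarrow> (('v,'a) qpath \<Rightarrow> 'k) set" where
  "qsmult I c X = cls I (\<lambda>p. c * qrep X p)"

definition qmult :: "('v,'a) quiver \<Rightarrow> (('v,'a) qpath \<Rightarrow> 'k::field) set
     \<Rightarrow> (('v,'a) qpath \<Rightarrow> 'k) set \<Rightarrow> (('v,'a) qpath \<Rightarrow> 'k) set \<Rightarrow> (('v,'a) qpath \<Rightarrow> 'k) set" where
  "qmult Q I X Y = cls I (pmult Q (qrep X) (qrep Y))"

type_synonym ('v,'a,'k) qder = "(('v,'a) qpath \<Rightarrow> 'k) set \<Rightarrow> (('v,'a) qpath \<Rightarrow> 'k) set"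

text \<open>k-linear derivations of k\<Gamma>/I.\<close>
definition is_qder :: "('v,'a) quiver \<Rightarrow> (('v,'a) qpath \<Rightarrow> 'k::field) set
     \<Rightarrow> ('v,'a,'k) qder \<Rightarrow> bool" where
  "is_qder Q I D \<longleftrightarrow>
     (\<forall>X\<in>qcar Q I. D X \<in> qcar Q I) \<and>
     (\<forall>X\<in>qcar Q I. \<forall>Y\<in>qcar Q I. D (qadd I X Y) = qadd I (D X) (D Y)) \<and>
     (\<forall>c. \<forall>X\<in>qcar Q I. D (qsmult I c X) = qsmult I c (D X)) \<and>
     (\<forall>X\<in>qcar Q I. \<forall>Y\<in>qcar Q I.
        D (qmult Q I X Y) = qadd I (qmult Q I (D X) Y) (qmult Q I X (D Y)))"

text \<open>Inner derivations [A,-].\<close>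
definition inner_qder :: "('v,'a) quiver \<Rightarrow> (('v,'a) qpath \<Rightarrow> 'k::field) set
     \<Rightarrow> ('v,'a,'k) qder \<Rightarrow> bool" where
  "inner_qder Q I D \<longleftrightarrow> (\<exists>A\<in>qcar Q I. \<forall>X\<in>qcar Q I.
      D X = qadd I (qmult Q I A X) (qsmult I (-1) (qmult Q I X A)))"

text \<open>Linear combination of (finitely many) derivations.\<close>
definition qcomb :: "(('v,'a) qpath \<Rightarrow> 'k::field) set \<Rightarrow> ('v,'a,'k) qder set
     \<Rightarrow> (('v,'a,'k) qder \<Rightarrow> 'k) \<Rightarrow> ('v,'a,'k) qder" where
  "qcomb I F c = (\<lambda>X. cls I (\<lambda>p. \<Sum>D\<in>F. c D * qrep (D X) p))"

text \<open>The classes of the elements of S form a k-basis of HH^1 = Der / Inn.\<close>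
definition hh1_basis :: "('v,'a) quiver \<Rightarrow> (('v,'a) qpath \<Rightarrow> 'k::field) set
     \<Rightarrow> ('v,'a,'k) qder set \<Rightarrow> bool" where
  "hh1_basis Q I S \<longleftrightarrow>
     (\<forall>D\<in>S. is_qder Q I D) \<and>
     (\<forall>F c. finite F \<and> F \<subseteq> S \<and> inner_qder Q I (qcomb I F c) \<longrightarrow> (\<forall>D\<in>F. c D = 0)) \<and>
     (\<forall>D. is_qder Q I D \<longrightarrow> (\<exists>F c. finite F \<and> F \<subseteq> S \<and>
         inner_qder Q I (\<lambda>X. qadd I (D X) (qsmult I (-1) (qcomb I F c X)))))"

section \<open>The derivations D_{r,s}\<close>

text \<open>The unique k-linear map D : k\<Gamma> \<rightarrow> k\<Gamma>/I with D(xy) = D(x) y + x D(y),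
  D(r) = s, vanishing on the other arrows and the vertices.\<close>
definition Dmap :: "('v,'a) quiver \<Rightarrow> (('v,'a) qpath \<Rightarrow> 'k::field) set \<Rightarrow> 'a
     \<Rightarrow> ('v,'a) qpath \<Rightarrow> (('v,'a) qpath \<Rightarrow> 'k) \<Rightarrow> (('v,'a) qpath \<Rightarrow> 'k) set" where
  "Dmap Q I r s = (THE D.
      (\<forall>x\<in>kG Q. D x \<in> qcar Q I) \<and>
      (\<forall>x\<in>kG Q. \<forall>y\<in>kG Q. D (\<lambda>p. x p + y p) = qadd I (D x) (D y)) \<and>
      (\<forall>c. \<forall>x\<in>kG Q. D (\<lambda>p. c * x p) = qsmult I c (D x)) \<and>
      (\<forall>x\<in>kG Q. \<forall>y\<in>kG Q. D (pmult Q x y) = qadd I (qmult Q I (D x) (cls I y)) (qmult Q I (cls I x) (D y))) \<and>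
      D (pel (apath Q r)) = cls I (pel s) \<and>
      (\<forall>a\<in>qarrs Q - {r}. D (pel (apath Q a)) = cls I (\<lambda>_. 0)) \<and>
      (\<forall>v\<in>qverts Q. D (pel (v, [])) = cls I (\<lambda>_. 0)) \<and>
      (\<forall>x. x \<notin> kG Q \<longrightarrow> D x = {}))"

text \<open>The induced derivation of k\<Gamma>/I (restricted to k\<Gamma>/I).\<close>
definition Dbar :: "('v,'a) quiver \<Rightarrow> (('v,'a) qpath \<Rightarrow> 'k::field) set \<Rightarrow> 'a
     \<Rightarrow> ('v,'a) qpath \<Rightarrow> ('v,'a,'k) qder" where
  "Dbar Q I r s = restrict (\<lambda>X. Dmap Q I r s (qrep X)) (qcar Q I)"

definition B2 :: "('v,'a) quiver \<Rightarrow> (('v,'a) qpath \<Rightarrow> 'k::field) set \<Rightarrow> ('v,'a,'k) qder set" where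
  "B2 Q I = {Dbar Q I r s | r s. r \<in> qarrs Q \<and> is_qpath Q s \<and> pel s \<notin> I \<and> qparallel Q (apath Q r) s}"

definition BE :: "('v,'a) quiver \<Rightarrow> (('v,'a) qpath \<Rightarrow> 'k::field) set \<Rightarrow> ('v,'a,'k) qder set" where
  "BE Q I = {Dbar Q I p (apath Q p) | p. p \<in> qarrs Q}"

section \<open>Plane embeddings, faces and the face derivations\<close>

text \<open>The plane R^2 is identified with \<complex>. Vertices go to distinct points, arrows to
  simple arcs from t(a) to h(a) whose interiors avoid the vertices and each other.\<close>
definition is_plane_embedding :: "('v,'a) quiver \<Rightarrow> ('v \<Rightarrow> complex) \<Rightarrow> ('a \<Rightarrow> real \<Rightarrow> complex) \<Rightarrow> bool" where
  "is_plane_embedding Q vpos earc \<longleftrightarrow>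
     inj_on vpos (qverts Q) \<and>
     (\<forall>a\<in>qarrs Q. path (earc a) \<and> inj_on (earc a) {0..1} \<and>
        pathstart (earc a) = vpos (qsrc Q a) \<and> pathfinish (earc a) = vpos (qtgt Q a) \<and>
        (\<forall>s\<in>{0<..<1}. earc a s \<notin> vpos ` qverts Q)) \<and>
     (\<forall>a\<in>qarrs Q. \<forall>b\<in>qarrs Q. a \<noteq> b \<longrightarrow> earc a ` {0<..<1} \<inter> earc b ` {0<..<1} = {})"

definition emb_image :: "('v,'a) quiver \<Rightarrow> ('v \<Rightarrow> complex) \<Rightarrow> ('a \<Rightarrow> real \<Rightarrow> complex) \<Rightarrow> complex set" where
  "emb_image Q vpos earc = vpos ` qverts Q \<union> (\<Union>a\<in>qarrs Q. path_image (earc a))"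

definition faces :: "('v,'a) quiver \<Rightarrow> ('v \<Rightarrow> complex) \<Rightarrow> ('a \<Rightarrow> real \<Rightarrow> complex) \<Rightarrow> complex set set" where
  "faces Q vpos earc = components (- emb_image Q vpos earc)"

text \<open>Faces other than the unbounded face f_0.\<close>
definition bounded_faces :: "('v,'a) quiver \<Rightarrow> ('v \<Rightarrow> complex) \<Rightarrow> ('a \<Rightarrow> real \<Rightarrow> complex) \<Rightarrow> complex set set" where
  "bounded_faces Q vpos earc = {f \<in> faces Q vpos earc. bounded f}"

text \<open>Sides of an arc: the winding number of the arc jumps by +1 when crossing it from
  its right side to its left side.  The face f lies on the right (left) of the arrow a if
  arbitrarily close to some interior point of the arc there are points z of f and
  points w off the graph on the other side.\<close>
definition face_right_of :: "('v,'a) quiver \<Rightarrow> ('v \<Rightarrow> complex) \<Rightarrow> ('a \<Rightarrow> real \<Rightarrow> complex)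
     \<Rightarrow> 'a \<Rightarrow> complex set \<Rightarrow> bool" where
  "face_right_of Q vpos earc a f \<longleftrightarrow> (\<exists>s\<in>{0<..<1}. \<forall>e>0. \<exists>z\<in>f. \<exists>w.
      w \<notin> emb_image Q vpos earc \<and> dist z (earc a s) < e \<and> dist w (earc a s) < e \<and>
      cmod (winding_number (earc a) w - winding_number (earc a) z - 1) < 1/2)"

definition face_left_of :: "('v,'a) quiver \<Rightarrow> ('v \<Rightarrow> complex) \<Rightarrow> ('a \<Rightarrow> real \<Rightarrow> complex)
     \<Rightarrow> 'a \<Rightarrow> complex set \<Rightarrow> bool" where
  "face_left_of Q vpos earc a f \<longleftrightarrow> (\<exists>s\<in>{0<..<1}. \<forall>e>0. \<exists>z\<in>f. \<exists>w.
      w \<notin> emb_image Q vpos earc \<and> dist z (earc a s) < e \<and> dist w (earc a s) < e \<and>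
      cmod (winding_number (earc a) z - winding_number (earc a) w - 1) < 1/2)"

text \<open>Total coefficient of D_{a,a} in D_{p_f}: an arrow running clockwise around f
  (i.e. with f on its right) contributes +1, counterclockwise -1; an arrow bordering f on
  both sides occurs twice in the boundary walk, once each way, contributing 0.\<close>
definition face_sign :: "('v,'a) quiver \<Rightarrow> ('v \<Rightarrow> complex) \<Rightarrow> ('a \<Rightarrow> real \<Rightarrow> complex)
     \<Rightarrow> 'a \<Rightarrow> complex set \<Rightarrow> 'k::field" where
  "face_sign Q vpos earc a f =
     (if face_right_of Q vpos earc a f then 1 else 0) - (if face_left_of Q vpos earc a f then 1 else 0)"

definition Dface :: "('v,'a) quiver \<Rightarrow> (('v,'a) qpath \<Rightarrow> 'k::field) set \<Rightarrow> ('v \<Rightarrow> complex)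
     \<Rightarrow> ('a \<Rightarrow> real \<Rightarrow> complex) \<Rightarrow> complex set \<Rightarrow> ('v,'a,'k) qder" where
  "Dface Q I vpos earc f = restrict (\<lambda>X. cls I (\<lambda>q. \<Sum>a\<in>qarrs Q.
       face_sign Q vpos earc a f * qrep (Dbar Q I a (apath Q a) X) q)) (qcar Q I)"

definition BP :: "('v,'a) quiver \<Rightarrow> (('v,'a) qpath \<Rightarrow> 'k::field) set \<Rightarrow> ('v \<Rightarrow> complex)
     \<Rightarrow> ('a \<Rightarrow> real \<Rightarrow> complex) \<Rightarrow> ('v,'a,'k) qder set" where
  "BP Q I vpos earc = Dface Q I vpos earc ` bounded_faces Q vpos earc"

end

theory Submission
  imports Defs "HOL-Library.Function_Algebras"
begin

text \<open>Paths outside the monomial ideal \<open>I\<close> give a basis of \<open>k\<Gamma>/I\<close>. Modulo inner derivations a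
  derivation kills the vertices and then sends each arrow to a combination of parallel paths; by
  acyclicity the inner derivations that kill the vertices are the coboundaries
  \<open>\<Sum>a. (\<phi> (t a) - \<phi> (h a)) D_{a,a}\<close>. So \<open>HH^1\<close> is spanned freely by the
  \<open>D_{r,s}\<close> with \<open>s \<noteq> r\<close> together with \<open>k^E\<close> modulo coboundaries, and what remains is that the
  signed boundaries of the bounded faces form a basis of this quotient.

  Over the reals the face boundaries span the space of circulations, which is the orthogonal
  complement of the coboundaries: a circulation \<open>y\<close> yields \<open>\<Sum>b. y b * wn b\<close>, a locally constant function
  off the drawing whose jump across the arrow \<open>a\<close> is \<open>y a\<close>; conversely every locally constant
  function off the drawing is of this form up to a constant, by adding the arrows one at a time and
  applying Janiszewski's theorem and the Jordan curve theorem. As the boundary matrices are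
  integral, additive maps \<open>k \<Rightarrow> real\<close> transfer both independence and spanning to any field of
  characteristic zero.\<close>

section \<open>The path algebra\<close>

text \<open>Algebra and plane meet only in the signs of arrows around bounded faces: there are
  finitely many such faces, their signed boundaries are independent modulo coboundaries, and
  together with the coboundaries they span. Both linear statements end with a vanishing sum of
  squares, which over a general k would not force the terms to vanish; hence the detour through the
  reals. On the algebraic side, completeness lets D_{r,s} descend to the quotient, and
  \<open>I \<subseteq> Rad2 Q\<close> keeps all vertices and arrows nonzero there. On the plane
  side, the boundary walk of a face is never constructed. The winding number of one arc varies
  continuously off the arc, but a combination of arcs with zero net flow at every vertex has its
  variable parts cancel, so it behaves like the winding number of a closed curve. A sign is then the
  difference of the indicator of the face at two points, one on each side of the arrow. Finiteness
  of the set of faces is a consequence rather than a starting point: independence is shown for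
  finite sets of bounded faces, and it forces every bounded face to lie beside some arrow.\<close>

lemma is_qpath_Nil [simp]: "is_qpath Q (v, []) \<longleftrightarrow> v \<in> qverts Q"
  unfolding is_qpath_def by simp

lemma pend_Nil [simp]: "pend Q (v, []) = v" and pend_Cons [simp]: "pend Q (v, a # xs) = pend Q (qtgt Q a, xs)"
  unfolding pend_def by auto

lemma pend_append: "pend Q (v, xs @ ys) = pend Q (pend Q (v, xs), ys)"
  by (induction xs arbitrary: v) auto

text \<open>The vertex at a cut is the end of the prefix; in this form the product formula is
  accessible to \<open>pend_append\<close> and to induction over lists.\<close>

lemma vert_at_pend: "i \<le> length (snd p) \<Longrightarrow> vert_at Q p i = pend Q (fst p, take i (snd p))"
  unfolding vert_at_def pend_def by (auto simp: take_Suc_conv_app_nth last_conv_nth)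

lemma finite_sum_le_eq:
  fixes n :: nat and g :: "nat \<Rightarrow> 'k::comm_monoid_add"
  assumes "j \<le> n" "\<And>i. i \<le> n \<Longrightarrow> i \<noteq> j \<Longrightarrow> g i = 0"
  shows "(\<Sum>i\<le>n. g i) = g j"
  using sum.mono_neutral_right[of "{..n}" "{j}" g] assms by auto

locale fin_quiver =
  fixes Q :: "('v,'a) quiver"
  assumes wf: "quiver_wf Q"
begin

abbreviation "V \<equiv> qverts Q"
abbreviation "E \<equiv> qarrs Q"
abbreviation "src \<equiv> qsrc Q"
abbreviation "tgt \<equiv> qtgt Q"

lemma finite_V: "finite V" and finite_E: "finite E"
  and src_V: "a \<in> E \<Longrightarrow> src a \<in> V" and tgt_V: "a \<in> E \<Longrightarrow> tgt a \<in> V"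
  using wf unfolding quiver_wf_def by auto

lemma is_qpath_Cons [simp]: "is_qpath Q (v, a # xs) \<longleftrightarrow> a \<in> E \<and> src a = v \<and> is_qpath Q (tgt a, xs)"
proof
  assume p: "is_qpath Q (v, a # xs)"
  then have "a \<in> E" "src a = v" "set xs \<subseteq> E" unfolding is_qpath_def by auto
  moreover have "xs \<noteq> [] \<longrightarrow> src (hd xs) = tgt a"
    using p unfolding is_qpath_def by (auto simp: hd_conv_nth dest!: spec[of _ 0])
  moreover have "\<forall>i. Suc i < length xs \<longrightarrow> tgt (xs ! i) = src (xs ! Suc i)"
  proof (intro allI impI)
    fix i assume "Suc i < length xs"
    then show "tgt (xs ! i) = src (xs ! Suc i)" using p unfolding is_qpath_def by (auto dest!: spec[of _ "Suc i"])
  qed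
  ultimately show "a \<in> E \<and> src a = v \<and> is_qpath Q (tgt a, xs)"
    using tgt_V unfolding is_qpath_def by auto
next
  assume "a \<in> E \<and> src a = v \<and> is_qpath Q (tgt a, xs)"
  then show "is_qpath Q (v, a # xs)" using src_V unfolding is_qpath_def
    by (auto simp: nth_Cons hd_conv_nth split: nat.splits)
qed

lemma is_qpath_append: "is_qpath Q (v, xs @ ys) \<longleftrightarrow> is_qpath Q (v, xs) \<and> is_qpath Q (pend Q (v, xs), ys)"
proof (induction xs arbitrary: v)
  case Nil
  have "is_qpath Q (v, ys) \<Longrightarrow> v \<in> V" unfolding is_qpath_def by auto
  then show ?case by auto
qed auto

lemma is_qpath_split:
  assumes "is_qpath Q p"
  shows "is_qpath Q (fst p, take i (snd p))" "is_qpath Q (pend Q (fst p, take i (snd p)), drop i (snd p))"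
  using assms is_qpath_append[of "fst p" "take i (snd p)" "drop i (snd p)"] by auto

lemma is_qpath_apath: "a \<in> E \<Longrightarrow> is_qpath Q (apath Q a)"
  unfolding apath_def using tgt_V by simp

lemma pmult_eq:
  "is_qpath Q p \<Longrightarrow> pmult Q x y p =
    (\<Sum>i\<le>length (snd p). x (fst p, take i (snd p)) * y (pend Q (fst p, take i (snd p)), drop i (snd p)))"
  unfolding pmult_def by (auto simp: vert_at_pend intro!: sum.cong)

lemma pmult_not_path: "\<not> is_qpath Q p \<Longrightarrow> pmult Q x y p = 0"
  unfolding pmult_def by simp

text \<open>A nonzero convolution sum has a nonzero summand, that is, a factorisation of
  \<open>p\<close> into paths of the two supports. Most support arguments below go through this rule
  instead of through the sum.\<close>

lemma pmult_nonzeroE: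
  assumes "pmult Q x y p \<noteq> 0"
  obtains q r where "is_qpath Q p" "x q \<noteq> 0" "y r \<noteq> 0" "p = (fst q, snd q @ snd r)" "pend Q q = fst r"
    "is_qpath Q q" "is_qpath Q r"
proof -
  have p: "is_qpath Q p" using assms pmult_not_path by blast
  then obtain i where "i \<le> length (snd p)"
    "x (fst p, take i (snd p)) * y (pend Q (fst p, take i (snd p)), drop i (snd p)) \<noteq> 0"
    using assms unfolding pmult_eq[OF p] by (metis (no_types, lifting) atMost_iff sum.neutral)
  then show ?thesis
    using that[of "(fst p, take i (snd p))" "(pend Q (fst p, take i (snd p)), drop i (snd p))"] p is_qpath_split[OF p]
    by auto
qed

lemma pmult_add_left: "pmult Q (\<lambda>p. x p + y p) z = (\<lambda>p. pmult Q x z p + pmult Q y z p)"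
  unfolding pmult_def by (auto simp: fun_eq_iff ring_distribs sum.distrib)

lemma pmult_add_right: "pmult Q x (\<lambda>p. y p + z p) = (\<lambda>p. pmult Q x y p + pmult Q x z p)"
  unfolding pmult_def by (auto simp: fun_eq_iff ring_distribs sum.distrib)

lemma pmult_scale_left: "pmult Q (\<lambda>p. c * x p) z = (\<lambda>p. c * pmult Q x z p)"
  unfolding pmult_def by (auto simp: fun_eq_iff mult.assoc sum_distrib_left)

lemma pmult_scale_right: "pmult Q x (\<lambda>p. c * y p) = (\<lambda>p. c * pmult Q x y p)"
  unfolding pmult_def by (auto simp: fun_eq_iff mult.left_commute sum_distrib_left)

lemma pmult_zero_left: "pmult Q (\<lambda>_. 0) y = (\<lambda>_. 0)" and pmult_zero_right: "pmult Q x (\<lambda>_. 0) = (\<lambda>_. 0)"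
  unfolding pmult_def by auto

text \<open>Here \<open>j \<le> i\<close> are two cut positions of a path. The right side runs over
  the first cut \<open>j\<close> and the length \<open>k = i - j\<close> of the middle
  piece.\<close>

lemma sum_split_assoc:
  fixes f :: "nat \<Rightarrow> nat \<Rightarrow> 'k::comm_monoid_add"
  shows "(\<Sum>i\<le>n. \<Sum>j\<le>i. f j i) = (\<Sum>j\<le>n. \<Sum>k\<le>n-j. f j (j + k))"
  unfolding sum.Sigma[OF finite_atMost ballI[OF finite_atMost]]
  by (rule sum.reindex_bij_witness[of _ "\<lambda>(j, k). (j + k, j)" "\<lambda>(i, j). (j, i - j)"]) auto

text \<open>Both sides sum over all ways to cut \<open>p\<close> into three consecutive
  pieces.\<close>

lemma pmult_assoc: "pmult Q (pmult Q x y) z = pmult Q x (pmult Q y z)"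
proof
  fix p
  show "pmult Q (pmult Q x y) z p = pmult Q x (pmult Q y z) p"
  proof (cases "is_qpath Q p")
    case True
    obtain v xs where p: "p = (v, xs)" by force
    let ?n = "length xs"
    let ?e = "\<lambda>i. pend Q (v, take i xs)"
    let ?f = "\<lambda>j i. x (v, take j xs) * y (?e j, drop j (take i xs)) * z (?e i, drop i xs)"
    have sp: "is_qpath Q (v, take i xs)" "is_qpath Q (?e i, drop i xs)" for i
      using is_qpath_split[OF True, of i] p by auto
    have "pmult Q (pmult Q x y) z p = (\<Sum>i\<le>?n. pmult Q x y (v, take i xs) * z (?e i, drop i xs))"
      using pmult_eq[OF True, of "pmult Q x y" z] unfolding p by simp
    also have "\<dots> = (\<Sum>i\<le>?n. \<Sum>j\<le>i. ?f j i)"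
      by (intro sum.cong refl) (simp add: pmult_eq[OF sp(1)] sum_distrib_right min_absorb1 min_absorb2)
    also have "\<dots> = (\<Sum>j\<le>?n. \<Sum>k\<le>?n - j. ?f j (j + k))" by (rule sum_split_assoc)
    also have "\<dots> = (\<Sum>j\<le>?n. x (v, take j xs) * pmult Q y z (?e j, drop j xs))"
    proof (intro sum.cong refl)
      fix j assume "j \<in> {..?n}"
      have "pend Q (?e j, take k (drop j xs)) = ?e (j + k)" for k
        unfolding pend_append[symmetric] take_add ..
      then show "(\<Sum>k\<le>?n - j. ?f j (j + k)) = x (v, take j xs) * pmult Q y z (?e j, drop j xs)"
        by (simp add: pmult_eq[OF sp(2)] sum_distrib_left mult.assoc drop_take add.commute)
    qed
    also have "\<dots> = pmult Q x (pmult Q y z) p"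
      using pmult_eq[OF True, of x "pmult Q y z"] unfolding p by simp
    finally show ?thesis .
  qed (simp add: pmult_not_path)
qed

lemma pmult_pel:
  assumes "is_qpath Q p" "is_qpath Q q" "pend Q p = fst q"
  shows "pmult Q (pel p) (pel q) = pel (fst p, snd p @ snd q)"
proof
  fix r
  have path: "is_qpath Q (fst p, snd p @ snd q)" using assms is_qpath_append[of "fst p" "snd p" "snd q"] by simp
  show "pmult Q (pel p) (pel q) r = (pel (fst p, snd p @ snd q) :: _ \<Rightarrow> 'b::field) r"
  proof (cases "r = (fst p, snd p @ snd q)")
    case True
    have "pmult Q (pel p) (pel q) r = pel p (fst r, take (length (snd p)) (snd r)) *
       (pel q (pend Q (fst r, take (length (snd p)) (snd r)), drop (length (snd p)) (snd r)) :: 'b)"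
      unfolding pmult_eq[OF path, folded True]
    proof (rule finite_sum_le_eq)
      fix i assume i: "i \<le> length (snd r)" "i \<noteq> length (snd p)"
      then have "length (take i (snd r)) \<noteq> length (snd p)" by simp
      then have "(fst r, take i (snd r)) \<noteq> p" by auto
      then show "pel p (fst r, take i (snd r)) * pel q (pend Q (fst r, take i (snd r)), drop i (snd r)) = (0::'b)"
        unfolding pel_def by auto
    qed (use True in auto)
    also have "\<dots> = 1" unfolding True pel_def using assms(3) by simp
    finally show ?thesis unfolding pel_def using True by simp
  next
    case False
    have "pmult Q (pel p) (pel q) r = (0::'b)"
    proof (rule ccontr)
      assume "pmult Q (pel p) (pel q) r \<noteq> (0::'b)"
      then show False
        by (rule pmult_nonzeroE) (use False in \<open>auto simp: pel_def split: if_splits\<close>)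
    qed
    then show ?thesis unfolding pel_def using False by simp
  qed
qed

lemma pmult_pel_vertex_right:
  assumes "is_qpath Q p" shows "pmult Q x (pel (v, [])) p = x p * of_bool (pend Q p = v)"
proof -
  have "pmult Q x (pel (v, [])) p = x (fst p, take (length (snd p)) (snd p)) *
     pel (v, []) (pend Q (fst p, take (length (snd p)) (snd p)), drop (length (snd p)) (snd p))"
    unfolding pmult_eq[OF assms] by (rule finite_sum_le_eq) (auto simp: pel_def)
  then show ?thesis by (simp add: pel_def)
qed

lemma pmult_pel_vertex_left:
  assumes "is_qpath Q p" shows "pmult Q (pel (v, [])) x p = x p * of_bool (fst p = v)"
proof -
  have "pmult Q (pel (v, [])) x p = pel (v, []) (fst p, take 0 (snd p)) *
     x (pend Q (fst p, take 0 (snd p)), drop 0 (snd p))"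
    unfolding pmult_eq[OF assms] by (rule finite_sum_le_eq) (auto simp: pel_def)
  then show ?thesis by (simp add: pel_def)
qed

lemma kG_zero: "(\<lambda>_. 0) \<in> kG Q" unfolding kG_def by simp

lemma kG_add: "x \<in> kG Q \<Longrightarrow> y \<in> kG Q \<Longrightarrow> (\<lambda>p. x p + y p) \<in> kG Q"
  unfolding kG_def by (auto intro: finite_subset[of _ "{p. x p \<noteq> 0} \<union> {p. y p \<noteq> 0}"] split: if_splits) force+

lemma kG_scale: "x \<in> kG Q \<Longrightarrow> (\<lambda>p. c * x p) \<in> kG Q"
  unfolding kG_def by (auto intro: finite_subset[of _ "{p. x p \<noteq> 0}"])

lemma kG_pel: "is_qpath Q p \<Longrightarrow> pel p \<in> kG Q"
  unfolding kG_def pel_def by (auto split: if_splits)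

lemma kG_sum: "(\<And>i. i \<in> S \<Longrightarrow> x i \<in> kG Q) \<Longrightarrow> (\<lambda>p. \<Sum>i\<in>S. c i * x i p) \<in> kG Q"
  by (induction S rule: infinite_finite_induct) (auto simp: kG_zero intro!: kG_add kG_scale)

lemma kG_pmult:
  assumes "x \<in> kG Q" "y \<in> kG Q" shows "pmult Q x y \<in> kG Q"
proof -
  have "{p. pmult Q x y p \<noteq> 0} \<subseteq> (\<lambda>(q, r). (fst q, snd q @ snd r)) ` ({p. x p \<noteq> 0} \<times> {p. y p \<noteq> 0})"
  proof
    fix p assume "p \<in> {p. pmult Q x y p \<noteq> 0}"
    then have "pmult Q x y p \<noteq> 0" by simp
    then show "p \<in> (\<lambda>(q, r). (fst q, snd q @ snd r)) ` ({p. x p \<noteq> 0} \<times> {p. y p \<noteq> 0})"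
      by (rule pmult_nonzeroE) force
  qed
  then have "finite {p. pmult Q x y p \<noteq> 0}"
    using assms finite_surj[of "{p. x p \<noteq> 0} \<times> {p. y p \<noteq> 0}"] unfolding kG_def by blast
  then show ?thesis using pmult_not_path unfolding kG_def by blast
qed

text \<open>An induction principle for linear closure. Only the paths in the support of
  \<open>x\<close> have to be treated, which is what makes it fit monomial ideals.\<close>

lemma kG_span:
  assumes x: "x \<in> kG Q" and zero: "(\<lambda>_. 0) \<in> J"
    and add: "\<And>x y. x \<in> J \<Longrightarrow> y \<in> J \<Longrightarrow> (\<lambda>p. x p + y p) \<in> J"
    and scale: "\<And>c x. x \<in> J \<Longrightarrow> (\<lambda>p. c * x p) \<in> J"
    and pel: "\<And>p. is_qpath Q p \<Longrightarrow> x p \<noteq> 0 \<Longrightarrow> pel p \<in> J"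
  shows "x \<in> J"
proof -
  have fin: "finite {p. x p \<noteq> 0}" using x unfolding kG_def by auto
  have "(\<lambda>q. \<Sum>p\<in>S. x p * pel p q) \<in> J" if "finite S" "S \<subseteq> {p. x p \<noteq> 0}" for S
    using that
  proof (induction S rule: finite_induct)
    case (insert p S)
    have "x p \<noteq> 0" using insert.prems by auto
    moreover have "is_qpath Q p" using calculation x unfolding kG_def by blast
    ultimately show ?case using insert by (auto intro!: add scale pel)
  qed (use zero in simp)
  from this[OF fin subset_refl] have "(\<lambda>q. \<Sum>p\<in>{p. x p \<noteq> 0}. x p * pel p q) \<in> J" .
  moreover have "(\<Sum>p\<in>{p. x p \<noteq> 0}. x p * pel p q) = x q" for q
  proof -
    have "(\<Sum>p\<in>{p. x p \<noteq> 0}. x p * pel p q) = (\<Sum>p\<in>{p. x p \<noteq> 0}. if p = q then x q else 0)"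
      unfolding pel_def by (rule sum.cong) auto
    then show ?thesis using fin by simp
  qed
  ultimately show ?thesis by simp
qed

text \<open>Concatenation does not shorten paths. As \<open>gen_ideal\<close> is an intersection,
  these ideals for \<open>n = 1\<close> and \<open>n = 2\<close> bound \<open>Rad\<close> and
  \<open>Rad2\<close> from above.\<close>

lemma long_ideal: "is_ideal Q {x\<in>kG Q. \<forall>p. length (snd p) < n \<longrightarrow> x p = (0::'k::field)}"
  unfolding is_ideal_def
proof (intro conjI ballI allI)
  fix x a :: "('v,'a) qpath \<Rightarrow> 'k"
  assume x: "x \<in> {x\<in>kG Q. \<forall>p. length (snd p) < n \<longrightarrow> x p = 0}" and a: "a \<in> kG Q"
  have x0: "x p = 0" if "length (snd p) < n" for p using x that by blast
  have "pmult Q a x p = 0" if "length (snd p) < n" for p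
  proof (rule ccontr)
    assume "pmult Q a x p \<noteq> 0"
    then show False by (rule pmult_nonzeroE) (use that x0 in auto)
  qed
  moreover have "pmult Q x a p = 0" if "length (snd p) < n" for p
  proof (rule ccontr)
    assume "pmult Q x a p \<noteq> 0"
    then show False by (rule pmult_nonzeroE) (use that x0 in auto)
  qed
  ultimately show "pmult Q a x \<in> {x\<in>kG Q. \<forall>p. length (snd p) < n \<longrightarrow> x p = 0}"
    "pmult Q x a \<in> {x\<in>kG Q. \<forall>p. length (snd p) < n \<longrightarrow> x p = 0}"
    using x a kG_pmult by auto
qed (auto simp: kG_zero kG_add kG_scale)

lemma Rad2_short:
  fixes x :: "('v,'a) qpath \<Rightarrow> 'k::field"
  assumes "x \<in> Rad2 Q" "length (snd p) < 2" shows "x p = 0"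
proof -
  let ?J = "\<lambda>n. {x\<in>kG Q. \<forall>p. length (snd p) < n \<longrightarrow> x p = (0::'k)}"
  have "Rad Q \<subseteq> ?J 1" unfolding Rad_def gen_ideal_def
  proof (rule Inter_lower, rule CollectI, rule conjI[OF long_ideal], rule subsetI)
    fix z :: "('v,'a) qpath \<Rightarrow> 'k"
    assume "z \<in> (\<lambda>a. pel (apath Q a)) ` E"
    then obtain a where a: "a \<in> E" "z = pel (apath Q a)" by auto
    then show "z \<in> ?J 1" using kG_pel[OF is_qpath_apath[OF a(1)]] by (auto simp: pel_def apath_def)
  qed
  then have R: "z \<in> kG Q" "z (v, []) = 0" if "z \<in> Rad Q" for z :: "('v,'a) qpath \<Rightarrow> 'k" and v
    using that by auto
  have "pmult Q y z p = 0" if "y \<in> Rad Q" "z \<in> Rad Q" "length (snd p) < 2"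
    for y z :: "('v,'a) qpath \<Rightarrow> 'k" and p
  proof (rule ccontr)
    assume "pmult Q y z p \<noteq> 0"
    then show False
    proof (rule pmult_nonzeroE)
      fix q r assume h: "y q \<noteq> 0" "z r \<noteq> 0" "p = (fst q, snd q @ snd r)"
      then have "snd q = [] \<or> snd r = []" using that(3) by (cases "snd q"; cases "snd r") auto
      then show False using h R(2)[OF that(1), of "fst q"] R(2)[OF that(2), of "fst r"]
        by (metis prod.collapse)
    qed
  qed
  note prod = this
  have "Rad2 Q \<subseteq> ?J 2" unfolding Rad2_def gen_ideal_def
  proof (rule Inter_lower, rule CollectI, rule conjI[OF long_ideal], rule subsetI)
    fix z :: "('v,'a) qpath \<Rightarrow> 'k"
    assume "z \<in> {pmult Q x y |x y. x \<in> Rad Q \<and> y \<in> Rad Q}"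
    then obtain x y where xy: "z = pmult Q x y" "x \<in> Rad Q" "y \<in> Rad Q" by blast
    then show "z \<in> ?J 2" using prod[OF xy(2,3)] kG_pmult[OF R(1)[OF xy(2)] R(1)[OF xy(3)]] by blast
  qed
  then show ?thesis using assms by blast
qed

end

section \<open>The quotient by a monomial ideal, in coordinates\<close>

locale monomial_quotient = fin_quiver Q for Q :: "('v,'a) quiver" +
  fixes I :: "(('v,'a) qpath \<Rightarrow> 'k::field) set"
  assumes idl: "is_ideal Q I" and pg: "path_generated Q I" and short: "I \<subseteq> Rad2 Q"
    and comp: "complete_rel Q I" and acyc: "acyclic_rel Q I"
begin

lemma I_kG: "x \<in> I \<Longrightarrow> x \<in> kG Q" and I_zero: "(\<lambda>_. 0) \<in> I"
  and I_add: "x \<in> I \<Longrightarrow> y \<in> I \<Longrightarrow> (\<lambda>p. x p + y p) \<in> I"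
  and I_scale: "x \<in> I \<Longrightarrow> (\<lambda>p. c * x p) \<in> I"
  and I_left: "x \<in> I \<Longrightarrow> y \<in> kG Q \<Longrightarrow> pmult Q y x \<in> I"
  and I_right: "x \<in> I \<Longrightarrow> y \<in> kG Q \<Longrightarrow> pmult Q x y \<in> I"
  using idl unfolding is_ideal_def by auto

text \<open>The paths with nonzero residue class; their classes are the basis of the quotient with
  respect to which all coordinates are taken.\<close>

definition N :: "('v,'a) qpath \<Rightarrow> bool" where
  "N p \<longleftrightarrow> is_qpath Q p \<and> pel p \<notin> I"

lemma pel_I_append:
  assumes "is_qpath Q (v, xs @ ys)" "pel (v, xs) \<in> I \<or> pel (pend Q (v, xs), ys) \<in> I"
  shows "pel (v, xs @ ys) \<in> I"
proof -
  have p: "is_qpath Q (v, xs)" "is_qpath Q (pend Q (v, xs), ys)" using assms(1) is_qpath_append by auto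
  have "(pel (v, xs @ ys) :: _ \<Rightarrow> 'k) = pmult Q (pel (v, xs)) (pel (pend Q (v, xs), ys))"
    using pmult_pel[OF p, symmetric] by simp
  then show ?thesis using assms(2) I_left I_right kG_pel p by metis
qed

lemma N_split:
  assumes "N p"
  shows "N (fst p, take i (snd p))" "N (pend Q (fst p, take i (snd p)), drop i (snd p))"
  using assms pel_I_append[of "fst p" "take i (snd p)" "drop i (snd p)"] is_qpath_split[of p i]
  unfolding N_def by auto

text \<open>The elements supported on paths of \<open>I\<close> form an ideal, by
  \<open>pel_I_append\<close>, and this ideal contains the generating paths; hence it contains
  \<open>I\<close>. So membership is decided path by path.\<close>

lemma mem_I_iff: "x \<in> I \<longleftrightarrow> x \<in> kG Q \<and> (\<forall>p. x p \<noteq> 0 \<longrightarrow> pel p \<in> I)"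
proof
  assume x: "x \<in> I"
  let ?J = "{x\<in>kG Q. \<forall>p. x p \<noteq> (0::'k) \<longrightarrow> pel p \<in> I}"
  obtain S where S: "\<forall>g\<in>S. is_qpath Q g" "I = gen_ideal Q (pel ` S)"
    using pg unfolding path_generated_def by blast
  have "is_ideal Q ?J" unfolding is_ideal_def
  proof (intro conjI ballI allI)
    fix x y assume x: "x \<in> ?J" and y: "y \<in> ?J"
    have "pel p \<in> I" if "x p + y p \<noteq> 0" for p
    proof (cases "x p = 0")
      case True then show ?thesis using that y by (metis (mono_tags, lifting) add_0 mem_Collect_eq)
    next
      case False then show ?thesis using x by blast
    qed
    then show "(\<lambda>p. x p + y p) \<in> ?J" using x y kG_add by auto
  next
    fix x a :: "('v,'a) qpath \<Rightarrow> 'k" assume x: "x \<in> ?J" and a: "a \<in> kG Q"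
    have "pel p \<in> I" if "pmult Q a x p \<noteq> 0" for p using that
      by (rule pmult_nonzeroE) (use x pel_I_append in \<open>metis (mono_tags, lifting) mem_Collect_eq prod.collapse\<close>)
    then show "pmult Q a x \<in> ?J" using x a kG_pmult by auto
    have "pel p \<in> I" if "pmult Q x a p \<noteq> 0" for p using that
      by (rule pmult_nonzeroE) (use x pel_I_append in \<open>metis (mono_tags, lifting) mem_Collect_eq prod.collapse\<close>)
    then show "pmult Q x a \<in> ?J" using x a kG_pmult by auto
  qed (auto simp: kG_zero kG_scale)
  moreover have "pel ` S \<subseteq> ?J"
  proof
    fix z :: "('v,'a) qpath \<Rightarrow> 'k" assume "z \<in> pel ` S"
    then obtain g where g: "g \<in> S" "z = pel g" by auto
    have "pel g \<in> I" unfolding S(2) gen_ideal_def using g(1) by auto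
    moreover have "p = g" if "pel g p \<noteq> (0::'k)" for p using that unfolding pel_def by (auto split: if_splits)
    moreover have "(pel g :: _ \<Rightarrow> 'k) \<in> kG Q" using S(1) g(1) by (intro kG_pel) auto
    ultimately show "z \<in> ?J" unfolding g(2) by blast
  qed
  ultimately have "gen_ideal Q (pel ` S) \<subseteq> ?J" unfolding gen_ideal_def by blast
  then have "I \<subseteq> ?J" using S(2) by simp
  then show "x \<in> kG Q \<and> (\<forall>p. x p \<noteq> 0 \<longrightarrow> pel p \<in> I)" using x by blast
next
  assume x: "x \<in> kG Q \<and> (\<forall>p. x p \<noteq> 0 \<longrightarrow> pel p \<in> I)"
  show "x \<in> I" by (rule kG_span) (use x I_zero I_add I_scale in auto)
qed

lemma I_N: "x \<in> I \<Longrightarrow> N p \<Longrightarrow> x p = 0"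
  using mem_I_iff unfolding N_def by blast

text \<open>This is the use of \<open>I \<subseteq> Rad2 Q\<close>: elements of \<open>Rad2\<close>
  have no coefficient on vertices and arrows.\<close>

lemma N_short: "is_qpath Q p \<Longrightarrow> length (snd p) < 2 \<Longrightarrow> N p"
  unfolding N_def using Rad2_short[of "pel p" p] short by (force simp: pel_def)

lemma N_vertex: "v \<in> V \<Longrightarrow> N (v, [])" by (rule N_short) auto
lemma N_arrow: "a \<in> E \<Longrightarrow> N (apath Q a)" using N_short[OF is_qpath_apath] by (simp add: apath_def)

lemma N_cycle: "N p \<Longrightarrow> fst p = pend Q p \<Longrightarrow> snd p = []"
  using acyc unfolding acyclic_rel_def N_def pstart_def by blast

text \<open>The value does not depend on the representative chosen by \<open>qrep\<close>: two
  representatives differ by an element of \<open>I\<close>, which vanishes on paths satisfying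
  \<open>N\<close>.\<close>

definition coords :: "(('v,'a) qpath \<Rightarrow> 'k) set \<Rightarrow> ('v,'a) qpath \<Rightarrow> 'k" where
  "coords X p = (if N p then qrep X p else 0)"

definition bas :: "('v,'a) qpath \<Rightarrow> (('v,'a) qpath \<Rightarrow> 'k) set" where
  "bas p = cls I (pel p)"

lemma qrep_cls: "\<exists>z\<in>I. qrep (cls I x) = (\<lambda>p. x p + z p)"
proof -
  have "x \<in> cls I x" unfolding cls_def using I_zero by (intro CollectI bexI[of _ "\<lambda>_. 0"]) auto
  then have "qrep (cls I x) \<in> cls I x" unfolding qrep_def by (rule someI[of "\<lambda>w. w \<in> cls I x"])
  then show ?thesis unfolding cls_def by blast
qed

lemma qrep_cls_kG: "x \<in> kG Q \<Longrightarrow> qrep (cls I x) \<in> kG Q"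
  using qrep_cls[of x] I_kG kG_add by metis

lemma coords_cls: "coords (cls I x) p = (if N p then x p else 0)"
  using qrep_cls[of x] I_N unfolding coords_def by fastforce

lemma coords_notN: "\<not> N p \<Longrightarrow> coords X p = 0" unfolding coords_def by simp

lemma cls_car: "x \<in> kG Q \<Longrightarrow> cls I x \<in> qcar Q I" unfolding qcar_def by auto

lemma cls_eq:
  assumes "x \<in> kG Q" "y \<in> kG Q" "\<And>p. N p \<Longrightarrow> x p = y p" shows "cls I x = cls I y"
proof -
  have *: "cls I x \<subseteq> cls I y" if "x \<in> kG Q" "y \<in> kG Q" "\<And>p. N p \<Longrightarrow> x p = y p" for x y
  proof
    fix w assume "w \<in> cls I x"
    then obtain z where z: "z \<in> I" "w = (\<lambda>p. x p + z p)" unfolding cls_def by blast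
    have "(\<lambda>p. x p + (-1) * y p) \<in> I"
    proof -
      have "(\<lambda>p. x p + (-1) * y p) \<in> kG Q" using that by (intro kG_add kG_scale)
      moreover have "pel p \<in> I" if "x p + (-1) * y p \<noteq> 0" for p
      proof -
        have "is_qpath Q p" using calculation that unfolding kG_def by blast
        then show ?thesis using that \<open>\<And>p. N p \<Longrightarrow> x p = y p\<close>[of p] unfolding N_def by auto
      qed
      ultimately show ?thesis using mem_I_iff[of "\<lambda>p. x p + (-1) * y p"] by blast
    qed
    from I_add[OF this z(1)] have "(\<lambda>p. x p + (-1) * y p + z p) \<in> I" .
    moreover have "w = (\<lambda>p. y p + (x p + (-1) * y p + z p))" using z(2) by (simp add: fun_eq_iff)
    ultimately show "w \<in> cls I y" unfolding cls_def
      by (intro CollectI bexI[of _ "\<lambda>p. x p + (-1) * y p + z p"])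
  qed
  show ?thesis using *[OF assms] *[OF assms(2,1)] assms(3) by auto
qed

lemma qrep_kG: "X \<in> qcar Q I \<Longrightarrow> qrep X \<in> kG Q"
  unfolding qcar_def using qrep_cls_kG by auto

lemma coords_kG: "X \<in> qcar Q I \<Longrightarrow> coords X \<in> kG Q"
  using qrep_kG[of X] unfolding kG_def coords_def N_def
  by (auto intro: finite_subset[of _ "{p. qrep X p \<noteq> 0}"] split: if_splits)

lemma cls_coords: "X \<in> qcar Q I \<Longrightarrow> cls I (coords X) = X"
proof -
  assume "X \<in> qcar Q I"
  then obtain x where x: "x \<in> kG Q" "X = cls I x" unfolding qcar_def by auto
  show ?thesis unfolding x(2)
    using x coords_kG[OF cls_car[OF x(1)]] by (intro cls_eq) (auto simp: coords_cls)
qed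

lemma qcar_eqI: "X \<in> qcar Q I \<Longrightarrow> Y \<in> qcar Q I \<Longrightarrow> (\<And>p. N p \<Longrightarrow> coords X p = coords Y p) \<Longrightarrow> X = Y"
  using cls_coords coords_notN by (metis ext)

lemma qadd_car: "X \<in> qcar Q I \<Longrightarrow> Y \<in> qcar Q I \<Longrightarrow> qadd I X Y \<in> qcar Q I"
  and qsmult_car: "X \<in> qcar Q I \<Longrightarrow> qsmult I c X \<in> qcar Q I"
  and qmult_car: "X \<in> qcar Q I \<Longrightarrow> Y \<in> qcar Q I \<Longrightarrow> qmult Q I X Y \<in> qcar Q I"
  unfolding qadd_def qsmult_def qmult_def by (auto intro!: cls_car kG_add kG_scale kG_pmult qrep_kG)

lemma coords_qadd: "coords (qadd I X Y) p = coords X p + coords Y p"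
  unfolding qadd_def coords_cls by (simp add: coords_def)

lemma coords_qsmult: "coords (qsmult I c X) p = c * coords X p"
  unfolding qsmult_def coords_cls by (simp add: coords_def)

text \<open>The coefficient at \<open>p\<close> involves only subpaths of \<open>p\<close>, and
  these satisfy \<open>N\<close> when \<open>p\<close> does. Hence products in the quotient can be
  computed from coordinates.\<close>

lemma pmult_cong_N:
  assumes "N p" "\<And>q. N q \<Longrightarrow> x q = x' q" "\<And>q. N q \<Longrightarrow> y q = y' q"
  shows "pmult Q x y p = pmult Q x' y' p"
proof -
  have "is_qpath Q p" using assms(1) unfolding N_def by auto
  then show ?thesis using N_split[OF assms(1)] assms(2,3) by (simp add: pmult_eq)
qed

lemma coords_qmult: "coords (qmult Q I X Y) p = (if N p then pmult Q (coords X) (coords Y) p else 0)"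
  unfolding qmult_def coords_cls by (auto simp: coords_def intro!: pmult_cong_N)

lemma coords_bas: "coords (bas p) q = (if N q then pel p q else 0)"
  unfolding bas_def coords_cls ..

lemma coords_bas_N: "N p \<Longrightarrow> coords (bas p) = pel p"
  unfolding fun_eq_iff coords_bas pel_def by auto

lemma bas_car: "is_qpath Q p \<Longrightarrow> bas p \<in> qcar Q I"
  unfolding bas_def by (intro cls_car kG_pel)

lemma cls_add: "x \<in> kG Q \<Longrightarrow> y \<in> kG Q \<Longrightarrow> cls I (\<lambda>p. x p + y p) = qadd I (cls I x) (cls I y)"
  by (rule qcar_eqI) (auto intro: cls_car kG_add qadd_car simp: coords_qadd coords_cls)

lemma cls_scale: "x \<in> kG Q \<Longrightarrow> cls I (\<lambda>p. c * x p) = qsmult I c (cls I x)"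
  by (rule qcar_eqI) (auto intro: cls_car kG_scale qsmult_car simp: coords_qsmult coords_cls)

lemma cls_mult: "x \<in> kG Q \<Longrightarrow> y \<in> kG Q \<Longrightarrow> cls I (pmult Q x y) = qmult Q I (cls I x) (cls I y)"
  by (rule qcar_eqI) (auto intro!: cls_car kG_pmult qmult_car pmult_cong_N simp: coords_qmult coords_cls)

lemma bas_Cons:
  assumes "is_qpath Q (v, a # xs)"
  shows "bas (v, a # xs) = qmult Q I (bas (apath Q a)) (bas (tgt a, xs))"
proof -
  have "(pel (v, a # xs) :: _ \<Rightarrow> 'k) = pmult Q (pel (apath Q a)) (pel (tgt a, xs))"
    using pmult_pel[OF is_qpath_apath, of a "(tgt a, xs)", symmetric] assms by (simp add: apath_def)
  then show ?thesis unfolding bas_def using assms cls_mult[OF kG_pel[OF is_qpath_apath] kG_pel, of a "(tgt a, xs)"] by simp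
qed

section \<open>Derivations of the quotient\<close>

definition qlinear :: "('v,'a,'k) qder \<Rightarrow> bool" where
  "qlinear D \<longleftrightarrow> (\<forall>X\<in>qcar Q I. D X \<in> qcar Q I) \<and>
     (\<forall>X\<in>qcar Q I. \<forall>Y\<in>qcar Q I. D (qadd I X Y) = qadd I (D X) (D Y)) \<and>
     (\<forall>c. \<forall>X\<in>qcar Q I. D (qsmult I c X) = qsmult I c (D X))"

lemma is_qder_iff: "is_qder Q I D \<longleftrightarrow> qlinear D \<and> (\<forall>X\<in>qcar Q I. \<forall>Y\<in>qcar Q I.
        D (qmult Q I X Y) = qadd I (qmult Q I (D X) Y) (qmult Q I X (D Y)))"
  unfolding is_qder_def qlinear_def by blast

lemma qlinear_eqI:
  assumes D: "qlinear D" and D': "qlinear D'" and eq: "\<And>p. is_qpath Q p \<Longrightarrow> D (bas p) = D' (bas p)"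
    and X: "X \<in> qcar Q I"
  shows "D X = D' X"
proof -
  let ?J = "{x\<in>kG Q. D (cls I x) = D' (cls I x)}"
  have "x \<in> ?J" if "x \<in> kG Q" for x
  proof (rule kG_span[OF that])
    have "cls I (\<lambda>_. 0) = qsmult I 0 (cls I (\<lambda>_. 0))" using cls_scale[OF kG_zero, of 0] by simp
    moreover have "qsmult I 0 Y = cls I (\<lambda>_. 0)" for Y unfolding qsmult_def by simp
    ultimately have "D (cls I (\<lambda>_. 0)) = cls I (\<lambda>_. 0)" "D' (cls I (\<lambda>_. 0)) = cls I (\<lambda>_. 0)"
      using D D' cls_car[OF kG_zero] unfolding qlinear_def by metis+
    then show "(\<lambda>_. 0) \<in> ?J" by (simp add: kG_zero)
  qed (use D D' eq in \<open>auto simp: qlinear_def cls_add cls_scale cls_car kG_add kG_scale kG_pel bas_def\<close>)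
  then show ?thesis using X unfolding qcar_def by auto
qed

text \<open>Vertices and arrows generate the algebra, so the Leibniz rule carries agreement along a
  path one arrow at a time.\<close>

lemma qder_eqI:
  assumes D: "is_qder Q I D" and D': "is_qder Q I D'"
    and v: "\<And>v. v \<in> V \<Longrightarrow> D (bas (v, [])) = D' (bas (v, []))"
    and a: "\<And>a. a \<in> E \<Longrightarrow> D (bas (apath Q a)) = D' (bas (apath Q a))"
    and X: "X \<in> qcar Q I"
  shows "D X = D' X"
proof (rule qlinear_eqI[OF _ _ _ X])
  show "qlinear D" "qlinear D'" using D D' unfolding is_qder_iff by auto
  have "is_qpath Q (u, xs) \<Longrightarrow> D (bas (u, xs)) = D' (bas (u, xs))" for u xs
  proof (induction xs arbitrary: u)
    case Nil then show ?case using v by simp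
  next
    case (Cons b xs)
    then have b: "b \<in> E" "is_qpath Q (tgt b, xs)" by auto
    then have car: "bas (apath Q b) \<in> qcar Q I" "bas (tgt b, xs) \<in> qcar Q I"
      using bas_car is_qpath_apath by auto
    have "D (qmult Q I (bas (apath Q b)) (bas (tgt b, xs))) = D' (qmult Q I (bas (apath Q b)) (bas (tgt b, xs)))"
      using D D' car a[OF b(1)] Cons.IH[OF b(2)] unfolding is_qder_iff by metis
    then show ?case using bas_Cons[OF Cons.prems] by simp
  qed
  then show "D (bas p) = D' (bas p)" if "is_qpath Q p" for p using that by (metis prod.collapse)
qed

lemma is_qderI:
  assumes "\<And>X. X \<in> qcar Q I \<Longrightarrow> D X \<in> qcar Q I"
    and "\<And>X Y p. X \<in> qcar Q I \<Longrightarrow> Y \<in> qcar Q I \<Longrightarrow> coords (D (qadd I X Y)) p = coords (D X) p + coords (D Y) p"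
    and "\<And>c X p. X \<in> qcar Q I \<Longrightarrow> coords (D (qsmult I c X)) p = c * coords (D X) p"
    and "\<And>X Y p. X \<in> qcar Q I \<Longrightarrow> Y \<in> qcar Q I \<Longrightarrow> N p \<Longrightarrow>
       coords (D (qmult Q I X Y)) p = pmult Q (coords (D X)) (coords Y) p + pmult Q (coords X) (coords (D Y)) p"
  shows "is_qder Q I D"
  unfolding is_qder_def
  by (intro conjI ballI allI qcar_eqI)
    (simp_all add: assms qadd_car qsmult_car qmult_car coords_qadd coords_qsmult coords_qmult)

lemma is_qderD:
  assumes "is_qder Q I D"
  shows "X \<in> qcar Q I \<Longrightarrow> D X \<in> qcar Q I"
    and "X \<in> qcar Q I \<Longrightarrow> Y \<in> qcar Q I \<Longrightarrow> coords (D (qadd I X Y)) p = coords (D X) p + coords (D Y) p"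
    and "X \<in> qcar Q I \<Longrightarrow> coords (D (qsmult I c X)) p = c * coords (D X) p"
    and "X \<in> qcar Q I \<Longrightarrow> Y \<in> qcar Q I \<Longrightarrow> N p \<Longrightarrow>
       coords (D (qmult Q I X Y)) p = pmult Q (coords (D X)) (coords Y) p + pmult Q (coords X) (coords (D Y)) p"
  using assms unfolding is_qder_def by (auto simp: coords_qadd coords_qsmult coords_qmult)

lemma qcomb_car:
  assumes "\<And>D. D \<in> F \<Longrightarrow> is_qder Q I D" "X \<in> qcar Q I" shows "qcomb I F c X \<in> qcar Q I"
  unfolding qcomb_def using assms is_qderD(1) by (intro cls_car kG_sum qrep_kG) blast

lemma coords_qcomb: "coords (qcomb I F c X) p = (\<Sum>D\<in>F. c D * coords (D X) p)"
  unfolding qcomb_def coords_cls by (simp add: coords_def)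

lemma pmult_sum_left: "pmult Q (\<lambda>p. \<Sum>i\<in>S. c i * x i p) y p = (\<Sum>i\<in>S. c i * pmult Q (x i) y p)"
proof (induction S rule: infinite_finite_induct)
  case (insert i S)
  then show ?case using pmult_add_left[of "\<lambda>p. c i * x i p" "\<lambda>p. \<Sum>i\<in>S. c i * x i p" y]
    pmult_scale_left[of "c i" "x i" y] by simp
qed (simp_all add: pmult_zero_left)

lemma pmult_sum_right: "pmult Q y (\<lambda>p. \<Sum>i\<in>S. c i * x i p) p = (\<Sum>i\<in>S. c i * pmult Q y (x i) p)"
proof (induction S rule: infinite_finite_induct)
  case (insert i S)
  then show ?case using pmult_add_right[of y "\<lambda>p. c i * x i p" "\<lambda>p. \<Sum>i\<in>S. c i * x i p"]
    pmult_scale_right[of y "c i" "x i"] by simp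
qed (simp_all add: pmult_zero_right)

text \<open>The combination is described by its coordinates only, so that the lemma serves
  \<open>qcomb\<close>, differences of derivations and the face derivations alike.\<close>

lemma is_qder_lincomb:
  assumes D: "\<And>i. i \<in> S \<Longrightarrow> is_qder Q I (D i)"
    and car: "\<And>X. X \<in> qcar Q I \<Longrightarrow> D' X \<in> qcar Q I"
    and eq: "\<And>X p. X \<in> qcar Q I \<Longrightarrow> coords (D' X) p = (\<Sum>i\<in>S. c i * coords (D i X) p)"
  shows "is_qder Q I D'"
proof (rule is_qderI)
  note d = is_qderD[OF D]
  have eq': "coords (D' X) = (\<lambda>p. \<Sum>i\<in>S. c i * coords (D i X) p)" if "X \<in> qcar Q I" for X
    using eq[OF that] by (simp add: fun_eq_iff)
  fix X Y p
  assume X: "X \<in> qcar Q I" and Y: "Y \<in> qcar Q I"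
  show "coords (D' (qadd I X Y)) p = coords (D' X) p + coords (D' Y) p"
    unfolding eq[OF X] eq[OF Y] eq[OF qadd_car[OF X Y]] sum.distrib[symmetric]
    by (intro sum.cong refl) (simp add: d(2)[OF _ X Y] ring_distribs)
  assume "N p"
  then show "coords (D' (qmult Q I X Y)) p = pmult Q (coords (D' X)) (coords Y) p + pmult Q (coords X) (coords (D' Y)) p"
    unfolding eq'[OF X] eq'[OF Y] eq[OF qmult_car[OF X Y]] pmult_sum_left pmult_sum_right sum.distrib[symmetric]
    by (intro sum.cong refl) (simp add: d(4)[OF _ X Y] ring_distribs)
next
  note d = is_qderD[OF D]
  fix k X p assume X: "X \<in> qcar Q I"
  show "coords (D' (qsmult I k X)) p = k * coords (D' X) p"
    unfolding eq[OF X] eq[OF qsmult_car[OF X]] sum_distrib_left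
    by (intro sum.cong refl) (simp add: d(3)[OF _ X])
qed (rule car)

lemma is_qder_qcomb: "(\<And>D. D \<in> F \<Longrightarrow> is_qder Q I D) \<Longrightarrow> is_qder Q I (qcomb I F c)"
  by (rule is_qder_lincomb[of F "\<lambda>D. D" _ c]) (auto simp: qcomb_car coords_qcomb)

lemma is_qder_diff:
  assumes "is_qder Q I D" "is_qder Q I D'"
  shows "is_qder Q I (\<lambda>X. qadd I (D X) (qsmult I (-1) (D' X)))"
  by (rule is_qder_lincomb[of "{True, False}" "\<lambda>b. if b then D else D'" _ "\<lambda>b. if b then 1 else -1"])
    (use assms is_qderD(1) in \<open>auto simp: coords_qadd coords_qsmult intro!: qadd_car qsmult_car\<close>)

section \<open>Inner derivations\<close>

definition inner :: "(('v,'a) qpath \<Rightarrow> 'k) set \<Rightarrow> ('v,'a,'k) qder" where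
  "inner A X = qadd I (qmult Q I A X) (qsmult I (-1) (qmult Q I X A))"

lemma coords_inner: "N p \<Longrightarrow> coords (inner A X) p = pmult Q (coords A) (coords X) p - pmult Q (coords X) (coords A) p"
  unfolding inner_def coords_qadd coords_qsmult coords_qmult by simp

lemma inner_car: "A \<in> qcar Q I \<Longrightarrow> X \<in> qcar Q I \<Longrightarrow> inner A X \<in> qcar Q I"
  unfolding inner_def by (intro qadd_car qsmult_car qmult_car)

lemma inner_qder_iff: "inner_qder Q I D \<longleftrightarrow> (\<exists>A\<in>qcar Q I. \<forall>X\<in>qcar Q I. D X = inner A X)"
  unfolding inner_qder_def inner_def ..

lemma is_qder_inner:
  assumes A: "A \<in> qcar Q I" shows "is_qder Q I (inner A)"
proof -
  have eqN: "coords (inner A X) p = (if N p then pmult Q (coords A) (coords X) p - pmult Q (coords X) (coords A) p else 0)" for X p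
    using coords_inner coords_notN by auto
  \<comment> \<open>\<open>coords\<close> of a product is cut off outside \<open>N\<close>, while
    \<open>pmult\<close> of coordinates need not be. The difference cannot be seen at a path
    \<open>p\<close> with \<open>N p\<close>, and after its removal the Leibniz rule is
    associativity.\<close>
  have qm: "pmult Q (coords (qmult Q I X Y)) z p = pmult Q (pmult Q (coords X) (coords Y)) z p"
    "pmult Q z (coords (qmult Q I X Y)) p = pmult Q z (pmult Q (coords X) (coords Y)) p" if "N p" for X Y z p
    by (intro pmult_cong_N[OF that]; simp add: coords_qmult)+
  have im: "pmult Q (coords (inner A X)) z p = pmult Q (pmult Q (coords A) (coords X)) z p - pmult Q (pmult Q (coords X) (coords A)) z p"
    "pmult Q z (coords (inner A X)) p = pmult Q z (pmult Q (coords A) (coords X)) p - pmult Q z (pmult Q (coords X) (coords A)) p"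
    if "N p" for X z p
  proof -
    have "pmult Q (coords (inner A X)) z p = pmult Q (\<lambda>p. pmult Q (coords A) (coords X) p + (-1) * pmult Q (coords X) (coords A) p) z p"
      by (intro pmult_cong_N[OF that]) (auto simp: coords_inner)
    then show "pmult Q (coords (inner A X)) z p = pmult Q (pmult Q (coords A) (coords X)) z p - pmult Q (pmult Q (coords X) (coords A)) z p"
      unfolding pmult_add_left pmult_scale_left by simp
    have "pmult Q z (coords (inner A X)) p = pmult Q z (\<lambda>p. pmult Q (coords A) (coords X) p + (-1) * pmult Q (coords X) (coords A) p) p"
      by (intro pmult_cong_N[OF that]) (auto simp: coords_inner)
    then show "pmult Q z (coords (inner A X)) p = pmult Q z (pmult Q (coords A) (coords X)) p - pmult Q z (pmult Q (coords X) (coords A)) p"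
      unfolding pmult_add_right pmult_scale_right by simp
  qed
  have ca: "coords (qadd I X Y) = (\<lambda>p. coords X p + coords Y p)" "coords (qsmult I c X) = (\<lambda>p. c * coords X p)" for X Y c
    by (auto simp: coords_qadd coords_qsmult)
  show ?thesis
  proof (rule is_qderI)
    fix X Y p assume "N p"
    then show "coords (inner A (qmult Q I X Y)) p = pmult Q (coords (inner A X)) (coords Y) p + pmult Q (coords X) (coords (inner A Y)) p"
      by (simp add: coords_inner qm im pmult_assoc)
  qed (auto simp: eqN ca pmult_add_left pmult_add_right pmult_scale_left pmult_scale_right algebra_simps inner_car A)
qed

section \<open>The derivations D_{r,s}\<close>

text \<open>The Leibniz rule unfolded at the first arrow. The empty list gets 0 because D_{r,s}
  kills vertices, so the start vertex need not be an argument.\<close>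

primrec dlist :: "'a \<Rightarrow> ('v,'a) qpath \<Rightarrow> 'a list \<Rightarrow> ('v,'a) qpath \<Rightarrow> 'k" where
  "dlist r s [] = (\<lambda>_. 0)"
| "dlist r s (a # xs) = (\<lambda>q. (if a = r then pmult Q (pel s) (pel (tgt a, xs)) q else 0)
     + pmult Q (pel (apath Q a)) (dlist r s xs) q)"

text \<open>The linear extension, with values in the path algebra itself: a lift of
  \<open>Dmap\<close> on which one can compute before passing to classes.\<close>

definition Dlin :: "'a \<Rightarrow> ('v,'a) qpath \<Rightarrow> (('v,'a) qpath \<Rightarrow> 'k) \<Rightarrow> ('v,'a) qpath \<Rightarrow> 'k" where
  "Dlin r s x q = (\<Sum>p\<in>{p. x p \<noteq> 0}. x p * dlist r s (snd p) q)"

lemma pmult_mismatch: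
  assumes "\<And>q r. x q \<noteq> 0 \<Longrightarrow> y r \<noteq> 0 \<Longrightarrow> pend Q q \<noteq> fst r"
  shows "pmult Q x y = (\<lambda>_. 0)"
proof
  fix p show "pmult Q x y p = 0"
  proof (rule ccontr)
    assume "pmult Q x y p \<noteq> 0"
    then show False by (rule pmult_nonzeroE) (use assms in blast)
  qed
qed

lemma Dlin_superset:
  "finite S \<Longrightarrow> {p. x p \<noteq> 0} \<subseteq> S \<Longrightarrow> Dlin r s x q = (\<Sum>p\<in>S. x p * dlist r s (snd p) q)"
  unfolding Dlin_def by (rule sum.mono_neutral_left) auto

lemma kG_finite: "x \<in> kG Q \<Longrightarrow> finite {p. x p \<noteq> 0}"
  unfolding kG_def by simp

lemma Dlin_add:
  assumes "x \<in> kG Q" "y \<in> kG Q"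
  shows "Dlin r s (\<lambda>p. x p + y p) = (\<lambda>q. Dlin r s x q + Dlin r s y q)"
proof
  fix q
  let ?S = "{p. x p \<noteq> 0} \<union> {p. y p \<noteq> 0}"
  have fin: "finite ?S" using assms kG_finite by auto
  have "Dlin r s (\<lambda>p. x p + y p) q = (\<Sum>p\<in>?S. (x p + y p) * dlist r s (snd p) q)"
    by (rule Dlin_superset[OF fin]) auto
  then show "Dlin r s (\<lambda>p. x p + y p) q = Dlin r s x q + Dlin r s y q"
    using Dlin_superset[OF fin, of x r s q] Dlin_superset[OF fin, of y r s q] by (simp add: ring_distribs sum.distrib)
qed

lemma Dlin_scale:
  assumes "x \<in> kG Q"
  shows "Dlin r s (\<lambda>p. c * x p) = (\<lambda>q. c * Dlin r s x q)"
proof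
  fix q
  have "Dlin r s (\<lambda>p. c * x p) q = (\<Sum>p\<in>{p. x p \<noteq> 0}. c * x p * dlist r s (snd p) q)"
    by (rule Dlin_superset) (use assms kG_finite in auto)
  then show "Dlin r s (\<lambda>p. c * x p) q = c * Dlin r s x q"
    unfolding Dlin_def sum_distrib_left by (simp add: mult.assoc)
qed

lemma Dlin_zero: "Dlin r s (\<lambda>_. 0) = (\<lambda>_. 0)"
  unfolding Dlin_def by simp

lemma Dlin_pel: "Dlin r s (pel p) = dlist r s (snd p)"
proof
  fix q
  have "Dlin r s (pel p) q = (\<Sum>p'\<in>{p}. pel p p' * dlist r s (snd p') q)"
    by (rule Dlin_superset) (auto simp: pel_def split: if_splits)
  then show "Dlin r s (pel p) q = dlist r s (snd p) q" by (simp add: pel_def)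
qed

context
  fixes r :: 'a and s :: "('v,'a) qpath"
  assumes r: "r \<in> E" and s: "is_qpath Q s" and rs: "qparallel Q (apath Q r) s"
begin

lemma s_ends: "fst s = src r" "pend Q s = tgt r"
  using rs unfolding qparallel_def pstart_def apath_def by auto

lemma dlist_kG: "is_qpath Q (v, xs) \<Longrightarrow> dlist r s xs \<in> kG Q"
proof (induction xs arbitrary: v)
  case (Cons a xs)
  then have "a \<in> E" "is_qpath Q (tgt a, xs)" by auto
  then show ?case using Cons.IH[of "tgt a"] s
    by (cases "a = r") (auto intro!: kG_add kG_pmult kG_pel is_qpath_apath)
qed (simp add: kG_zero)

text \<open>D_{r,s} replaces one occurrence of \<open>r\<close> by the parallel path
  \<open>s\<close>, so every path produced is parallel to the original one.\<close>

lemma dlist_support: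
  "is_qpath Q (v, xs) \<Longrightarrow> dlist r s xs q \<noteq> 0 \<Longrightarrow> is_qpath Q q \<and> fst q = v \<and> pend Q q = pend Q (v, xs)"
proof (induction xs arbitrary: v q)
  case (Cons a xs)
  then have a: "a \<in> E" "src a = v" "is_qpath Q (tgt a, xs)" by auto
  consider "a = r" "pmult Q (pel s) (pel (tgt a, xs)) q \<noteq> (0::'k)" | "pmult Q (pel (apath Q a)) (dlist r s xs) q \<noteq> 0"
    using Cons.prems(2) by (cases "a = r"; cases "pmult Q (pel (apath Q a)) (dlist r s xs) q = 0") auto
  then show ?case
  proof cases
    case 1
    from 1(2) show ?thesis
    proof (rule pmult_nonzeroE)
      fix q1 q2
      assume h: "is_qpath Q q" "pel s q1 \<noteq> (0::'k)" "pel (tgt a, xs) q2 \<noteq> (0::'k)" "q = (fst q1, snd q1 @ snd q2)"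
      then have "q1 = s" "q2 = (tgt a, xs)" unfolding pel_def by (auto split: if_splits)
      moreover have "pend Q (v, snd s) = tgt r" using s_ends a(2) 1(1) by (metis prod.collapse)
      ultimately show ?thesis using h s_ends(1) a 1(1) by (simp add: pend_append)
    qed
  next
    case 2
    then show ?thesis
    proof (rule pmult_nonzeroE)
      fix q1 q2
      assume h: "is_qpath Q q" "pel (apath Q a) q1 \<noteq> (0::'k)" "dlist r s xs q2 \<noteq> 0" "q = (fst q1, snd q1 @ snd q2)"
      then have q1: "q1 = (src a, [a])" unfolding pel_def apath_def by (auto split: if_splits)
      have "fst q2 = tgt a" "pend Q q2 = pend Q (tgt a, xs)" using Cons.IH[OF a(3) h(3)] by auto
      then have "pend Q (tgt a, snd q2) = pend Q (tgt a, xs)" by (metis prod.collapse)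
      then show ?thesis using h q1 a by simp
    qed
  qed
qed simp

lemma dlist_append:
  "is_qpath Q (v, xs @ ys) \<Longrightarrow> dlist r s (xs @ ys) =
    (\<lambda>q. pmult Q (dlist r s xs) (pel (pend Q (v, xs), ys)) q + pmult Q (pel (v, xs)) (dlist r s ys) q)"
proof (induction xs arbitrary: v)
  case Nil
  \<comment> \<open>The trivial path at \<open>v\<close> acts as identity here because everything in
    the support of \<open>dlist r s ys\<close> starts at \<open>v\<close>.\<close>
  have "pmult Q (pel (v, [])) (dlist r s ys) q = dlist r s ys q" for q
  proof (cases "is_qpath Q q")
    case True
    then show ?thesis using dlist_support[of v ys q] Nil by (auto simp: pmult_pel_vertex_left)
  next
    case False
    then show ?thesis using dlist_support[of v ys q] Nil by (auto simp: pmult_not_path)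
  qed
  then show ?case by (simp add: pmult_zero_left)
next
  case (Cons a xs)
  then have a: "a \<in> E" "src a = v" "is_qpath Q (tgt a, xs @ ys)" by auto
  let ?e = "pend Q (tgt a, xs)"
  have p: "is_qpath Q (tgt a, xs)" "is_qpath Q (?e, ys)" using a(3) is_qpath_append by auto
  have 1: "(pel (tgt a, xs @ ys) :: _ \<Rightarrow> 'k) = pmult Q (pel (tgt a, xs)) (pel (?e, ys))"
    using pmult_pel[OF p, symmetric] by simp
  have 2: "(pel (v, a # xs) :: _ \<Rightarrow> 'k) = pmult Q (pel (apath Q a)) (pel (tgt a, xs))"
    using pmult_pel[OF is_qpath_apath[OF a(1)] p(1), symmetric] a(2) by (simp add: apath_def)
  have 3: "pmult Q (\<lambda>q. (if a = r then x q else 0) + y q) z =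
     (\<lambda>q. (if a = r then pmult Q x z q else 0) + pmult Q y z q)" for x y z :: "('v,'a) qpath \<Rightarrow> 'k"
    using pmult_add_left[of x y z] pmult_add_left[of "\<lambda>_. 0" y z] by (cases "a = r") (auto simp: pmult_zero_left)
  show ?case
    unfolding append_Cons dlist.simps Cons.IH[OF a(3)] pend_Cons 1 2 3 pmult_add_right pmult_assoc
    by (simp add: fun_eq_iff add.assoc)
qed

lemma Dlin_kG: "x \<in> kG Q \<Longrightarrow> Dlin r s x \<in> kG Q"
proof -
  assume x: "x \<in> kG Q"
  have "(\<lambda>q. \<Sum>p\<in>{p. x p \<noteq> 0}. x p * dlist r s (snd p) q) \<in> kG Q"
  proof (rule kG_sum)
    fix p assume "p \<in> {p. x p \<noteq> 0}"
    then have "is_qpath Q p" using x unfolding kG_def by blast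
    then show "dlist r s (snd p) \<in> kG Q" using dlist_kG[of "fst p" "snd p"] by simp
  qed
  then show ?thesis unfolding Dlin_def[abs_def] .
qed

text \<open>Each path of the image is parallel to a path occurring in \<open>z\<close>; the latter
  lies in \<open>I\<close>, and completeness moves this along parallelism.\<close>

lemma Dlin_I: assumes z: "z \<in> I" shows "Dlin r s z \<in> I"
proof -
  have "pel q \<in> I" if "Dlin r s z q \<noteq> 0" for q
  proof -
    have "\<exists>p. z p * dlist r s (snd p) q \<noteq> 0"
      using that unfolding Dlin_def by (metis (mono_tags, lifting) sum.neutral)
    then obtain p where p: "z p \<noteq> 0" "dlist r s (snd p) q \<noteq> 0" by auto
    then have "is_qpath Q p" "pel p \<in> I" using z mem_I_iff[of z] unfolding kG_def by blast+
    moreover have "is_qpath Q q \<and> fst q = fst p \<and> pend Q q = pend Q p"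
      using dlist_support[of "fst p" "snd p" q] p(2) calculation by simp
    ultimately show ?thesis using comp unfolding complete_rel_def qparallel_def pstart_def by metis
  qed
  then show ?thesis using mem_I_iff[of "Dlin r s z"] Dlin_kG[OF I_kG[OF z]] by blast
qed

text \<open>If the paths compose, this is \<open>dlist_append\<close>. If not, all three products
  vanish, since D_{r,s} preserves the ends of a path.\<close>

lemma Dlin_mult_pel:
  assumes p: "is_qpath Q p" and q: "is_qpath Q q"
  shows "Dlin r s (pmult Q (pel p) (pel q)) =
    (\<lambda>t. pmult Q (Dlin r s (pel p)) (pel q) t + pmult Q (pel p) (Dlin r s (pel q)) t)"
proof (cases "pend Q p = fst q")
  case True
  have "is_qpath Q (fst p, snd p @ snd q)" using is_qpath_append[of "fst p" "snd p" "snd q"] p q True by simp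
  from dlist_append[OF this] show ?thesis unfolding pmult_pel[OF p q True] Dlin_pel using True by simp
next
  case False
  have 1: "pmult Q (pel p) (pel q) = (\<lambda>_. 0::'k)"
    by (rule pmult_mismatch) (use False in \<open>auto simp: pel_def split: if_splits\<close>)
  have 2: "pmult Q (dlist r s (snd p)) (pel q) = (\<lambda>_. 0)"
  proof (rule pmult_mismatch)
    fix t u assume "dlist r s (snd p) t \<noteq> 0" "pel q u \<noteq> (0::'k)"
    then show "pend Q t \<noteq> fst u" using dlist_support[of "fst p" "snd p" t] p False by (auto simp: pel_def split: if_splits)
  qed
  have 3: "pmult Q (pel p) (dlist r s (snd q)) = (\<lambda>_. 0)"
  proof (rule pmult_mismatch)
    fix t u assume "pel p t \<noteq> (0::'k)" "dlist r s (snd q) u \<noteq> 0"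
    then show "pend Q t \<noteq> fst u" using dlist_support[of "fst q" "snd q" u] q False by (auto simp: pel_def split: if_splits)
  qed
  show ?thesis unfolding Dlin_pel 1 2 3 Dlin_zero by simp
qed

lemma Dlin_mult:
  assumes x: "x \<in> kG Q" and y: "y \<in> kG Q"
  shows "Dlin r s (pmult Q x y) = (\<lambda>t. pmult Q (Dlin r s x) y t + pmult Q x (Dlin r s y) t)"
proof -
  let ?P = "\<lambda>x y. Dlin r s (pmult Q x y) = (\<lambda>t. pmult Q (Dlin r s x) y t + pmult Q x (Dlin r s y) t)"
  have 1: "y \<in> {y\<in>kG Q. ?P (pel p) y}" if p: "is_qpath Q p" for p
  proof (rule kG_span[OF y])
    show "(\<lambda>_. 0) \<in> {y\<in>kG Q. ?P (pel p) y}" by (simp add: kG_zero pmult_zero_right Dlin_zero)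
  next
    fix u v assume "u \<in> {y\<in>kG Q. ?P (pel p) y}" "v \<in> {y\<in>kG Q. ?P (pel p) y}"
    then show "(\<lambda>p. u p + v p) \<in> {y\<in>kG Q. ?P (pel p) y}"
      using p by (auto simp: kG_add pmult_add_right Dlin_add kG_pmult kG_pel fun_eq_iff)
  next
    fix c u assume "u \<in> {y\<in>kG Q. ?P (pel p) y}"
    then show "(\<lambda>p. c * u p) \<in> {y\<in>kG Q. ?P (pel p) y}"
      using p by (auto simp: kG_scale pmult_scale_right Dlin_scale kG_pmult kG_pel fun_eq_iff ring_distribs)
  qed (use p Dlin_mult_pel kG_pel in auto)
  have "x \<in> {x\<in>kG Q. ?P x y}"
  proof (rule kG_span[OF x])
    show "(\<lambda>_. 0) \<in> {x\<in>kG Q. ?P x y}" by (simp add: kG_zero pmult_zero_left Dlin_zero)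
  next
    fix u v assume "u \<in> {x\<in>kG Q. ?P x y}" "v \<in> {x\<in>kG Q. ?P x y}"
    then show "(\<lambda>p. u p + v p) \<in> {x\<in>kG Q. ?P x y}"
      using y by (auto simp: kG_add pmult_add_left Dlin_add kG_pmult fun_eq_iff)
  next
    fix c u assume "u \<in> {x\<in>kG Q. ?P x y}"
    then show "(\<lambda>p. c * u p) \<in> {x\<in>kG Q. ?P x y}"
      using y by (auto simp: kG_scale pmult_scale_left Dlin_scale kG_pmult fun_eq_iff ring_distribs)
  qed (use 1 kG_pel in auto)
  then show ?thesis by simp
qed

lemma Dlin_arrow: "Dlin r s (pel (apath Q a)) = (if a = r then pel s else (\<lambda>_. 0))"
proof -
  have "pmult Q (pel s) (pel (tgt r, [])) = (pel s :: _ \<Rightarrow> 'k)"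
    using pmult_pel[OF s, of "(tgt r, [])"] s_ends(2) r tgt_V by simp
  then show ?thesis unfolding Dlin_pel by (auto simp: apath_def pmult_zero_right)
qed

lemma Dmap_eq:
  assumes x: "x \<in> kG Q" shows "Dmap Q I r s x = cls I (Dlin r s x)"
proof -
  \<comment> \<open>The definite description prescribes the value \<open>{}\<close> outside the path
    algebra, which turns uniqueness there into an equality of total functions. On the algebra,
    uniqueness is again induction along paths.\<close>
  let ?D = "\<lambda>x. if x \<in> kG Q then cls I (Dlin r s x) else {}"
  have "Dmap Q I r s = ?D" unfolding Dmap_def
  proof (rule the_equality)
    show "(\<forall>x\<in>kG Q. ?D x \<in> qcar Q I) \<and>
      (\<forall>x\<in>kG Q. \<forall>y\<in>kG Q. ?D (\<lambda>p. x p + y p) = qadd I (?D x) (?D y)) \<and>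
      (\<forall>c. \<forall>x\<in>kG Q. ?D (\<lambda>p. c * x p) = qsmult I c (?D x)) \<and>
      (\<forall>x\<in>kG Q. \<forall>y\<in>kG Q. ?D (pmult Q x y) = qadd I (qmult Q I (?D x) (cls I y)) (qmult Q I (cls I x) (?D y))) \<and>
      ?D (pel (apath Q r)) = cls I (pel s) \<and>
      (\<forall>a\<in>qarrs Q - {r}. ?D (pel (apath Q a)) = cls I (\<lambda>_. 0)) \<and>
      (\<forall>v\<in>qverts Q. ?D (pel (v, [])) = cls I (\<lambda>_. 0)) \<and>
      (\<forall>x. x \<notin> kG Q \<longrightarrow> ?D x = {})"
    proof (intro conjI ballI allI impI)
      fix x y :: "('v,'a) qpath \<Rightarrow> 'k" assume xy: "x \<in> kG Q" "y \<in> kG Q"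
      show "?D (\<lambda>p. x p + y p) = qadd I (?D x) (?D y)"
        using xy by (simp add: kG_add Dlin_add cls_add Dlin_kG)
      show "?D (pmult Q x y) = qadd I (qmult Q I (?D x) (cls I y)) (qmult Q I (cls I x) (?D y))"
        using xy by (simp add: kG_pmult Dlin_mult cls_add cls_mult Dlin_kG)
    next
      fix c and x :: "('v,'a) qpath \<Rightarrow> 'k" assume x: "x \<in> kG Q"
      show "?D (\<lambda>p. c * x p) = qsmult I c (?D x)"
        using x by (simp add: kG_scale Dlin_scale cls_scale Dlin_kG)
    qed (use r in \<open>simp_all add: cls_car Dlin_kG Dlin_arrow kG_pel is_qpath_apath Dlin_pel[of _ _ "(_, [])"]\<close>)
  next
    fix D :: "(('v,'a) qpath \<Rightarrow> 'k) \<Rightarrow> (('v,'a) qpath \<Rightarrow> 'k) set"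
    assume "(\<forall>x\<in>kG Q. D x \<in> qcar Q I) \<and>
      (\<forall>x\<in>kG Q. \<forall>y\<in>kG Q. D (\<lambda>p. x p + y p) = qadd I (D x) (D y)) \<and>
      (\<forall>c. \<forall>x\<in>kG Q. D (\<lambda>p. c * x p) = qsmult I c (D x)) \<and>
      (\<forall>x\<in>kG Q. \<forall>y\<in>kG Q. D (pmult Q x y) = qadd I (qmult Q I (D x) (cls I y)) (qmult Q I (cls I x) (D y))) \<and>
      D (pel (apath Q r)) = cls I (pel s) \<and>
      (\<forall>a\<in>qarrs Q - {r}. D (pel (apath Q a)) = cls I (\<lambda>_. 0)) \<and>
      (\<forall>v\<in>qverts Q. D (pel (v, [])) = cls I (\<lambda>_. 0)) \<and>
      (\<forall>x. x \<notin> kG Q \<longrightarrow> D x = {})"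
    then have D: "\<And>x y. x \<in> kG Q \<Longrightarrow> y \<in> kG Q \<Longrightarrow> D (\<lambda>p. x p + y p) = qadd I (D x) (D y)"
      "\<And>c x. x \<in> kG Q \<Longrightarrow> D (\<lambda>p. c * x p) = qsmult I c (D x)"
      "\<And>x y. x \<in> kG Q \<Longrightarrow> y \<in> kG Q \<Longrightarrow> D (pmult Q x y) = qadd I (qmult Q I (D x) (cls I y)) (qmult Q I (cls I x) (D y))"
      "D (pel (apath Q r)) = cls I (pel s)"
      "\<And>a. a \<in> E \<Longrightarrow> a \<noteq> r \<Longrightarrow> D (pel (apath Q a)) = cls I (\<lambda>_. 0)"
      "\<And>v. v \<in> V \<Longrightarrow> D (pel (v, [])) = cls I (\<lambda>_. 0)"
      "\<And>x. x \<notin> kG Q \<Longrightarrow> D x = {}" by auto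
    have pel: "is_qpath Q (v, xs) \<Longrightarrow> D (pel (v, xs)) = cls I (Dlin r s (pel (v, xs)))" for v xs
    proof (induction xs arbitrary: v)
      case Nil then show ?case using D(6) by (simp add: Dlin_pel)
    next
      case (Cons a xs)
      then have a: "a \<in> E" "src a = v" "is_qpath Q (tgt a, xs)" by auto
      have k: "(pel (apath Q a) :: _ \<Rightarrow> 'k) \<in> kG Q" "(pel (tgt a, xs) :: _ \<Rightarrow> 'k) \<in> kG Q" using a kG_pel is_qpath_apath by blast+
      have 1: "(pel (v, a # xs) :: _ \<Rightarrow> 'k) = pmult Q (pel (apath Q a)) (pel (tgt a, xs))"
        using pmult_pel[OF is_qpath_apath[OF a(1)] a(3), symmetric] a(2) by (simp add: apath_def)
      have 2: "D (pel (apath Q a)) = cls I (Dlin r s (pel (apath Q a)))"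
        using D(4,5) a(1) by (simp add: Dlin_arrow)
      show ?case unfolding 1 D(3)[OF k] Dlin_mult[OF k] 2 Cons.IH[OF a(3)]
        using k by (simp add: cls_add cls_mult Dlin_kG kG_pmult)
    qed
    show "D = ?D"
    proof
      fix x
      show "D x = ?D x"
      proof (cases "x \<in> kG Q")
        case True
        have "x \<in> {x\<in>kG Q. D x = cls I (Dlin r s x)}"
        proof (rule kG_span[OF True])
          have "qsmult I 0 Y = cls I (\<lambda>_. 0)" for Y unfolding qsmult_def by simp
          then have "D (\<lambda>_. 0) = cls I (\<lambda>_. 0)" using D(2)[OF kG_zero, of 0] by simp
          then show "(\<lambda>_. 0) \<in> {x\<in>kG Q. D x = cls I (Dlin r s x)}" by (simp add: kG_zero Dlin_zero)
        next
          fix p assume "is_qpath Q p"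
          then show "pel p \<in> {x\<in>kG Q. D x = cls I (Dlin r s x)}"
            using pel[of "fst p" "snd p"] kG_pel by simp
        qed (auto simp: D kG_add kG_scale Dlin_add Dlin_scale cls_add cls_scale Dlin_kG)
        then show ?thesis using True by simp
      qed (simp add: D(7))
    qed
  qed
  then show ?thesis using x by simp
qed

text \<open>Well-definedness on residue classes: the chosen representative differs from
  \<open>x\<close> by an element of \<open>I\<close>, which \<open>Dlin_I\<close> keeps in
  \<open>I\<close>.\<close>

lemma Dbar_cls:
  assumes x: "x \<in> kG Q" shows "Dbar Q I r s (cls I x) = cls I (Dlin r s x)"
proof -
  obtain z where z: "z \<in> I" "qrep (cls I x) = (\<lambda>p. x p + z p)" using qrep_cls by blast
  have zk: "z \<in> kG Q" using z I_kG by auto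
  have "Dbar Q I r s (cls I x) = cls I (Dlin r s (\<lambda>p. x p + z p))"
    unfolding Dbar_def using cls_car[OF x] Dmap_eq[OF kG_add[OF x zk]] z(2) by simp
  also have "\<dots> = cls I (Dlin r s x)" unfolding Dlin_add[OF x zk]
    using Dlin_I[OF z(1)] I_N by (intro cls_eq kG_add Dlin_kG x zk) simp
  finally show ?thesis .
qed

lemma is_qder_Dbar: "is_qder Q I (Dbar Q I r s)"
  unfolding is_qder_def
proof (intro conjI ballI allI)
  fix X assume "X \<in> qcar Q I"
  then obtain x where x: "x \<in> kG Q" "X = cls I x" unfolding qcar_def by auto
  show "Dbar Q I r s X \<in> qcar Q I" using x by (simp add: Dbar_cls cls_car Dlin_kG)
  show "Dbar Q I r s (qsmult I c X) = qsmult I c (Dbar Q I r s X)" for c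
    using x by (simp add: Dbar_cls cls_scale[symmetric] kG_scale Dlin_scale Dlin_kG)
  fix Y assume "Y \<in> qcar Q I"
  then obtain y where y: "y \<in> kG Q" "Y = cls I y" unfolding qcar_def by auto
  show "Dbar Q I r s (qadd I X Y) = qadd I (Dbar Q I r s X) (Dbar Q I r s Y)"
    using x y by (simp add: Dbar_cls cls_add[symmetric] kG_add Dlin_add Dlin_kG)
  show "Dbar Q I r s (qmult Q I X Y) = qadd I (qmult Q I (Dbar Q I r s X) Y) (qmult Q I X (Dbar Q I r s Y))"
    using x y by (simp add: Dbar_cls cls_mult[symmetric] cls_add[symmetric] kG_pmult Dlin_mult Dlin_kG)
qed

lemma coords_Dbar_arrow:
  "a \<in> E \<Longrightarrow> coords (Dbar Q I r s (bas (apath Q a))) q = (if a = r \<and> q = s \<and> N q then 1 else 0)"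
  unfolding bas_def by (simp add: Dbar_cls kG_pel is_qpath_apath Dlin_arrow coords_cls) (simp add: pel_def)

lemma coords_Dbar_vertex:
  "v \<in> V \<Longrightarrow> coords (Dbar Q I r s (bas (v, []))) q = 0"
  unfolding bas_def by (simp add: Dbar_cls kG_pel Dlin_pel coords_cls)

end

section \<open>Values of derivations on vertices and arrows\<close>

lemma pend_V: "is_qpath Q p \<Longrightarrow> pend Q p \<in> V"
proof (cases p)
  case (Pair v xs)
  show "is_qpath Q p \<Longrightarrow> pend Q p \<in> V" unfolding Pair
    by (induction xs arbitrary: v) auto
qed

lemma N_path: "N p \<Longrightarrow> is_qpath Q p" unfolding N_def by blast

definition qpairs :: "('a \<times> ('v,'a) qpath) set" where
  "qpairs = {(r, s). r \<in> E \<and> N s \<and> qparallel Q (apath Q r) s \<and> s \<noteq> apath Q r}"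

lemma qpairsD: "(r, s) \<in> qpairs \<Longrightarrow> r \<in> E \<and> N s \<and> is_qpath Q s \<and> qparallel Q (apath Q r) s \<and> s \<noteq> apath Q r"
  unfolding qpairs_def using N_path by auto

lemma parallel_refl: "qparallel Q p p" unfolding qparallel_def by simp

lemmas bas_arrow_car = is_qpath_apath[THEN bas_car]
lemmas coords_Dloop_arrow = coords_Dbar_arrow[OF _ is_qpath_apath parallel_refl]
lemmas coords_Dloop_vertex = coords_Dbar_vertex[OF _ is_qpath_apath parallel_refl]
lemmas is_qder_Dloop = is_qder_Dbar[OF _ is_qpath_apath parallel_refl]

lemma coords_pair_arrow:
  "(r, s) \<in> qpairs \<Longrightarrow> a \<in> E \<Longrightarrow>
    coords (Dbar Q I r s (bas (apath Q a))) q = (if a = r \<and> q = s then 1 else 0)"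
  using qpairsD[of r s] coords_Dbar_arrow[of r s a q] by auto

lemma Dbar_pair_inj: "inj_on (\<lambda>(r, s). Dbar Q I r s) qpairs"
proof (rule inj_onI, clarify)
  fix r s r' s' assume h: "(r, s) \<in> qpairs" "(r', s') \<in> qpairs" "Dbar Q I r s = Dbar Q I r' s'"
  have "r \<in> E" using qpairsD[OF h(1)] by blast
  then have "(1::'k) = (if r = r' \<and> s = s' then 1 else 0)"
    using coords_pair_arrow[OF h(1), of r s] coords_pair_arrow[OF h(2), of r s] h(3) by simp
  then show "r = r' \<and> s = s'" by (auto split: if_splits)
qed

text \<open>The difference is one of sets of maps, not of index pairs. No map is lost: on the arrow
  \<open>r\<close>, the derivation D_{r,s} has coefficient 1 at \<open>s\<close>, where every
  D_{t,t} has 0 as soon as \<open>s\<close> differs from \<open>r\<close>.\<close>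

lemma B2_minus_BE: "B2 Q I - BE Q I = (\<lambda>(r, s). Dbar Q I r s) ` qpairs"
proof (intro equalityI subsetI)
  fix D assume "D \<in> B2 Q I - BE Q I"
  then obtain r s where "D = Dbar Q I r s" "r \<in> E" "is_qpath Q s" "pel s \<notin> I" "qparallel Q (apath Q r) s" "D \<notin> BE Q I"
    unfolding B2_def by blast
  moreover from this have "s \<noteq> apath Q r" unfolding BE_def by blast
  ultimately show "D \<in> (\<lambda>(r, s). Dbar Q I r s) ` qpairs"
    by (intro image_eqI[of _ _ "(r, s)"]) (auto simp: qpairs_def N_def)
next
  fix D assume "D \<in> (\<lambda>(r, s). Dbar Q I r s) ` qpairs"
  then obtain r s where rs: "(r, s) \<in> qpairs" "D = Dbar Q I r s" by auto
  note p = qpairsD[OF rs(1)]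
  have "D \<in> B2 Q I" using rs p unfolding B2_def N_def by blast
  moreover have "D \<notin> BE Q I"
  proof
    assume "D \<in> BE Q I"
    then obtain t where t: "t \<in> E" "D = Dbar Q I t (apath Q t)" unfolding BE_def by blast
    have "coords (D (bas (apath Q r))) s = 1" unfolding rs(2) using coords_pair_arrow[OF rs(1)] p by simp
    moreover have "coords (D (bas (apath Q r))) s = 0" unfolding t(2) using coords_Dloop_arrow[OF t(1) t(1)] p by auto
    ultimately show False by simp
  qed
  ultimately show "D \<in> B2 Q I - BE Q I" by blast
qed

text \<open>A contribution at \<open>q\<close> is a factorisation of \<open>q\<close> into some
  \<open>p\<close> followed by \<open>a\<close>; the hypothesis \<open>triv\<close> makes
  \<open>p\<close> a vertex, hence \<open>q\<close> is the arrow itself.\<close>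

lemma pmult_arrow_right:
  fixes x :: "('v,'a) qpath \<Rightarrow> 'k"
  assumes a: "a \<in> E" and q: "N q"
    and triv: "\<And>p. N p \<Longrightarrow> x p \<noteq> 0 \<Longrightarrow> fst p = fst q \<Longrightarrow> pend Q p = src a \<Longrightarrow> snd p = []"
  shows "pmult Q x (pel (apath Q a)) q = (if q = apath Q a then x (src a, []) else 0)"
proof (cases "q = apath Q a")
  case True
  then show ?thesis using pmult_eq[OF N_path[OF q], of x "pel (apath Q a)"] by (simp add: apath_def pel_def)
next
  case False
  have "pmult Q x (pel (apath Q a)) q = 0"
  proof (rule ccontr)
    assume "pmult Q x (pel (apath Q a)) q \<noteq> 0"
    then show False
    proof (rule pmult_nonzeroE)
      fix p r assume h: "x p \<noteq> 0" "pel (apath Q a) r \<noteq> (0::'k)" "q = (fst p, snd p @ snd r)" "pend Q p = fst r"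
      then have r: "r = apath Q a" unfolding pel_def by (auto split: if_splits)
      have "N p" using N_split(1)[OF q, of "length (snd p)"] h(3) by simp
      then have "snd p = []" using triv[of p] h r by (simp add: apath_def)
      moreover have "pend Q p = src a" using h r by (simp add: apath_def)
      ultimately have "fst p = src a" by (metis pend_Nil prod.collapse)
      then show False using False h(3) r \<open>snd p = []\<close> by (simp add: apath_def)
    qed
  qed
  then show ?thesis using False by simp
qed

lemma pmult_arrow_left:
  fixes x :: "('v,'a) qpath \<Rightarrow> 'k"
  assumes a: "a \<in> E" and q: "N q"
    and triv: "\<And>p. N p \<Longrightarrow> x p \<noteq> 0 \<Longrightarrow> pend Q p = pend Q q \<Longrightarrow> fst p = tgt a \<Longrightarrow> snd p = []"
  shows "pmult Q (pel (apath Q a)) x q = (if q = apath Q a then x (tgt a, []) else 0)"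
proof (cases "q = apath Q a")
  case True
  then show ?thesis using pmult_eq[OF N_path[OF q], of "pel (apath Q a)" x] by (simp add: apath_def pel_def)
next
  case False
  have "pmult Q (pel (apath Q a)) x q = 0"
  proof (rule ccontr)
    assume "pmult Q (pel (apath Q a)) x q \<noteq> 0"
    then show False
    proof (rule pmult_nonzeroE)
      fix r p assume h: "pel (apath Q a) r \<noteq> (0::'k)" "x p \<noteq> 0" "q = (fst r, snd r @ snd p)" "pend Q r = fst p"
      then have r: "r = apath Q a" unfolding pel_def by (auto split: if_splits)
      then have fp: "fst p = tgt a" using h(4) by (simp add: apath_def)
      have q': "q = (src a, a # snd p)" using h(3) r by (simp add: apath_def)
      have "N p" using N_split(2)[OF q, of 1] fp unfolding q' by (simp) (metis prod.collapse)
      moreover have "pend Q p = pend Q q" unfolding q' using fp by simp (metis prod.collapse)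
      ultimately have "snd p = []" using triv[of p] h fp by simp
      then show False using False q' by (simp add: apath_def)
    qed
  qed
  then show ?thesis using False by simp
qed

text \<open>If \<open>q\<close> is parallel to \<open>a\<close>, then in a factorisation of
  \<open>q\<close> with \<open>a\<close> as first or last factor the other factor is a closed path,
  and acyclicity makes it a vertex: only vertex coefficients of \<open>A\<close> survive. The second
  alternative, \<open>A\<close> a combination of vertices, allows arbitrary \<open>q\<close>; it is
  the case of the inner derivation that realises a coboundary.\<close>

lemma coords_inner_arrow:
  assumes a: "a \<in> E" and q: "N q"
    and triv: "qparallel Q (apath Q a) q \<or> (\<forall>p. coords A p \<noteq> 0 \<longrightarrow> snd p = [])"
  shows "coords (inner A (bas (apath Q a))) q =
    (if q = apath Q a then coords A (src a, []) - coords A (tgt a, []) else 0)"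
proof -
  have "pmult Q (coords A) (pel (apath Q a)) q = (if q = apath Q a then coords A (src a, []) else 0)"
    by (rule pmult_arrow_right[OF a q])
      (use triv N_cycle in \<open>auto simp: qparallel_def pstart_def apath_def\<close>)
  moreover have "pmult Q (pel (apath Q a)) (coords A) q = (if q = apath Q a then coords A (tgt a, []) else 0)"
    by (rule pmult_arrow_left[OF a q])
      (use triv N_cycle in \<open>auto simp: qparallel_def pstart_def apath_def\<close>)
  ultimately show ?thesis unfolding coords_inner[OF q] coords_bas_N[OF N_arrow[OF a]] by simp
qed

lemma bas_mult:
  "is_qpath Q p \<Longrightarrow> is_qpath Q q \<Longrightarrow> qmult Q I (bas p) (bas q) = cls I (pmult Q (pel p) (pel q))"
  unfolding bas_def by (simp add: cls_mult kG_pel)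

lemma qder_zero: "is_qder Q I D \<Longrightarrow> coords (D (cls I (\<lambda>_. 0))) p = 0"
proof -
  assume D: "is_qder Q I D"
  have "cls I (\<lambda>_. 0) = qsmult I 0 (cls I (\<lambda>_. 0))" unfolding qsmult_def by simp
  then show ?thesis using is_qderD(3)[OF D cls_car[OF kG_zero], of 0 p] by simp
qed

text \<open>The standard normalisation: subtracting the inner derivation by \<open>\<Sum>v. D(e_v) e_v\<close>
  makes a derivation vanish on all vertices.\<close>

lemma qder_vanish_on_vertices:
  assumes D: "is_qder Q I D"
  obtains A where "A \<in> qcar Q I" "\<And>v q. v \<in> V \<Longrightarrow> N q \<Longrightarrow> coords (D (bas (v, []))) q = coords (inner A (bas (v, []))) q"
proof -
  define d where "d v = coords (D (bas (v, [])))" for v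
  \<comment> \<open>The coefficient at \<open>q\<close> of the sum of all D(e_w) e_w: right
    multiplication by e_w keeps only paths ending at \<open>w\<close>, so only the end of
    \<open>q\<close> contributes.\<close>
  define \<alpha> where "\<alpha> q = (if N q then d (pend Q q) q else 0)" for q
  have car: "bas (v, []) \<in> qcar Q I" if "v \<in> V" for v using bas_car that by simp
  have dk: "d v \<in> kG Q" if "v \<in> V" for v unfolding d_def by (intro coords_kG is_qderD(1)[OF D] car that)
  have "{q. \<alpha> q \<noteq> 0} \<subseteq> (\<Union>v\<in>V. {q. d v q \<noteq> 0})"
  proof
    fix q assume "q \<in> {q. \<alpha> q \<noteq> 0}"
    then have "N q" "d (pend Q q) q \<noteq> 0" unfolding \<alpha>_def by (simp_all split: if_splits)
    then show "q \<in> (\<Union>v\<in>V. {q. d v q \<noteq> 0})" using pend_V[OF N_path] by blast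
  qed
  then have "finite {q. \<alpha> q \<noteq> 0}" by (rule finite_subset) (use finite_V dk kG_finite in auto)
  then have \<alpha>: "\<alpha> \<in> kG Q" unfolding kG_def \<alpha>_def using N_path by auto
  have ca: "coords (cls I \<alpha>) = \<alpha>" unfolding fun_eq_iff coords_cls \<alpha>_def by simp
  \<comment> \<open>From e_v e_v = e_v. It forces the coefficient of D(e_v) at \<open>q\<close> to
    vanish unless exactly one end of \<open>q\<close> is \<open>v\<close>.\<close>
  have sq: "d v q = d v q * of_bool (pend Q q = v) + d v q * of_bool (fst q = v)" if "v \<in> V" "N q" for v q
  proof -
    have e: "qmult Q I (bas (v, [])) (bas (v, [])) = bas (v, [])"
    proof -
      have "pmult Q (pel (v, [])) (pel (v, [])) = (pel (v, []) :: _ \<Rightarrow> 'k)"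
        using pmult_pel[of "(v, [])" "(v, [])"] that by simp
      then show ?thesis using bas_mult[of "(v, [])" "(v, [])"] that by (simp add: bas_def)
    qed
    have "d v q = pmult Q (d v) (pel (v, [])) q + pmult Q (pel (v, [])) (d v) q"
      using is_qderD(4)[OF D car[OF that(1)] car[OF that(1)] that(2)]
      unfolding e coords_bas_N[OF N_vertex[OF that(1)]] d_def .
    then show ?thesis
      unfolding pmult_pel_vertex_right[OF N_path[OF that(2)]] pmult_pel_vertex_left[OF N_path[OF that(2)]] .
  qed
  \<comment> \<open>From e_v e_w = 0. For a path from \<open>v\<close> to \<open>w\<close> it says
    that D(e_v) and D(e_w) have opposite coefficients there, which gives the minus sign of the
    commutator.\<close>
  have orth: "d v q * of_bool (pend Q q = w) + d w q * of_bool (fst q = v) = 0"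
    if "v \<in> V" "w \<in> V" "v \<noteq> w" "N q" for v w q
  proof -
    have "qmult Q I (bas (v, [])) (bas (w, [])) = cls I (\<lambda>_. 0)"
    proof -
      have "pmult Q (pel (v, [])) (pel (w, [])) = (\<lambda>_. 0::'k)"
        by (rule pmult_mismatch) (use that in \<open>auto simp: pel_def split: if_splits\<close>)
      then show ?thesis using bas_mult[of "(v, [])" "(w, [])"] that by simp
    qed
    then show ?thesis
      using is_qderD(4)[OF D car[OF that(1)] car[OF that(2)] that(4)] qder_zero[OF D, of q]
      unfolding coords_bas_N[OF N_vertex[OF that(1)]] coords_bas_N[OF N_vertex[OF that(2)]] d_def[symmetric]
      by (simp add: pmult_pel_vertex_right pmult_pel_vertex_left N_path[OF that(4)])
  qed
  show ?thesis
  proof (rule that[of "cls I \<alpha>"])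
    show "cls I \<alpha> \<in> qcar Q I" using \<alpha> by (rule cls_car)
    fix v q assume v: "v \<in> V" and q: "N q"
    have "d v q = \<alpha> q * of_bool (pend Q q = v) - \<alpha> q * of_bool (fst q = v)"
    proof (cases "pend Q q = v")
      case True
      show ?thesis
      proof (cases "fst q = v")
        case fst: True
        have "d v q + d v q = d v q" using sq[OF v q] True fst by simp
        then have "d v q = 0" by (metis add_cancel_right_right)
        then show ?thesis using True fst by simp
      next
        case False
        then show ?thesis using True q unfolding \<alpha>_def by simp
      qed
    next
      case False
      have w: "pend Q q \<in> V" using pend_V N_path q by blast
      show ?thesis using False sq[OF v q] orth[OF v w _ q] q unfolding \<alpha>_def
        by (cases "fst q = v") (auto simp: eq_neg_iff_add_eq_0)
    qed
    then show "coords (D (bas (v, []))) q = coords (inner (cls I \<alpha>) (bas (v, []))) q"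
      unfolding coords_inner[OF q] coords_bas_N[OF N_vertex[OF v]] ca d_def[symmetric]
      by (simp add: pmult_pel_vertex_right pmult_pel_vertex_left N_path[OF q])
  qed
qed

lemma vertex_arrow_mult:
  assumes "a \<in> E"
  shows "qmult Q I (bas (src a, [])) (bas (apath Q a)) = bas (apath Q a)"
    "qmult Q I (bas (apath Q a)) (bas (tgt a, [])) = bas (apath Q a)"
proof -
  note k = src_V[OF assms] tgt_V[OF assms] is_qpath_apath[OF assms]
  have "pmult Q (pel (src a, [])) (pel (apath Q a)) = (pel (apath Q a) :: _ \<Rightarrow> 'k)"
    using pmult_pel[of "(src a, [])" "apath Q a"] k by (simp add: apath_def)
  then show "qmult Q I (bas (src a, [])) (bas (apath Q a)) = bas (apath Q a)"
    using bas_mult[of "(src a, [])" "apath Q a"] k by (simp add: bas_def)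
  have "pmult Q (pel (apath Q a)) (pel (tgt a, [])) = (pel (apath Q a) :: _ \<Rightarrow> 'k)"
    using pmult_pel[of "apath Q a" "(tgt a, [])"] k by (simp add: apath_def)
  then show "qmult Q I (bas (apath Q a)) (bas (tgt a, [])) = bas (apath Q a)"
    using bas_mult[of "apath Q a" "(tgt a, [])"] k by (simp add: bas_def)
qed

text \<open>An arrow satisfies a = e_{t(a)} a e_{h(a)}. When both vertices are killed, D(a) =
  e_{t(a)} D(a) e_{h(a)}.\<close>

lemma qder_arrow_parallel:
  assumes D: "is_qder Q I D" and v: "\<And>v q. v \<in> V \<Longrightarrow> coords (D (bas (v, []))) q = 0"
    and a: "a \<in> E" and nz: "coords (D (bas (apath Q a))) q \<noteq> 0"
  shows "qparallel Q (apath Q a) q"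
proof -
  have q: "N q" using nz coords_notN by blast
  have z: "coords (D (bas (u, []))) = (\<lambda>_. 0)" if "u \<in> V" for u using v[OF that] by (simp add: fun_eq_iff)
  note k = src_V[OF a] tgt_V[OF a]
  have car: "bas (src a, []) \<in> qcar Q I" "bas (tgt a, []) \<in> qcar Q I" using bas_car k by simp_all
  have "coords (D (bas (apath Q a))) q = coords (D (bas (apath Q a))) q * of_bool (fst q = src a)"
    using is_qderD(4)[OF D car(1) bas_arrow_car[OF a] q]
    unfolding vertex_arrow_mult[OF a] z[OF k(1)] coords_bas_N[OF N_vertex[OF k(1)]]
    by (simp add: pmult_zero_left pmult_pel_vertex_left N_path[OF q])
  moreover have "coords (D (bas (apath Q a))) q = coords (D (bas (apath Q a))) q * of_bool (pend Q q = tgt a)"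
    using is_qderD(4)[OF D bas_arrow_car[OF a] car(2) q]
    unfolding vertex_arrow_mult[OF a] z[OF k(2)] coords_bas_N[OF N_vertex[OF k(2)]]
    by (simp add: pmult_zero_right pmult_pel_vertex_right N_path[OF q])
  ultimately have "fst q = src a" "pend Q q = tgt a" using nz by (auto split: if_splits)
  then show ?thesis unfolding qparallel_def pstart_def by (simp add: apath_def)
qed

section \<open>Reduction of the basis to linear algebra on k^E\<close>

context
  fixes vpos :: "'v \<Rightarrow> complex" and earc :: "'a \<Rightarrow> real \<Rightarrow> complex"
  assumes finF: "finite (bounded_faces Q vpos earc)"
    and indep: "\<And>(c :: complex set \<Rightarrow> 'k) \<phi> f. (\<And>a. a \<in> E \<Longrightarrow>
      (\<Sum>f\<in>bounded_faces Q vpos earc. c f * face_sign Q vpos earc a f) = \<phi> (src a) - \<phi> (tgt a)) \<Longrightarrow>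
      f \<in> bounded_faces Q vpos earc \<Longrightarrow> c f = 0"
    and spanning: "\<And>x :: 'a \<Rightarrow> 'k. \<exists>c \<phi>. \<forall>a\<in>E. x a =
      (\<Sum>f\<in>bounded_faces Q vpos earc. c f * face_sign Q vpos earc a f) + (\<phi> (src a) - \<phi> (tgt a))"
begin

abbreviation "\<F> \<equiv> bounded_faces Q vpos earc"
abbreviation "sg \<equiv> (face_sign Q vpos earc :: 'a \<Rightarrow> complex set \<Rightarrow> 'k)"
abbreviation "\<D> \<equiv> Dface Q I vpos earc"

lemma coords_Dface: "X \<in> qcar Q I \<Longrightarrow> coords (\<D> f X) q = (\<Sum>a\<in>E. sg a f * coords (Dbar Q I a (apath Q a) X) q)"
  unfolding Dface_def by (simp add: coords_cls) (simp add: coords_def)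

lemma is_qder_Dface: "is_qder Q I (\<D> f)"
proof (rule is_qder_lincomb[of E "\<lambda>a. Dbar Q I a (apath Q a)" "\<D> f" "\<lambda>a. sg a f"])
  fix X assume X: "X \<in> qcar Q I"
  show "\<D> f X \<in> qcar Q I" unfolding Dface_def using X
    by (simp, intro cls_car kG_sum qrep_kG is_qderD(1)[OF is_qder_Dloop]) auto
qed (auto intro: is_qder_Dloop coords_Dface)

lemma coords_Dface_arrow:
  assumes a: "a \<in> E" shows "coords (\<D> f (bas (apath Q a))) q = (if q = apath Q a then sg a f else 0)"
proof -
  have "coords (\<D> f (bas (apath Q a))) q = (\<Sum>b\<in>E. if b = a then (if q = apath Q a then sg a f else 0) else 0)"
    unfolding coords_Dface[OF bas_arrow_car[OF a]] using N_arrow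
    by (intro sum.cong refl) (auto simp: coords_Dloop_arrow a)
  then show ?thesis using a finite_E by simp
qed

lemma coords_Dface_vertex:
  assumes v: "v \<in> V" shows "coords (\<D> f (bas (v, []))) q = 0"
proof -
  have "bas (v, []) \<in> qcar Q I" using v bas_car by simp
  then show ?thesis using v by (simp add: coords_Dface coords_Dloop_vertex)
qed

text \<open>The face derivations are collected as a set of maps, so two faces must not share one. If
  they did, the difference of their indicator functions would be a nontrivial relation with zero
  coboundary.\<close>

lemma Dface_inj: "inj_on \<D> \<F>"
proof (rule inj_onI, rule ccontr)
  fix f g assume fg: "f \<in> \<F>" "g \<in> \<F>" "\<D> f = \<D> g" "f \<noteq> g"
  have "sg a f = sg a g" if "a \<in> E" for a
    using coords_Dface_arrow[OF that, of f "apath Q a"] coords_Dface_arrow[OF that, of g "apath Q a"] fg(3) by simp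
  moreover have "(\<Sum>h\<in>\<F>. (of_bool (h = f) - of_bool (h = g)) * sg a h) = sg a f - sg a g" for a
  proof -
    have "(\<Sum>h\<in>\<F>. (of_bool (h = f) - of_bool (h = g)) * sg a h) =
      (\<Sum>h\<in>\<F>. if h = f then sg a h else 0) - (\<Sum>h\<in>\<F>. if h = g then sg a h else 0)"
      unfolding sum_subtractf[symmetric] by (rule sum.cong) auto
    then show ?thesis using finF fg by simp
  qed
  ultimately have "(\<Sum>h\<in>\<F>. (of_bool (h = f) - of_bool (h = g)) * sg a h) = (\<lambda>_. 0) (src a) - (\<lambda>_. 0) (tgt a)"
    if "a \<in> E" for a using that by simp
  from indep[of "\<lambda>h. of_bool (h = f) - of_bool (h = g)" "\<lambda>_. 0", OF this fg(1)] show False using fg(4) by simp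
qed

abbreviation "\<S> \<equiv> (B2 Q I - BE Q I) \<union> BP Q I vpos earc"

lemma S_cases:
  assumes "D \<in> \<S>"
  obtains r s where "(r, s) \<in> qpairs" "D = Dbar Q I r s" | f where "f \<in> \<F>" "D = \<D> f"
  using assms unfolding B2_minus_BE BP_def by auto

lemma is_qder_S: "D \<in> \<S> \<Longrightarrow> is_qder Q I D"
  by (erule S_cases) (use qpairsD in \<open>auto intro!: is_qder_Dface is_qder_Dbar\<close>)

lemma coords_S_vertex: "D \<in> \<S> \<Longrightarrow> v \<in> V \<Longrightarrow> coords (D (bas (v, []))) q = 0"
  by (erule S_cases) (use qpairsD in \<open>auto intro!: coords_Dface_vertex coords_Dbar_vertex\<close>)

lemma coords_S_arrow_nonzero: "D \<in> \<S> \<Longrightarrow> a \<in> E \<Longrightarrow> coords (D (bas (apath Q a))) q \<noteq> 0 \<Longrightarrow> qparallel Q (apath Q a) q"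
  by (rule qder_arrow_parallel[OF is_qder_S]) (auto intro: coords_S_vertex)

text \<open>The coefficient at \<open>s\<close> of the value on \<open>r\<close> is the functional
  dual to D_{r,s} within the candidate basis; face derivations are diagonal and do not meet
  it.\<close>

lemma coords_S_pair:
  assumes "D \<in> \<S>" "(r, s) \<in> qpairs"
  shows "coords (D (bas (apath Q r))) s = (if D = Dbar Q I r s then 1 else 0)"
proof -
  have r: "r \<in> E" "s \<noteq> apath Q r" using qpairsD[OF assms(2)] by auto
  have own: "coords (Dbar Q I r s (bas (apath Q r))) s = 1" using coords_pair_arrow[OF assms(2) r(1)] by simp
  show ?thesis
  proof (cases "D = Dbar Q I r s")
    case False
    from assms(1) show ?thesis
    proof (cases rule: S_cases)
      case (1 r' s')
      then show ?thesis using coords_pair_arrow[OF 1(1) r(1)] False by auto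
    next
      case (2 f)
      then show ?thesis using coords_Dface_arrow[OF r(1)] r(2) False by simp
    qed
  qed (simp add: own)
qed

lemma sum_S_pair:
  assumes "finite F" "F \<subseteq> \<S>" "(r, s) \<in> qpairs"
  shows "(\<Sum>D\<in>F. c D * coords (D (bas (apath Q r))) s) = (if Dbar Q I r s \<in> F then c (Dbar Q I r s) else 0)"
proof -
  have "(\<Sum>D\<in>F. c D * coords (D (bas (apath Q r))) s) = (\<Sum>D\<in>F. if D = Dbar Q I r s then c D else 0)"
    using coords_S_pair[OF _ assms(3)] assms(2) by (intro sum.cong) auto
  then show ?thesis using assms(1) by simp
qed

text \<open>Only face derivations have diagonal entries. Injectivity of \<open>\<D>\<close> turns
  the sum over maps into a sum over faces, the form in which the planar facts apply.\<close>

lemma sum_S_loop: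
  assumes F: "finite F" "F \<subseteq> \<S>" and a: "a \<in> E"
  shows "(\<Sum>D\<in>F. c D * coords (D (bas (apath Q a))) (apath Q a)) =
    (\<Sum>f\<in>\<F>. (if \<D> f \<in> F then c (\<D> f) else 0) * sg a f)"
proof -
  let ?B = "\<D> ` \<F>"
  let ?g = "\<lambda>D. c D * coords (D (bas (apath Q a))) (apath Q a)"
  have "(\<Sum>D\<in>F. ?g D) = (\<Sum>D\<in>F \<inter> ?B. ?g D)"
  proof (rule sum.mono_neutral_right[OF F(1)])
    show "\<forall>D\<in>F - F \<inter> ?B. ?g D = 0"
    proof
      fix D assume D: "D \<in> F - F \<inter> ?B"
      then have "D \<in> \<S>" using F by auto
      then show "?g D = 0"
      proof (cases rule: S_cases)
        case (1 r s)
        then show ?thesis using coords_pair_arrow[OF 1(1) a, of "apath Q a"] qpairsD[OF 1(1)] by auto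
      next
        case (2 f) then show ?thesis using D by auto
      qed
    qed
  qed auto
  also have "\<dots> = (\<Sum>D\<in>?B. if D \<in> F then ?g D else 0)"
    using finF by (subst sum.inter_restrict[symmetric]) (auto simp: Int_commute)
  also have "\<dots> = (\<Sum>f\<in>\<F>. if \<D> f \<in> F then ?g (\<D> f) else 0)"
    by (rule sum.reindex_cong[OF Dface_inj]) auto
  also have "\<dots> = (\<Sum>f\<in>\<F>. (if \<D> f \<in> F then c (\<D> f) else 0) * sg a f)"
    by (intro sum.cong) (auto simp: coords_Dface_arrow[OF a])
  finally show ?thesis .
qed

text \<open>An inner derivation has no coefficient at a pair in \<open>qpairs\<close>, which
  isolates each D_{r,s}. On the diagonal it is the coboundary of the vertex coefficients of
  \<open>A\<close>, and independence of face boundaries modulo coboundaries takes over.\<close>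

lemma S_independent:
  assumes F: "finite F" "F \<subseteq> \<S>" and inn: "inner_qder Q I (qcomb I F c)" and D: "D \<in> F"
  shows "c D = 0"
proof -
  obtain A where A: "A \<in> qcar Q I" "\<And>X. X \<in> qcar Q I \<Longrightarrow> qcomb I F c X = inner A X"
    using inn unfolding inner_qder_iff by blast
  have eq: "(\<Sum>D\<in>F. c D * coords (D (bas (apath Q a))) q) =
      (if q = apath Q a then coords A (src a, []) - coords A (tgt a, []) else 0)"
    if "a \<in> E" "N q" "qparallel Q (apath Q a) q" for a q
    using coords_qcomb[of F c "bas (apath Q a)" q] A(2)[OF bas_arrow_car[OF that(1)]] coords_inner_arrow[OF that(1,2), of A] that(3)
    by simp
  have "D \<in> \<S>" using F D by auto
  then show ?thesis
  proof (cases rule: S_cases)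
    case (1 r s)
    note p = qpairsD[OF 1(1)]
    have "c D = (\<Sum>D\<in>F. c D * coords (D (bas (apath Q r))) s)"
      using sum_S_pair[OF F 1(1), of c] D 1(2) by simp
    also have "\<dots> = 0" using eq[of r s] p by simp
    finally show ?thesis .
  next
    case (2 f)
    have "(\<Sum>f\<in>\<F>. (if \<D> f \<in> F then c (\<D> f) else 0) * sg a f) =
      (\<lambda>v. coords A (v, [])) (src a) - (\<lambda>v. coords A (v, [])) (tgt a)" if "a \<in> E" for a
      using sum_S_loop[OF F that, of c] eq[OF that N_arrow[OF that] parallel_refl] by simp
    from indep[of "\<lambda>f. if \<D> f \<in> F then c (\<D> f) else 0" "\<lambda>v. coords A (v, [])", OF this 2(1)]
    show ?thesis using 2(2) D by simp
  qed
qed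

lemma S_spanning:
  assumes D: "is_qder Q I D"
  shows "\<exists>F c. finite F \<and> F \<subseteq> \<S> \<and> inner_qder Q I (\<lambda>X. qadd I (D X) (qsmult I (-1) (qcomb I F c X)))"
proof -
  obtain A where A: "A \<in> qcar Q I"
    "\<And>v q. v \<in> V \<Longrightarrow> N q \<Longrightarrow> coords (D (bas (v, []))) q = coords (inner A (bas (v, []))) q"
    using qder_vanish_on_vertices[OF D] by blast
  \<comment> \<open>Normalised to kill the vertices. Its off-diagonal entries on arrows become
    coefficients of the D_{r,s}; its diagonal is split into face boundaries and a
    coboundary.\<close>
  define D1 where "D1 X = qadd I (D X) (qsmult I (-1) (inner A X))" for X
  have D1: "is_qder Q I D1" unfolding D1_def[abs_def] by (rule is_qder_diff[OF D is_qder_inner[OF A(1)]])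
  have D1v: "coords (D1 (bas (v, []))) q = 0" if "v \<in> V" for v q
    using A(2)[OF that, of q] coords_notN[of q] unfolding D1_def by (cases "N q") (auto simp: coords_qadd coords_qsmult)
  define l where "l a = coords (D1 (bas (apath Q a)))" for a
  have par: "qparallel Q (apath Q a) q" if "a \<in> E" "l a q \<noteq> 0" for a q
    using qder_arrow_parallel[OF D1 D1v that(1)] that(2) unfolding l_def by blast
  obtain c0 \<phi> where c0: "\<And>a. a \<in> E \<Longrightarrow> l a (apath Q a) = (\<Sum>f\<in>\<F>. c0 f * sg a f) + (\<phi> (src a) - \<phi> (tgt a))"
    using spanning[of "\<lambda>a. l a (apath Q a)"] by blast
  let ?g = "\<lambda>(r, s). Dbar Q I r s"
  define P where "P = {(a, s) \<in> qpairs. l a s \<noteq> 0}"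
  have Pq: "P \<subseteq> qpairs" unfolding P_def by auto
  have "P \<subseteq> (\<Union>a\<in>E. {a} \<times> {s. l a s \<noteq> 0})" unfolding P_def qpairs_def by auto
  moreover have "finite {s. l a s \<noteq> 0}" if "a \<in> E" for a
    unfolding l_def by (rule kG_finite[OF coords_kG[OF is_qderD(1)[OF D1 bas_arrow_car[OF that]]]])
  ultimately have finP: "finite P" using finite_E by (auto intro: finite_subset)
  define F where "F = ?g ` P \<union> \<D> ` \<F>"
  \<comment> \<open>A coefficient has to be attached to a map, so the index is recovered by
    \<open>inv_into\<close>. The cases do not conflict because no D_{r,s} in question is a face
    derivation (\<open>notB\<close>).\<close>
  define c where "c D = (if D \<in> \<D> ` \<F> then c0 (inv_into \<F> \<D> D) else case_prod l (inv_into qpairs ?g D))" for D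
  have F: "finite F" "F \<subseteq> \<S>" unfolding F_def using finP finF Pq B2_minus_BE unfolding BP_def by auto
  have notB: "Dbar Q I r s \<notin> \<D> ` \<F>" if "(r, s) \<in> qpairs" for r s
  proof
    assume "Dbar Q I r s \<in> \<D> ` \<F>"
    then obtain f where f: "Dbar Q I r s = \<D> f" by auto
    have "r \<in> E" "s \<noteq> apath Q r" using qpairsD[OF that] by auto
    then show False
      using coords_pair_arrow[OF that, of r s] coords_Dface_arrow[of r f s] f by simp
  qed
  have cp: "(if Dbar Q I a s \<in> F then c (Dbar Q I a s) else 0) = l a s" if as: "(a, s) \<in> qpairs" for a s
  proof -
    have "inv_into qpairs ?g (?g (a, s)) = (a, s)" by (rule inv_into_f_f[OF Dbar_pair_inj as])
    then have "c (Dbar Q I a s) = l a s" unfolding c_def using notB[OF as] by simp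
    moreover have "Dbar Q I a s \<in> F \<longleftrightarrow> l a s \<noteq> 0"
    proof -
      have "Dbar Q I a s \<in> ?g ` P \<longleftrightarrow> (a, s) \<in> P"
        using inj_on_image_mem_iff[OF Dbar_pair_inj as Pq] by simp
      then show ?thesis unfolding F_def using notB[OF as] as by (auto simp: P_def)
    qed
    ultimately show ?thesis by simp
  qed
  have cf: "(if \<D> f \<in> F then c (\<D> f) else 0) = c0 f" if "f \<in> \<F>" for f
    using that inv_into_f_f[OF Dface_inj that] unfolding F_def c_def by simp
  \<comment> \<open>The combination of vertices with weights \<open>\<phi>\<close>; its inner
    derivation multiplies each arrow by the coboundary of \<open>\<phi>\<close>, the part left over
    by the faces.\<close>
  define \<beta> :: "('v,'a) qpath \<Rightarrow> 'k" where "\<beta> q = (if snd q = [] \<and> fst q \<in> V then \<phi> (fst q) else 0)" for q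
  have "{q. \<beta> q \<noteq> 0} \<subseteq> (\<lambda>v. (v, [])) ` V" unfolding \<beta>_def by (force split: if_splits)
  then have "finite {q. \<beta> q \<noteq> 0}" by (rule finite_subset) (use finite_V in auto)
  then have \<beta>: "\<beta> \<in> kG Q" unfolding kG_def \<beta>_def by (auto split: if_splits)
  define B where "B = cls I \<beta>"
  have B: "B \<in> qcar Q I" unfolding B_def using \<beta> by (rule cls_car)
  have Bt: "\<forall>p. coords B p \<noteq> 0 \<longrightarrow> snd p = []" unfolding B_def coords_cls \<beta>_def by (auto split: if_splits)
  have Bv: "coords B (v, []) = \<phi> v" if "v \<in> V" for v
    unfolding B_def coords_cls \<beta>_def using that N_vertex by simp
  have qc: "is_qder Q I (qcomb I F c)" by (rule is_qder_qcomb) (use F is_qder_S in blast)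
  define D2 where "D2 X = qadd I (D1 X) (qsmult I (-1) (qcomb I F c X))" for X
  have D2: "is_qder Q I D2" unfolding D2_def[abs_def] by (rule is_qder_diff[OF D1 qc])
  have c2: "coords (D2 X) q = coords (D1 X) q - (\<Sum>D\<in>F. c D * coords (D X) q)" for X q
    unfolding D2_def by (simp add: coords_qadd coords_qsmult coords_qcomb)
  \<comment> \<open>Two derivations are compared, so only vertices and arrows have to be
    checked.\<close>
  have D2B: "D2 X = inner B X" if X: "X \<in> qcar Q I" for X
  proof (rule qder_eqI[OF D2 is_qder_inner[OF B] _ _ X])
    fix v assume v: "v \<in> V"
    then have car: "bas (v, []) \<in> qcar Q I" using bas_car by simp
    show "D2 (bas (v, [])) = inner B (bas (v, []))"
    proof (rule qcar_eqI[OF is_qderD(1)[OF D2 car] inner_car[OF B car]])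
      fix q assume q: "N q"
      have "coords (D2 (bas (v, []))) q = 0"
        unfolding c2 using D1v[OF v] coords_S_vertex[OF _ v] F(2) by (simp add: subset_iff)
      moreover have "coords B q * of_bool (pend Q q = v) = coords B q * of_bool (fst q = v)"
      proof (cases "snd q = []")
        case False
        then have "coords B q = 0" using Bt by blast
        then show ?thesis by simp
      qed (simp add: pend_def)
      ultimately show "coords (D2 (bas (v, []))) q = coords (inner B (bas (v, []))) q"
        unfolding coords_inner[OF q] coords_bas_N[OF N_vertex[OF v]]
        by (simp add: pmult_pel_vertex_right pmult_pel_vertex_left N_path[OF q])
    qed
  next
    fix a assume a: "a \<in> E"
    show "D2 (bas (apath Q a)) = inner B (bas (apath Q a))"
    proof (rule qcar_eqI[OF is_qderD(1)[OF D2 bas_arrow_car[OF a]] inner_car[OF B bas_arrow_car[OF a]]])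
      fix q assume q: "N q"
      have in_eq: "coords (inner B (bas (apath Q a))) q = (if q = apath Q a then \<phi> (src a) - \<phi> (tgt a) else 0)"
        using coords_inner_arrow[OF a q disjI2[OF Bt]] Bv src_V[OF a] tgt_V[OF a] by simp
      consider "\<not> qparallel Q (apath Q a) q" | "q = apath Q a" | "(a, q) \<in> qpairs"
        using a q unfolding qpairs_def by auto
      then show "coords (D2 (bas (apath Q a))) q = coords (inner B (bas (apath Q a))) q"
      proof cases
        case 1
        then have "q \<noteq> apath Q a" using parallel_refl by blast
        moreover have "l a q = 0" using par[OF a] 1 by blast
        moreover have "coords (D (bas (apath Q a))) q = 0" if "D \<in> F" for D
          using coords_S_arrow_nonzero[of D, OF _ a] 1 that F(2) by blast
        ultimately show ?thesis unfolding c2 in_eq l_def[symmetric] by simp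
      next
        case 2
        have "(\<Sum>f\<in>\<F>. (if \<D> f \<in> F then c (\<D> f) else 0) * sg a f) = (\<Sum>f\<in>\<F>. c0 f * sg a f)"
          using cf by (intro sum.cong) auto
        then show ?thesis unfolding c2 in_eq l_def[symmetric]
          using sum_S_loop[OF F a, of c] c0[OF a] 2 by simp
      next
        case 3
        then have "q \<noteq> apath Q a" using qpairsD by blast
        then show ?thesis unfolding c2 in_eq l_def[symmetric]
          using sum_S_pair[OF F 3, of c] cp[OF 3] by simp
      qed
    qed
  qed
  have "qadd I (D X) (qsmult I (-1) (qcomb I F c X)) = inner (qadd I A B) X" if X: "X \<in> qcar Q I" for X
  proof (rule qcar_eqI)
    show "qadd I (D X) (qsmult I (-1) (qcomb I F c X)) \<in> qcar Q I"
      using is_qderD(1)[OF is_qder_diff[OF D qc] X] .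
    show "inner (qadd I A B) X \<in> qcar Q I" by (intro inner_car qadd_car A(1) B X)
    fix q assume q: "N q"
    have "coords (D1 X) q - coords (qcomb I F c X) q = coords (inner B X) q"
      using D2B[OF X] c2[of X q] coords_qcomb[of F c X q] by simp
    moreover have "coords (D X) q = coords (D1 X) q + coords (inner A X) q"
      unfolding D1_def by (simp add: coords_qadd coords_qsmult)
    moreover have "coords (inner (qadd I A B) X) q = coords (inner A X) q + coords (inner B X) q"
    proof -
      have "coords (qadd I A B) = (\<lambda>p. coords A p + coords B p)" by (simp add: fun_eq_iff coords_qadd)
      then show ?thesis unfolding coords_inner[OF q] by (simp add: pmult_add_left pmult_add_right)
    qed
    ultimately show "coords (qadd I (D X) (qsmult I (-1) (qcomb I F c X))) q = coords (inner (qadd I A B) X) q"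
      by (simp add: coords_qadd coords_qsmult algebra_simps)
  qed
  then have "inner_qder Q I (\<lambda>X. qadd I (D X) (qsmult I (-1) (qcomb I F c X)))"
    unfolding inner_qder_iff using qadd_car[OF A(1) B] by blast
  then show ?thesis using F by blast
qed

lemma hh1_basis_S: "hh1_basis Q I \<S>"
  unfolding hh1_basis_def using is_qder_S S_independent S_spanning by blast

end

end

section \<open>Plane drawings\<close>

text \<open>The inverse of an arc would embed an open subset of the plane continuously into the
  line, against invariance of dimension.\<close>

lemma interior_arc_image_complex:
  fixes g :: "real \<Rightarrow> complex"
  assumes "arc g"
  shows "interior (path_image g) = {}"
proof (rule ccontr)
  assume ne: "interior (path_image g) \<noteq> {}"
  obtain h where h: "homeomorphism {0..1} (path_image g) g h"
    using homeomorphism_arc[OF assms] by blast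
  have "continuous_on (interior (path_image g)) h"
    using h homeomorphism_cont2 continuous_on_subset interior_subset by metis
  moreover have "inj_on h (interior (path_image g))"
    using h interior_subset unfolding homeomorphism_def
    by (metis inj_on_inverseI inj_on_subset)
  ultimately have "DIM(complex) \<le> DIM(real)"
    using invariance_of_dimension[of "interior (path_image g)" h] ne by auto
  then show False by simp
qed

text \<open>In characteristic zero \<open>'k\<close> is a rational vector space. The vector
  \<open>x\<close> extends to a basis, so some rational functional into the reals takes the value 1
  at \<open>x\<close>; rational linearity includes integer scalars.\<close>

lemma additive_functional_nonzero:
  fixes x :: "'k::field_char_0"
  assumes "x \<noteq> 0"
  obtains \<pi> :: "'k \<Rightarrow> real" where "Modules.additive \<pi>" "\<And>n u. \<pi> (of_int n * u) = of_int n * \<pi> u" "\<pi> x \<noteq> 0"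
proof -
  interpret vector_space_pair "\<lambda>(q::rat) (u::'k). of_rat q * u" "\<lambda>(q::rat) (u::real). of_rat q * u"
    by unfold_locales (simp_all add: of_rat_add of_rat_mult algebra_simps)
  have "\<not> vs1.dependent {x}" using assms by (simp add: vs1.dependent_single)
  then obtain \<pi> where \<pi>: "Vector_Spaces.linear (\<lambda>(q::rat) (u::'k). of_rat q * u) (\<lambda>(q::rat) (u::real). of_rat q * u) \<pi>" "\<pi> x = 1"
    using linear_independent_extend[of "{x}" "\<lambda>_. 1"] by auto
  have "\<pi> (of_int n * u) = of_int n * \<pi> u" for n u
    using linear_scale[OF \<pi>(1), of "of_int n" u] by simp
  moreover have "Modules.additive \<pi>" using linear_add[OF \<pi>(1)] by (simp add: Modules.additive_def)
  ultimately show ?thesis using that[of \<pi>] \<pi>(2) by simp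
qed

locale plane_quiver = fin_quiver Q for Q :: "('v,'a) quiver" +
  fixes vpos :: "'v \<Rightarrow> complex" and earc :: "'a \<Rightarrow> real \<Rightarrow> complex"
  assumes emb: "is_plane_embedding Q vpos earc"
begin

abbreviation "wn a \<equiv> winding_number (earc a)"

lemma vpos_inj: "inj_on vpos V"
  using emb unfolding is_plane_embedding_def by auto

lemma arc_earc: "a \<in> E \<Longrightarrow> arc (earc a)"
  using emb unfolding is_plane_embedding_def arc_def by auto

lemma path_earc: "a \<in> E \<Longrightarrow> path (earc a)"
  using arc_earc arc_imp_path by blast

lemma earc_start: "a \<in> E \<Longrightarrow> pathstart (earc a) = vpos (src a)"
  and earc_finish: "a \<in> E \<Longrightarrow> pathfinish (earc a) = vpos (tgt a)"
  using emb unfolding is_plane_embedding_def by auto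

text \<open>The embedding makes every arc injective on the closed unit interval, end points
  included, which rules out loops.\<close>

lemma src_neq_tgt: "a \<in> E \<Longrightarrow> src a \<noteq> tgt a"
  using arc_earc[of a] earc_start[of a] earc_finish[of a] arc_distinct_ends by force

section \<open>Vertices, open edges and subdrawings\<close>

text \<open>The arc without its end points. Vertices and cells are pairwise disjoint, so
  intersections of drawings can be computed on the graph.\<close>

definition cell :: "'a \<Rightarrow> complex set" where
  "cell a = earc a ` {0<..<1}"

lemma cell_not_vertex: "a \<in> E \<Longrightarrow> cell a \<inter> vpos ` V = {}"
  using emb unfolding is_plane_embedding_def cell_def by blast

lemma cells_disjoint: "a \<in> E \<Longrightarrow> b \<in> E \<Longrightarrow> a \<noteq> b \<Longrightarrow> cell a \<inter> cell b = {}"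
  using emb unfolding is_plane_embedding_def cell_def by blast

lemma path_image_earc:
  assumes "a \<in> E" shows "path_image (earc a) = {vpos (src a), vpos (tgt a)} \<union> cell a"
proof -
  have "{0..1::real} = {0,1} \<union> {0<..<1}" by auto
  then show ?thesis
    using earc_start[OF assms] earc_finish[OF assms]
    unfolding path_image_def cell_def pathstart_def pathfinish_def by (metis image_Un image_insert image_empty)
qed

lemma cell_connected: "a \<in> E \<Longrightarrow> connected (cell a)"
  unfolding cell_def
  using path_earc[of a] unfolding path_def
  by (meson connected_continuous_image connected_Ioo continuous_on_subset greaterThanLessThan_subseteq_atLeastAtMost_iff order_refl)

definition sub_drawing :: "'v set \<Rightarrow> 'a set \<Rightarrow> complex set" where
  "sub_drawing V' A = vpos ` V' \<union> (\<Union>a\<in>A. path_image (earc a))"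

definition subquiver :: "'v set \<Rightarrow> 'a set \<Rightarrow> bool" where
  "subquiver V' A \<longleftrightarrow> V' \<subseteq> V \<and> A \<subseteq> E \<and> (\<forall>a\<in>A. src a \<in> V' \<and> tgt a \<in> V')"

lemma sub_drawing_cells:
  assumes "subquiver V' A" shows "sub_drawing V' A = vpos ` V' \<union> (\<Union>a\<in>A. cell a)"
proof -
  have "path_image (earc a) = {vpos (src a), vpos (tgt a)} \<union> cell a" if "a \<in> A" for a
    using assms that path_image_earc unfolding subquiver_def by auto
  then show ?thesis using assms unfolding sub_drawing_def subquiver_def by auto
qed

text \<open>Because vertices and cells are disjoint pieces, drawing commutes with intersection. This
  supplies the connected intersections that Janiszewski's theorem asks for.\<close>

lemma sub_drawing_Int:
  assumes "subquiver V1 A1" "subquiver V2 A2"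
  shows "sub_drawing V1 A1 \<inter> sub_drawing V2 A2 = sub_drawing (V1 \<inter> V2) (A1 \<inter> A2)"
proof -
  have s: "subquiver (V1 \<inter> V2) (A1 \<inter> A2)" using assms unfolding subquiver_def by auto
  have 1: "vpos ` V1 \<inter> vpos ` V2 = vpos ` (V1 \<inter> V2)"
    using assms vpos_inj unfolding subquiver_def by (metis inj_on_image_Int)
  have 2: "vpos ` V1 \<inter> (\<Union>a\<in>A2. cell a) = {}" "(\<Union>a\<in>A1. cell a) \<inter> vpos ` V2 = {}"
    using assms cell_not_vertex unfolding subquiver_def by blast+
  have 3: "(\<Union>a\<in>A1. cell a) \<inter> (\<Union>a\<in>A2. cell a) = (\<Union>a\<in>A1 \<inter> A2. cell a)"
    using assms cells_disjoint unfolding subquiver_def by blast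
  show ?thesis
    unfolding sub_drawing_cells[OF assms(1)] sub_drawing_cells[OF assms(2)] sub_drawing_cells[OF s]
    by (simp only: Int_Un_distrib Int_Un_distrib2 1 2 3 Un_empty_right Un_empty_left)
qed

lemma sub_drawing_Un:
  "sub_drawing V1 A1 \<union> sub_drawing V2 A2 = sub_drawing (V1 \<union> V2) (A1 \<union> A2)"
  unfolding sub_drawing_def by auto

lemma sub_drawing_arrow:
  assumes "a \<in> E"
  shows "sub_drawing {src a, tgt a} {a} = path_image (earc a)" "subquiver {src a, tgt a} {a}"
  using path_image_earc[OF assms] src_V[OF assms] tgt_V[OF assms] assms
  unfolding sub_drawing_def subquiver_def by auto

lemma compact_sub_drawing:
  assumes "subquiver V' A" shows "compact (sub_drawing V' A)"
proof -
  have "finite V'" "finite A" using assms finite_V finite_E finite_subset unfolding subquiver_def by auto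
  moreover have "compact (path_image (earc a))" if "a \<in> A" for a
    using that assms path_earc compact_path_image unfolding subquiver_def by blast
  ultimately show ?thesis unfolding sub_drawing_def
    by (intro compact_Un compact_UN) (auto simp: finite_imp_compact)
qed

abbreviation "G A \<equiv> sub_drawing V A"

lemma subquiver_V: "A \<subseteq> E \<Longrightarrow> subquiver V A"
  unfolding subquiver_def using src_V tgt_V by auto

lemma compact_G: "A \<subseteq> E \<Longrightarrow> compact (G A)"
  using compact_sub_drawing subquiver_V by blast

lemma closed_G: "A \<subseteq> E \<Longrightarrow> closed (G A)"
  using compact_G compact_imp_closed by blast

lemma open_compl_G: "A \<subseteq> E \<Longrightarrow> open (- G A)"
  using closed_G by blast

lemma emb_image_G: "emb_image Q vpos earc = G E"
  unfolding emb_image_def sub_drawing_def ..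

lemma G_insert:
  assumes "a \<in> E" shows "G (insert a A) = G A \<union> path_image (earc a)"
  unfolding sub_drawing_def by auto

lemma G_insert_cell:
  assumes "a \<in> E" shows "G (insert a A) = G A \<union> cell a"
  using path_image_earc[OF assms] src_V[OF assms] tgt_V[OF assms]
  unfolding sub_drawing_def by auto

lemma cell_disjoint_G:
  assumes "a \<in> E" "A \<subseteq> E" "a \<notin> A" shows "cell a \<inter> G A = {}"
  unfolding sub_drawing_cells[OF subquiver_V[OF assms(2)]]
  using assms cell_not_vertex[OF assms(1)] cells_disjoint[OF assms(1)] by blast

lemma G_mono: "A \<subseteq> B \<Longrightarrow> G A \<subseteq> G B"
  unfolding sub_drawing_def by auto

section \<open>Bridges\<close>

definition reach :: "'a set \<Rightarrow> ('v \<times> 'v) set" where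
  "reach A = (\<Union>a\<in>A. {(src a, tgt a), (tgt a, src a)})\<^sup>*"

text \<open>Cut the rest of the drawing into the part joined to the source of the bridge and the
  remainder; the bridge meets each of the two parts in one point, so Janiszewski's theorem applies
  twice.\<close>

lemma bridge_separates_nothing:
  assumes a: "a \<in> E" "A \<subseteq> E" "a \<notin> A" and nr: "(src a, tgt a) \<notin> reach A"
    and x: "x \<notin> G (insert a A)" and y: "y \<notin> G (insert a A)"
    and c: "connected_component (- G A) x y"
  shows "connected_component (- G (insert a A)) x y"
proof -
  define V1 where "V1 = {v\<in>V. (src a, v) \<in> reach A}"
  define A1 where "A1 = {b\<in>A. src b \<in> V1}"
  have nbr: "(src b, tgt b) \<in> reach A" "(tgt b, src b) \<in> reach A" if "b \<in> A" for b
    unfolding reach_def using that by (auto intro: r_into_rtrancl)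
  have tr: "(u, w) \<in> reach A" if "(u, v) \<in> reach A" "(v, w) \<in> reach A" for u v w
    using that unfolding reach_def by (rule rtrancl_trans)
  have iff: "src b \<in> V1 \<longleftrightarrow> tgt b \<in> V1" if "b \<in> A" for b
    using nbr[OF that] tr that a src_V tgt_V unfolding V1_def by blast
  have s1: "subquiver V1 A1" using iff a unfolding subquiver_def A1_def V1_def by auto
  have s2: "subquiver (V - V1) (A - A1)"
    using iff a src_V tgt_V unfolding subquiver_def A1_def by auto
  have in1: "src a \<in> V1" "tgt a \<notin> V1"
    using nr src_V a unfolding V1_def reach_def by auto
  have GA: "G A = sub_drawing V1 A1 \<union> sub_drawing (V - V1) (A - A1)"
  proof -
    have "V1 \<union> (V - V1) = V" "A1 \<union> (A - A1) = A" unfolding V1_def A1_def by auto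
    then show ?thesis unfolding sub_drawing_Un by simp
  qed
  have c1: "connected_component (- sub_drawing V1 A1) x y"
    and c2: "connected_component (- sub_drawing (V - V1) (A - A1)) x y"
    using c unfolding GA by (auto elim!: connected_component_of_subset)
  have i1: "sub_drawing V1 A1 \<inter> path_image (earc a) = {vpos (src a)}"
  proof -
    have "V1 \<inter> {src a, tgt a} = {src a}" "A1 \<inter> {a} = {}" using in1 a unfolding A1_def by auto
    then show ?thesis
      using sub_drawing_Int[OF s1 sub_drawing_arrow(2)[OF a(1)]] sub_drawing_arrow(1)[OF a(1)]
      by (simp add: sub_drawing_def)
  qed
  have ca: "connected_component (- path_image (earc a)) x y"
  proof -
    have "connected (- path_image (earc a))" using connected_arc_complement[OF arc_earc[OF a(1)]] by simp
    moreover have "x \<in> - path_image (earc a)" "y \<in> - path_image (earc a)"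
      using x y unfolding G_insert[OF a(1)] by auto
    ultimately show ?thesis unfolding connected_component_def by blast
  qed
  have c3: "connected_component (- (sub_drawing V1 A1 \<union> path_image (earc a))) x y"
    using Janiszewski[of "sub_drawing V1 A1" "path_image (earc a)"] compact_sub_drawing[OF s1] i1 c1 ca
      closed_path_image[OF path_earc[OF a(1)]] by simp
  have i2: "(sub_drawing V1 A1 \<union> path_image (earc a)) \<inter> sub_drawing (V - V1) (A - A1) = {vpos (tgt a)}"
  proof -
    have "{src a, tgt a} \<inter> (V - V1) = {tgt a}" "{a} \<inter> (A - A1) = {}" using in1 a tgt_V by auto
    then have "path_image (earc a) \<inter> sub_drawing (V - V1) (A - A1) = {vpos (tgt a)}"
      using sub_drawing_Int[OF sub_drawing_arrow(2)[OF a(1)] s2] sub_drawing_arrow(1)[OF a(1)]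
      by (simp add: sub_drawing_def)
    moreover have "sub_drawing V1 A1 \<inter> sub_drawing (V - V1) (A - A1) = {}"
      unfolding sub_drawing_Int[OF s1 s2] by (simp add: sub_drawing_def)
    ultimately show ?thesis by blast
  qed
  have "connected_component (- ((sub_drawing V1 A1 \<union> path_image (earc a)) \<union> sub_drawing (V - V1) (A - A1))) x y"
    by (rule Janiszewski[OF _ _ _ c3 c2])
      (use compact_sub_drawing[OF s1] compact_sub_drawing[OF s2] i2 compact_path_image[OF path_earc[OF a(1)]]
        in \<open>auto intro: compact_imp_closed compact_Un\<close>)
  then show ?thesis unfolding G_insert[OF a(1)] GA by (simp add: Un_ac)
qed

section \<open>Circulations, routes and their winding numbers\<close>

text \<open>The boundary operator of the graph, adjoint to the coboundary
  \<open>\<phi> (src a) - \<phi> (tgt a)\<close>. Its kernel is the space of circulations.\<close>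

definition net_flow :: "('a \<Rightarrow> real) \<Rightarrow> 'v \<Rightarrow> real" where
  "net_flow y v = (\<Sum>a\<in>E. y a * (of_bool (src a = v) - of_bool (tgt a = v)))"

text \<open>Undirected walks without repeated vertices, recording visited vertices and used arrows
  so that the image is a subdrawing. A route begins with one arrow, since an arc cannot be a
  point.\<close>

inductive simple_route :: "'a set \<Rightarrow> 'v \<Rightarrow> 'v set \<Rightarrow> 'a set \<Rightarrow> 'v \<Rightarrow> bool" for A u where
  start: "b \<in> A \<Longrightarrow> u \<noteq> v \<Longrightarrow> {src b, tgt b} = {u, v} \<Longrightarrow> simple_route A u {u, v} {b} v"
| step: "simple_route A u V' B v \<Longrightarrow> b \<in> A \<Longrightarrow> {src b, tgt b} = {v, w} \<Longrightarrow> w \<notin> V' \<Longrightarrow>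
    simple_route A u (insert w V') (insert b B) w"

text \<open>Replaces the removal of loops: when a walk returns to a vertex of the route, the route
  is cut back to that vertex.\<close>

lemma simple_route_truncate:
  "simple_route A u V' B v \<Longrightarrow> w \<in> V' \<Longrightarrow> w \<noteq> u \<Longrightarrow> \<exists>V'' B'. simple_route A u V'' B' w"
  by (induction rule: simple_route.induct) (auto intro: simple_route.intros)

lemma reach_simple_route:
  assumes "(u, v) \<in> reach A" "u \<noteq> v" shows "\<exists>V' B. simple_route A u V' B v"
  using assms unfolding reach_def
proof (induction rule: rtrancl_induct)
  case (step v w)
  obtain b where b: "b \<in> A" "{src b, tgt b} = {v, w}" using step.hyps by auto
  show ?case
  proof (cases "v = u")
    case True then show ?thesis using b step.prems simple_route.start by metis
  next
    case False
    then obtain V' B where r: "simple_route A u V' B v" using step.IH by auto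
    show ?thesis
    proof (cases "w \<in> V'")
      case True then show ?thesis using simple_route_truncate[OF r] step.prems by auto
    next
      case False then show ?thesis using simple_route.step[OF r b] by auto
    qed
  qed
qed auto

text \<open>The arrow is traversed from \<open>v\<close> to \<open>w\<close>; \<open>s\<close> is 1
  or -1 according to direction, and reversal changes the winding number and the boundary by this
  same sign.\<close>

lemma oriented_arrow:
  assumes b: "b \<in> E" "{src b, tgt b} = {v, w}"
  obtains q and s :: real where "arc q" "pathstart q = vpos v" "pathfinish q = vpos w"
    "path_image q = path_image (earc b)"
    "\<And>z. z \<notin> path_image (earc b) \<Longrightarrow> winding_number q z = s * wn b z"
    "\<And>x. s * (of_bool (src b = x) - of_bool (tgt b = x)) = of_bool (x = v) - of_bool (x = w)"
proof (cases "src b = v")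
  case True
  then have "tgt b = w" using b src_neq_tgt[OF b(1)] by (auto simp: doubleton_eq_iff)
  then show ?thesis using True b that[of "earc b" 1] arc_earc earc_start earc_finish by auto
next
  case False
  then have *: "tgt b = v" "src b = w" using b by (auto simp: doubleton_eq_iff)
  show ?thesis
    by (rule that[of "reversepath (earc b)" "-1"])
      (use * b arc_earc[OF b(1)] earc_start earc_finish path_earc[OF b(1)] in
        \<open>auto simp: arc_reversepath winding_number_reversepath\<close>)
qed

text \<open>The arrows of the route are joined one by one. The new arrow meets the old arc only in
  its end point because \<open>w\<close> is new; flow and winding number both add up, so the arc is
  represented by a flow from \<open>u\<close> to \<open>v\<close>.\<close>

lemma simple_route_arc:
  assumes "simple_route A u V' B v" "A \<subseteq> E"
  shows "subquiver V' B \<and> B \<subseteq> A \<and> u \<in> V' \<and> v \<in> V' \<and> (\<exists>p y. arc p \<and> pathstart p = vpos u \<and>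
    pathfinish p = vpos v \<and> path_image p = sub_drawing V' B \<and> (\<forall>b. b \<notin> B \<longrightarrow> y b = 0) \<and>
    (\<forall>x. net_flow y x = of_bool (x = u) - of_bool (x = v)) \<and>
    (\<forall>z. z \<notin> path_image p \<longrightarrow> winding_number p z = (\<Sum>b\<in>E. y b * wn b z)))"
  using assms
proof (induction rule: simple_route.induct)
  case (start b v)
  then have b: "b \<in> E" by auto
  obtain q and s :: real where q: "arc q" "pathstart q = vpos u" "pathfinish q = vpos v"
    "path_image q = path_image (earc b)"
    "\<And>z. z \<notin> path_image (earc b) \<Longrightarrow> winding_number q z = s * wn b z"
    "\<And>x. s * (of_bool (src b = x) - of_bool (tgt b = x)) = of_bool (x = u) - of_bool (x = v)"
    using oriented_arrow[OF b start(3)] by metis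
  define y where "y c = (if c = b then s else 0)" for c
  have nf: "net_flow y x = of_bool (x = u) - of_bool (x = v)" for x
    unfolding net_flow_def y_def q(6)[symmetric] using b finite_E by (simp add: if_distrib[of "\<lambda>t. t * _"] sum.delta cong: if_cong)
  have wq: "winding_number q z = (\<Sum>c\<in>E. y c * wn c z)" if "z \<notin> path_image q" for z
  proof -
    have "(\<Sum>c\<in>E. complex_of_real (y c) * wn c z) = (\<Sum>c\<in>E. if c = b then s * wn b z else 0)"
      unfolding y_def by (rule sum.cong) auto
    then show ?thesis using q that b finite_E by simp
  qed
  have pi: "path_image q = sub_drawing {u, v} {b}"
    using sub_drawing_arrow(1)[OF b] q(4) start(3) by simp
  have sq: "subquiver {u, v} {b}" using sub_drawing_arrow(2)[OF b] start(3) by simp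
  have "\<forall>c. c \<notin> {b} \<longrightarrow> y c = 0" unfolding y_def by auto
  then show ?case using q(1-3) nf wq pi sq start(1)
    by (intro conjI exI[of _ q] exI[of _ y]) auto
next
  case (step V' B v b w)
  then have sq: "subquiver V' B" "B \<subseteq> A" "u \<in> V'" "v \<in> V'" by auto
  obtain p y where p: "arc p" "pathstart p = vpos u" "pathfinish p = vpos v"
     "path_image p = sub_drawing V' B" "\<forall>b. b \<notin> B \<longrightarrow> y b = 0"
     "\<forall>x. net_flow y x = of_bool (x = u) - of_bool (x = v)"
     "\<forall>z. z \<notin> path_image p \<longrightarrow> winding_number p z = (\<Sum>b\<in>E. y b * wn b z)"
    using step.IH step.prems by blast
  have b: "b \<in> E" using step by auto
  obtain q and s :: real where q: "arc q" "pathstart q = vpos v" "pathfinish q = vpos w"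
    "path_image q = path_image (earc b)"
    "\<And>z. z \<notin> path_image (earc b) \<Longrightarrow> winding_number q z = s * wn b z"
    "\<And>x. s * (of_bool (src b = x) - of_bool (tgt b = x)) = of_bool (x = v) - of_bool (x = w)"
    using oriented_arrow[OF b step(3)] by metis
  have bB: "b \<notin> B" using step sq unfolding subquiver_def by (metis insertI1 insertI2 insert_iff doubleton_eq_iff)
  define y' where "y' c = y c + (if c = b then s else 0)" for c
  have pi: "path_image q = sub_drawing {v, w} {b}"
    using sub_drawing_arrow(1)[OF b] q(4) step(3) by simp
  have sq': "subquiver {v, w} {b}" using sub_drawing_arrow(2)[OF b] step(3) by simp
  have "V' \<inter> {v, w} = {v}" "B \<inter> {b} = {}" using step sq bB by auto
  then have i: "path_image p \<inter> path_image q = {vpos v}"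
    unfolding p(4) pi sub_drawing_Int[OF sq(1) sq'] by (simp add: sub_drawing_def)
  have ar: "arc (p +++ q)" by (rule arc_join) (use p q i in auto)
  have pij: "path_image (p +++ q) = path_image p \<union> path_image q"
    using p q by (simp add: path_image_join)
  have pi2: "path_image (p +++ q) = sub_drawing (insert w V') (insert b B)"
  proof -
    have "V' \<union> {v, w} = insert w V'" "B \<union> {b} = insert b B" using sq by auto
    then show ?thesis unfolding pij p(4) pi sub_drawing_Un by simp
  qed
  have nf: "net_flow y' x = of_bool (x = u) - of_bool (x = w)" for x
  proof -
    have "net_flow y' x = net_flow y x + s * (of_bool (src b = x) - of_bool (tgt b = x))"
      unfolding net_flow_def y'_def using b finite_E
      by (simp add: ring_distribs sum.distrib sum_subtractf if_distrib[of "\<lambda>t. t * _"] sum.delta cong: if_cong)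
    then show ?thesis unfolding q(6) using p(6) by simp
  qed
  have wq: "winding_number (p +++ q) z = (\<Sum>c\<in>E. y' c * wn c z)" if "z \<notin> path_image (p +++ q)" for z
  proof -
    have "(\<Sum>c\<in>E. complex_of_real (y' c) * wn c z) =
      (\<Sum>c\<in>E. y c * wn c z) + (\<Sum>c\<in>E. if c = b then s * wn b z else 0)"
      unfolding y'_def sum.distrib[symmetric] by (rule sum.cong) (auto simp: ring_distribs)
    moreover have "winding_number (p +++ q) z = winding_number p z + winding_number q z"
      by (rule winding_number_join) (use p q that arc_imp_path pij in auto)
    ultimately show ?thesis using p(7) q(4,5) that b finite_E pij by simp
  qed
  have sq2: "subquiver (insert w V') (insert b B)"
    using sq sq' unfolding subquiver_def by auto
  have "\<forall>c. c \<notin> insert b B \<longrightarrow> y' c = 0" using p(5) unfolding y'_def by auto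
  then show ?case using p(1,2) q(3) ar nf wq pi2 sq2 sq step.hyps(2)
    by (intro conjI exI[of _ "p +++ q"] exI[of _ y']) auto
qed

text \<open>The winding number of the real 1-chain in which the arc of \<open>b\<close> has weight
  \<open>y b\<close>.\<close>

definition flow_wn :: "('a \<Rightarrow> real) \<Rightarrow> complex \<Rightarrow> complex" where
  "flow_wn y z = (\<Sum>b\<in>E. complex_of_real (y b) * wn b z)"

lemma flow_wn_diff: "flow_wn (\<lambda>b. y b - c * y' b) z = flow_wn y z - c * flow_wn y' z"
  unfolding flow_wn_def by (simp add: ring_distribs sum_subtractf sum_distrib_left mult.assoc)

lemma flow_wn_add: "flow_wn (\<lambda>b. y b + c * y' b) z = flow_wn y z + c * flow_wn y' z"
  unfolding flow_wn_def by (simp add: ring_distribs sum.distrib sum_distrib_left mult.assoc)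

lemma net_flow_add: "net_flow (\<lambda>b. y b + c * y' b) v = net_flow y v + c * net_flow y' v"
  unfolding net_flow_def by (simp add: algebra_simps sum.distrib sum_subtractf sum_distrib_left)

text \<open>The arc of \<open>a\<close> is the only one through \<open>p\<close>, and it has weight
  zero.\<close>

lemma continuous_flow_wn:
  assumes "a \<in> E" "p \<in> cell a" "y a = 0"
  shows "continuous (at p) (flow_wn y)"
proof -
  have eq: "flow_wn y = (\<lambda>z. \<Sum>b\<in>E-{a}. complex_of_real (y b) * wn b z)"
    unfolding flow_wn_def using assms(1,3) finite_E by (auto simp: sum.remove[of E a] fun_eq_iff)
  have "continuous (at p) (wn b)" if "b \<in> E - {a}" for b
  proof (rule continuous_at_winding_number)
    have "p \<notin> G (E - {a})" using cell_disjoint_G[of a "E - {a}"] assms by auto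
    then show "p \<notin> path_image (earc b)" using that unfolding sub_drawing_def by auto
  qed (use that path_earc in auto)
  then show ?thesis unfolding eq by (intro continuous_sum continuous_mult continuous_const) auto
qed

lemma one_le_norm_Ints:
  fixes z :: complex
  assumes "z \<in> \<int>" "z \<noteq> 0" shows "1 \<le> norm z"
proof -
  obtain n :: int where n: "z = of_int n" using assms(1) Ints_cases by auto
  then have "1 \<le> \<bar>n\<bar>" using assms(2) by auto
  then show ?thesis unfolding n by simp
qed

text \<open>The exponential of 2 pi i times the winding number of an arc is the quotient of its end
  points seen from \<open>u\<close>. Hence near \<open>w\<close> each winding number is a difference
  of two logarithms plus an integer constant, and zero net flow cancels the logarithm belonging to
  each vertex.\<close>

lemma locally_constant_flow_wn:
  assumes nf: "\<And>v. net_flow y v = 0" and c: "connected_component (- G E) x z"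
  shows "flow_wn y x = flow_wn y z"
proof -
  obtain S where S: "connected S" "S \<subseteq> - G E" "x \<in> S" "z \<in> S"
    using c unfolding connected_component_def by blast
  have loc: "\<exists>r>0. \<forall>u\<in>ball w r. flow_wn y u = flow_wn y w" if w: "w \<in> - G E" for w
  proof -
    obtain r where r: "r > 0" "ball w r \<subseteq> - G E"
      using open_compl_G[of E] w open_contains_ball by blast
    have "\<exists>h. continuous_on (ball w r) h \<and> (\<forall>u\<in>ball w r. vpos v - u = exp (h u))" if "v \<in> V" for v
    proof -
      have "vpos v - u \<noteq> 0" if "u \<in> ball w r" for u
        using \<open>v \<in> V\<close> that r(2) unfolding sub_drawing_def by auto
      moreover have "continuous_on (ball w r) (\<lambda>u. vpos v - u)" by (intro continuous_intros)
      ultimately show ?thesis by (metis continuous_logarithm_on_ball)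
    qed
    then obtain L where L: "\<And>v. v \<in> V \<Longrightarrow> continuous_on (ball w r) (L v)"
      "\<And>v u. v \<in> V \<Longrightarrow> u \<in> ball w r \<Longrightarrow> vpos v - u = exp (L v u)" by metis
    \<comment> \<open>What remains of the winding number after subtracting local logarithms of the
      end points: integer-valued and continuous on a ball, hence constant there.\<close>
    define k where "k b u = wn b u - (L (tgt b) u - L (src b) u) / (2 * pi * \<i>)" for b u
    have kc: "k b u = k b w" if b: "b \<in> E" and u: "u \<in> ball w r" for b u
    proof -
      have off: "t \<notin> path_image (earc b)" if "t \<in> ball w r" for t
        using that r(2) b unfolding sub_drawing_def by auto
      have int: "k b t \<in> \<int>" if t: "t \<in> ball w r" for t
      proof -
        have "vpos (tgt b) - t = exp (2 * pi * \<i> * wn b t) * (vpos (src b) - t)"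
          using winding_number_exp_2pi[OF path_earc[OF b] off[OF t]] earc_start[OF b] earc_finish[OF b] by simp
        then have "exp (2 * pi * \<i> * wn b t + L (src b) t) = exp (L (tgt b) t)"
          using L(2)[OF src_V[OF b] t] L(2)[OF tgt_V[OF b] t] by (simp add: exp_add)
        then obtain n :: int where n: "2 * pi * \<i> * wn b t + L (src b) t = L (tgt b) t + (of_int (2 * n) * pi) * \<i>"
          unfolding exp_eq by auto
        have "k b t = of_int n"
          using n unfolding k_def by (simp add: field_simps)
        then show ?thesis by simp
      qed
      have "continuous_on (ball w r) (wn b)"
        by (rule continuous_on_subset[OF continuous_on_winding_number[OF path_earc[OF b]]]) (use off in auto)
      then have "continuous_on (ball w r) (k b)" unfolding k_def
        using L(1)[OF src_V[OF b]] L(1)[OF tgt_V[OF b]] by (intro continuous_intros) auto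
      moreover have "\<exists>e>0. \<forall>t'. t' \<in> ball w r \<and> k b t' \<noteq> k b t \<longrightarrow> e \<le> norm (k b t' - k b t)"
        if "t \<in> ball w r" for t
      proof (intro exI[of _ 1] conjI allI impI)
        fix t' assume t': "t' \<in> ball w r \<and> k b t' \<noteq> k b t"
        then have "k b t' - k b t \<in> \<int>" "k b t' - k b t \<noteq> 0" using int that by auto
        then show "1 \<le> norm (k b t' - k b t)"
          using one_le_norm_Ints by blast
      qed simp
      ultimately have "k b constant_on ball w r"
        by (intro continuous_discrete_range_constant) auto
      then show ?thesis using u r(1) unfolding constant_on_def by (metis centre_in_ball)
    qed
    \<comment> \<open>Summation by parts: the logarithms are regrouped by vertex, and each acquires
      the factor \<open>net_flow y v = 0\<close>.\<close>
    have fl: "flow_wn y u = (\<Sum>b\<in>E. y b * k b u)" if u: "u \<in> ball w r" for u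
    proof -
      have "(\<Sum>b\<in>E. complex_of_real (y b) * (L (src b) u - L (tgt b) u))
         = (\<Sum>b\<in>E. \<Sum>v\<in>V. complex_of_real (y b * (of_bool (src b = v) - of_bool (tgt b = v))) * L v u)"
      proof (rule sum.cong[OF refl])
        fix b assume b: "b \<in> E"
        have "(\<Sum>v\<in>V. complex_of_real (y b * (of_bool (src b = v) - of_bool (tgt b = v))) * L v u)
          = y b * ((\<Sum>v\<in>V. if src b = v then L v u else 0) - (\<Sum>v\<in>V. if tgt b = v then L v u else 0))"
          unfolding sum_subtractf[symmetric] sum_distrib_left by (rule sum.cong) auto
        then show "complex_of_real (y b) * (L (src b) u - L (tgt b) u) =
          (\<Sum>v\<in>V. complex_of_real (y b * (of_bool (src b = v) - of_bool (tgt b = v))) * L v u)"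
          using src_V[OF b] tgt_V[OF b] finite_V by simp
      qed
      also have "\<dots> = (\<Sum>v\<in>V. complex_of_real (net_flow y v) * L v u)"
        unfolding net_flow_def of_real_sum sum_distrib_right by (rule sum.swap)
      finally have z: "(\<Sum>b\<in>E. complex_of_real (y b) * (L (src b) u - L (tgt b) u)) = 0"
        using nf by simp
      have "(\<Sum>b\<in>E. y b * k b u) = (\<Sum>b\<in>E. complex_of_real (y b) * wn b u
         + (complex_of_real (y b) * (L (src b) u - L (tgt b) u)) / (2 * pi * \<i>))"
        unfolding k_def by (rule sum.cong) (auto simp: field_simps)
      also have "\<dots> = flow_wn y u + (\<Sum>b\<in>E. complex_of_real (y b) * (L (src b) u - L (tgt b) u)) / (2 * pi * \<i>)"
        unfolding flow_wn_def sum.distrib sum_divide_distrib ..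
      finally show ?thesis using z by simp
    qed
    have "flow_wn y u = flow_wn y w" if "u \<in> ball w r" for u
      using fl[OF that] fl[of w] r(1) kc[OF _ that] by simp
    then show ?thesis using r(1) by blast
  qed
  show ?thesis
  proof (rule connected_local_const[OF S(1,3,4)], intro ballI)
    fix w assume "w \<in> S"
    then obtain r where r: "r > 0" "\<forall>u\<in>ball w r. flow_wn y u = flow_wn y w" using loc S(2) by blast
    then show "\<forall>\<^sub>F u in at w within S. flow_wn y w = flow_wn y u"
      unfolding eventually_at by (metis dist_commute mem_ball)
  qed
qed

section \<open>The Jordan curve through an arrow\<close>

text \<open>All that is used later about a Jordan curve through \<open>a\<close>, with the curve
  itself forgotten. \<open>y\<close> gives the weights of its arrows, \<open>\<sigma>\<close> its
  orientation, and \<open>flow_wn y\<close> its winding number: 0 outside and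
  \<open>\<sigma>\<close> inside. The last clause says that every point of the cell is approached
  from both sides.\<close>

definition bounding_cycle :: "'a \<Rightarrow> 'a set \<Rightarrow> ('a \<Rightarrow> real) \<Rightarrow> real \<Rightarrow> bool" where
  "bounding_cycle a A y \<sigma> \<longleftrightarrow>
     y a = 1 \<and> (\<forall>v. net_flow y v = 0) \<and> \<sigma> \<in> {1, -1} \<and>
     (\<forall>x. x \<notin> G (insert a A) \<longrightarrow> flow_wn y x \<in> {0, complex_of_real \<sigma>}) \<and>
     (\<forall>x z. x \<notin> G (insert a A) \<and> z \<notin> G (insert a A) \<and> connected_component (- G A) x z \<and>
       flow_wn y x = flow_wn y z \<longrightarrow> connected_component (- G (insert a A)) x z) \<and>
     (\<forall>x z. connected_component (- G (insert a A)) x z \<longrightarrow> flow_wn y x = flow_wn y z) \<and>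
     (\<forall>p e t. p \<in> cell a \<and> e > 0 \<and> t \<in> {0, complex_of_real \<sigma>} \<longrightarrow>
       (\<exists>x\<in>ball p e. x \<notin> G (insert a A) \<and> flow_wn y x = t))"

lemma bounding_cycleD:
  assumes "bounding_cycle a A y \<sigma>"
  shows "y a = 1" "\<And>v. net_flow y v = 0" "\<sigma> \<in> {1, -1}"
    "\<And>x. x \<notin> G (insert a A) \<Longrightarrow> flow_wn y x \<in> {0, complex_of_real \<sigma>}"
    "\<And>x z. x \<notin> G (insert a A) \<Longrightarrow> z \<notin> G (insert a A) \<Longrightarrow> connected_component (- G A) x z \<Longrightarrow>
       flow_wn y x = flow_wn y z \<Longrightarrow> connected_component (- G (insert a A)) x z"
    "\<And>x z. connected_component (- G (insert a A)) x z \<Longrightarrow> flow_wn y x = flow_wn y z"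
    "\<And>p e t. p \<in> cell a \<Longrightarrow> e > 0 \<Longrightarrow> t \<in> {0, complex_of_real \<sigma>} \<Longrightarrow>
       \<exists>x\<in>ball p e. x \<notin> G (insert a A) \<and> flow_wn y x = t"
  using assms unfolding bounding_cycle_def by blast+

text \<open>Close the arrow to a Jordan curve with a simple route through the other arrows. The curve meets
  the rest of the drawing in that route, which is connected, so by Janiszewski's theorem two points
  on the same side of the curve are separated only if they were so before.\<close>

lemma cycle_through_arrow:
  assumes a: "a \<in> E" "A \<subseteq> E" "a \<notin> A" and r: "(src a, tgt a) \<in> reach A"
  shows "\<exists>y \<sigma>. bounding_cycle a A y \<sigma>"
proof -
  have "(tgt a, src a) \<in> reach A"
  proof -
    have "sym (\<Union>a\<in>A. {(src a, tgt a), (tgt a, src a)})" by (auto simp: sym_def)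
    then show ?thesis using r unfolding reach_def by (meson sym_rtrancl symD)
  qed
  then obtain V' B where "simple_route A (tgt a) V' B (src a)"
    using reach_simple_route src_neq_tgt[OF a(1)] by metis
  from simple_route_arc[OF this a(2)]
  obtain p y0 where sq: "subquiver V' B" "B \<subseteq> A" "tgt a \<in> V'" "src a \<in> V'" and
    p: "arc p" "pathstart p = vpos (tgt a)" "pathfinish p = vpos (src a)" "path_image p = sub_drawing V' B"
    "\<forall>b. b \<notin> B \<longrightarrow> y0 b = 0"
    "\<forall>x. net_flow y0 x = of_bool (x = tgt a) - of_bool (x = src a)"
    "\<forall>z. z \<notin> path_image p \<longrightarrow> winding_number p z = (\<Sum>b\<in>E. y0 b * wn b z)" by blast
  \<comment> \<open>The route runs from \<open>tgt a\<close> back to \<open>src a\<close>, so the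
    curve traverses \<open>a\<close> forwards and \<open>a\<close> gets weight 1.\<close>
  define \<gamma> where "\<gamma> = earc a +++ p"
  define y where "y b = y0 b + (if b = a then 1 else 0)" for b
  have aB: "a \<notin> B" using a sq by auto
  have ij: "path_image (earc a) \<inter> path_image p = {vpos (src a), vpos (tgt a)}"
  proof -
    have "{src a, tgt a} \<inter> V' = {src a, tgt a}" "{a} \<inter> B = {}" using sq aB by auto
    then show ?thesis
      using sub_drawing_Int[OF sub_drawing_arrow(2)[OF a(1)] sq(1)]
      unfolding sub_drawing_arrow(1)[OF a(1)] p(4) by (simp add: sub_drawing_def)
  qed
  have sp: "simple_path \<gamma>" unfolding \<gamma>_def
    by (rule simple_path_join_loop) (use ij p arc_earc[OF a(1)] earc_start[OF a(1)] earc_finish[OF a(1)] in auto)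
  have loop: "pathfinish \<gamma> = pathstart \<gamma>" unfolding \<gamma>_def using p earc_start[OF a(1)] by simp
  have pi: "path_image \<gamma> = path_image (earc a) \<union> path_image p"
    unfolding \<gamma>_def using p earc_finish[OF a(1)] by (simp add: path_image_join)
  have wy: "winding_number \<gamma> z = flow_wn y z" if "z \<notin> path_image \<gamma>" for z
  proof -
    have "flow_wn y z = (\<Sum>b\<in>E. y0 b * wn b z) + (\<Sum>b\<in>E. if b = a then wn a z else 0)"
      unfolding flow_wn_def y_def sum.distrib[symmetric] by (rule sum.cong) (auto simp: ring_distribs)
    moreover have "winding_number \<gamma> z = wn a z + winding_number p z"
      unfolding \<gamma>_def
      by (rule winding_number_join) (use that pi p path_earc[OF a(1)] earc_finish[OF a(1)] arc_imp_path in auto)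
    ultimately show ?thesis using p(7) that pi a(1) finite_E by simp
  qed
  have nf: "net_flow y v = 0" for v
  proof -
    have "net_flow y v = net_flow y0 v + (of_bool (src a = v) - of_bool (tgt a = v))"
      unfolding net_flow_def y_def using a(1) finite_E
      by (simp add: ring_distribs sum.distrib sum_subtractf if_distrib[of "\<lambda>t. t * _"] sum.delta cong: if_cong)
    then show ?thesis using p(6) by auto
  qed
  have ya: "y a = 1" using p(5) aB unfolding y_def by auto
  have sub: "path_image \<gamma> \<subseteq> G (insert a A)"
    unfolding pi p(4) G_insert[OF a(1)] using sq unfolding sub_drawing_def subquiver_def by auto
  note J = Jordan_inside_outside[OF sp loop]
  have conn: "connected (inside (path_image \<gamma>))" "connected (outside (path_image \<gamma>))" using J by auto
  have out0: "flow_wn y z = 0" if "z \<in> outside (path_image \<gamma>)" for z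
    using winding_number_zero_in_outside[OF simple_path_imp_path[OF sp] loop that] wy outside_no_overlap that
    by (metis IntI empty_iff)
  obtain \<sigma> where \<sigma>: "\<sigma> \<in> {1, -1::real}" "\<And>z. z \<in> inside (path_image \<gamma>) \<Longrightarrow> winding_number \<gamma> z = complex_of_real \<sigma>"
    using simple_closed_path_winding_number_inside[OF sp] by (metis insertI1 insertI2 of_real_1 of_real_minus)
  have \<sigma>0: "complex_of_real \<sigma> \<noteq> 0" using \<sigma>(1) by auto
  have in\<sigma>: "flow_wn y z = complex_of_real \<sigma>" if "z \<in> inside (path_image \<gamma>)" for z
    using \<sigma>(2)[OF that] wy inside_no_overlap that by (metis IntI empty_iff)
  have io: "z \<in> inside (path_image \<gamma>) \<or> z \<in> outside (path_image \<gamma>)" if "z \<notin> path_image \<gamma>" for z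
    using that J by blast
  have vals: "flow_wn y x \<in> {0, complex_of_real \<sigma>}" if "x \<notin> G (insert a A)" for x
    using io[of x] that sub out0 in\<sigma> by blast
  have sep: "connected_component (- G (insert a A)) x z"
    if x: "x \<notin> G (insert a A)" and z: "z \<notin> G (insert a A)" and c: "connected_component (- G A) x z"
      and eq: "flow_wn y x = flow_wn y z" for x z
  proof -
    have "connected_component (- path_image \<gamma>) x z"
    proof (cases "x \<in> inside (path_image \<gamma>)")
      case True
      then have "z \<in> inside (path_image \<gamma>)" using io[of z] z sub eq in\<sigma>[OF True] out0[of z] \<sigma>0 by auto
      then show ?thesis using True conn inside_no_overlap[of "path_image \<gamma>"] unfolding connected_component_def
        by (intro exI[of _ "inside (path_image \<gamma>)"]) blast
    next
      case False
      then have "x \<in> outside (path_image \<gamma>)" using io[of x] x sub by blast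
      moreover have "z \<in> outside (path_image \<gamma>)" using out0[OF calculation] io[of z] z sub eq in\<sigma>[of z] \<sigma>0 by auto
      ultimately show ?thesis using conn outside_no_overlap[of "path_image \<gamma>"] unfolding connected_component_def
        by (intro exI[of _ "outside (path_image \<gamma>)"]) blast
    qed
    moreover have "path_image \<gamma> \<inter> G A = path_image p"
    proof -
      have "path_image p \<subseteq> G A" unfolding p(4) using sq unfolding sub_drawing_def subquiver_def by auto
      moreover have "path_image (earc a) \<inter> G A \<subseteq> {vpos (src a), vpos (tgt a)}"
        unfolding path_image_earc[OF a(1)] using cell_disjoint_G[OF a] by auto
      ultimately show ?thesis using ij unfolding pi by blast
    qed
    ultimately have "connected_component (- (path_image \<gamma> \<union> G A)) x z"
      using Janiszewski[of "path_image \<gamma>" "G A" x z] c closed_G[OF a(2)]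
        compact_path_image[OF simple_path_imp_path[OF sp]] connected_path_image[OF arc_imp_path[OF p(1)]] by simp
    moreover have "path_image \<gamma> \<union> G A = G (insert a A)"
      using sub unfolding pi G_insert[OF a(1)] by blast
    ultimately show ?thesis by simp
  qed
  have lc: "flow_wn y x = flow_wn y z" if c: "connected_component (- G (insert a A)) x z" for x z
  proof -
    obtain S where S: "connected S" "S \<subseteq> - G (insert a A)" "x \<in> S" "z \<in> S"
      using c unfolding connected_component_def by blast
    have d: "S \<inter> path_image \<gamma> = {}" using S sub by blast
    then have "x \<notin> path_image \<gamma>" "z \<notin> path_image \<gamma>" using S by auto
    then show ?thesis
      using winding_number_eq[OF simple_path_imp_path[OF sp] loop S(3,4,1) d] wy by simp
  qed
  have near: "\<exists>x\<in>ball q e. x \<notin> G (insert a A) \<and> flow_wn y x = t"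
    if q: "q \<in> cell a" "e > 0" "t \<in> {0, complex_of_real \<sigma>}" for q e t
  proof -
    \<comment> \<open>The side of the curve on which the value is \<open>t\<close>. By the Jordan
      curve theorem \<open>q\<close> lies on the frontier of either side; staying in a ball off
      \<open>G A\<close> then keeps the point found off the whole drawing.\<close>
    define R where "R = (if t = 0 then outside (path_image \<gamma>) else inside (path_image \<gamma>))"
    have Rt: "flow_wn y x = t" if "x \<in> R" for x using that out0 in\<sigma> q(3) unfolding R_def by (auto split: if_splits)
    have "q \<in> path_image \<gamma>" using q(1) unfolding pi path_image_earc[OF a(1)] by auto
    then have "q \<in> frontier R" using J unfolding R_def by auto
    then have cl: "q \<in> closure R" unfolding frontier_def by auto
    have "q \<in> - G A" using cell_disjoint_G[OF a] q(1) by auto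
    then obtain e' where e': "e' > 0" "ball q e' \<subseteq> - G A"
      using open_compl_G[OF a(2)] open_contains_ball by blast
    obtain x where x: "x \<in> R" "dist x q < min e e'"
      using cl q(2) e'(1) unfolding closure_approachable by (metis min_less_iff_conj)
    have "x \<notin> path_image \<gamma>" using x(1) unfolding R_def
      using inside_no_overlap outside_no_overlap by (metis IntI empty_iff)
    moreover have "x \<notin> G A" using e' x(2) by (auto simp: dist_commute)
    ultimately have "x \<notin> G (insert a A)" unfolding G_insert[OF a(1)] pi by auto
    then show ?thesis using x Rt by (auto simp: dist_commute intro!: bexI[of _ x])
  qed
  show ?thesis unfolding bounding_cycle_def
    using ya nf \<sigma>(1) vals sep lc near by (intro exI[of _ y] exI[of _ \<sigma>]) blast
qed

text \<open>The cell of \<open>a\<close> is connected and avoids the drawing of \<open>A\<close>, so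
  it lies in one component of the open complement, and small balls around its points do as
  well.\<close>

lemma near_cell_connected:
  assumes a: "a \<in> E" "A \<subseteq> E" "a \<notin> A" and p: "p \<in> cell a" "q \<in> cell a"
  obtains e where "e > 0" "\<And>x. x \<in> ball p e \<Longrightarrow> connected_component (- G A) x q"
proof -
  have sub: "cell a \<subseteq> - G A" using cell_disjoint_G[OF a] by auto
  then obtain e where e: "e > 0" "ball p e \<subseteq> - G A"
    using open_compl_G[OF a(2)] p open_contains_ball by blast
  have "connected_component (- G A) x q" if "x \<in> ball p e" for x
  proof -
    have "connected_component (- G A) x p"
      unfolding connected_component_def using that e
      by (intro exI[of _ "ball p e"]) auto
    moreover have "connected_component (- G A) p q"
      unfolding connected_component_def using cell_connected[OF a(1)] sub p by blast
    ultimately show ?thesis by (rule connected_component_trans)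
  qed
  then show ?thesis using that e by blast
qed

section \<open>Locally constant functions off the drawing\<close>

text \<open>Erasing an arrow: a component of \<open>- G A\<close> is open and thus not contained in
  an arc, so it has a point off the larger drawing, at which \<open>g\<close> is evaluated. The
  hypothesis makes the choice of this point irrelevant.\<close>

lemma extend_over_arrow:
  assumes a: "a \<in> E" "A \<subseteq> E" "a \<notin> A"
    and g: "\<And>x z. x \<notin> G (insert a A) \<Longrightarrow> z \<notin> G (insert a A) \<Longrightarrow> connected_component (- G A) x z \<Longrightarrow> g x = g z"
  obtains g' where "\<And>x z. connected_component (- G A) x z \<Longrightarrow> g' x = g' z"
    "\<And>x. x \<notin> G (insert a A) \<Longrightarrow> g' x = g x"
proof -
  define w where "w x = (SOME z. z \<notin> G (insert a A) \<and> connected_component (- G A) x z)" for x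
  have ex: "w x \<notin> G (insert a A) \<and> connected_component (- G A) x (w x)" if "x \<notin> G A" for x
  proof -
    let ?C = "connected_component_set (- G A) x"
    have "open ?C" using open_compl_G[OF a(2)] open_connected_component by blast
    moreover have "x \<in> ?C" using that connected_component_refl_eq by auto
    ultimately have "\<not> ?C \<subseteq> path_image (earc a)"
      using interior_maximal[of ?C "path_image (earc a)"] interior_arc_image_complex[OF arc_earc[OF a(1)]] by blast
    then obtain z where z: "connected_component (- G A) x z" "z \<notin> path_image (earc a)" by auto
    then have "z \<notin> G A" using connected_component_in by blast
    then have "z \<notin> G (insert a A)" unfolding G_insert[OF a(1)] using z by auto
    then show ?thesis unfolding w_def using z(1) by (metis (mono_tags, lifting) someI)
  qed
  show ?thesis
  proof (rule that[of "\<lambda>x. g (w x)"])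
    fix x z assume c: "connected_component (- G A) x z"
    then have xz: "x \<notin> G A" "z \<notin> G A" using connected_component_in by blast+
    have "connected_component (- G A) (w x) (w z)"
      using c ex[OF xz(1)] ex[OF xz(2)] by (meson connected_component_sym connected_component_trans)
    then show "g (w x) = g (w z)" using g ex xz by blast
  next
    fix x assume x: "x \<notin> G (insert a A)"
    then have "x \<notin> G A" using G_mono[of A "insert a A"] by auto
    then show "g (w x) = g x" using g x ex connected_component_sym by metis
  qed
qed

text \<open>Without arrows the complement of finitely many points is connected. A bridge separates
  nothing new, so \<open>g\<close> extends across it. For any other arrow a multiple of the winding
  number of a cycle through it is subtracted first, which removes the jump of \<open>g\<close> and
  again permits extension.\<close>

lemma locally_constant_imp_flow_wn:
  fixes g :: "complex \<Rightarrow> real"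
  assumes "A \<subseteq> E" "\<And>x z. connected_component (- G A) x z \<Longrightarrow> g x = g z"
  shows "\<exists>c y. (\<forall>v. net_flow y v = 0) \<and> (\<forall>x. x \<notin> G A \<longrightarrow> complex_of_real (g x) = c + flow_wn y x)"
proof -
  have "finite A" using assms(1) finite_E by (rule finite_subset)
  then show ?thesis using assms
  proof (induction A arbitrary: g rule: finite_induct)
    case empty
    have "G {} = vpos ` V" unfolding sub_drawing_def by simp
    then have "countable (G {})" using finite_V by (simp add: countable_finite)
    then have "connected (- G {})"
      using path_connected_complement_countable path_connected_imp_connected by (metis DIM_complex order_refl)
    then have "connected_component (- G {}) x z" if "x \<notin> G {}" "z \<notin> G {}" for x z
      using that unfolding connected_component_def by blast
    then have "\<exists>c. \<forall>x. x \<notin> G {} \<longrightarrow> complex_of_real (g x) = c"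
      using empty(2) by metis
    then show ?case by (auto intro!: exI[of _ "\<lambda>_. 0"] simp: net_flow_def flow_wn_def)
  next
    case (insert a A)
    then have a: "a \<in> E" "A \<subseteq> E" "a \<notin> A" by auto
    note g = insert.prems(2)
    show ?case
    proof (cases "(src a, tgt a) \<in> reach A")
      case False
      have "g x = g z" if "x \<notin> G (insert a A)" "z \<notin> G (insert a A)" "connected_component (- G A) x z" for x z
        using g bridge_separates_nothing[OF a False that] by blast
      then obtain g' where g': "\<And>x z. connected_component (- G A) x z \<Longrightarrow> g' x = g' z"
        "\<And>x. x \<notin> G (insert a A) \<Longrightarrow> g' x = g x" using extend_over_arrow[OF a, of g] by metis
      from insert.IH[of g', OF a(2) g'(1)] obtain c y where
        "\<forall>v. net_flow y v = 0" "\<forall>x. x \<notin> G A \<longrightarrow> complex_of_real (g' x) = c + flow_wn y x" by blast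
      then show ?thesis using g'(2) G_mono[of A "insert a A"] by (metis subset_insertI subsetD)
    next
      case True
      obtain y0 \<sigma> where "bounding_cycle a A y0 \<sigma>" using cycle_through_arrow[OF a True] by blast
      note y0 = bounding_cycleD(2-7)[OF this]
      define p where "p = earc a (1/2)"
      have p: "p \<in> cell a" unfolding p_def cell_def by auto
      obtain e where e: "e > 0" "\<And>x. x \<in> ball p e \<Longrightarrow> connected_component (- G A) x p"
        using near_cell_connected[OF a p p] by blast
      obtain x0 where x0: "x0 \<in> ball p e" "x0 \<notin> G (insert a A)" "flow_wn y0 x0 = 0"
        using y0(6)[OF p e(1)] by blast
      obtain x1 where x1: "x1 \<in> ball p e" "x1 \<notin> G (insert a A)" "flow_wn y0 x1 = complex_of_real \<sigma>"
        using y0(6)[OF p e(1)] by blast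
      \<comment> \<open>Across the arrow \<open>g\<close> jumps by \<open>g x1 - g x0\<close> and
        \<open>flow_wn y0\<close> by \<open>\<sigma>\<close>; with this multiple, \<open>h\<close>
        agrees at \<open>x0\<close> and \<open>x1\<close>.\<close>
      define l where "l = (g x1 - g x0) / \<sigma>"
      define h where "h x = g x - l * Re (flow_wn y0 x)" for x
      have hx: "h x = g x0" if x: "x \<notin> G (insert a A)" "connected_component (- G A) x p" for x
      proof -
        have c: "connected_component (- G A) x x0" "connected_component (- G A) x x1"
          using x e(2) x0(1) x1(1) by (meson connected_component_sym connected_component_trans)+
        consider "flow_wn y0 x = 0" | "flow_wn y0 x = complex_of_real \<sigma>" using y0(3)[OF x(1)] by blast
        then show ?thesis
        proof cases
          case 1
          then have "g x = g x0" using g y0(4)[OF x(1) x0(2) c(1)] x0(3) by simp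
          then show ?thesis unfolding h_def 1 by simp
        next
          case 2
          then have "g x = g x1" using g y0(4)[OF x(1) x1(2) c(2)] x1(3) by simp
          then show ?thesis unfolding h_def 2 l_def using y0(2) by auto
        qed
      qed
      have "h x = h z" if x: "x \<notin> G (insert a A)" and z: "z \<notin> G (insert a A)"
        and c: "connected_component (- G A) x z" for x z
      proof (cases "connected_component (- G A) x p")
        case True
        then have "connected_component (- G A) z p"
          using c by (meson connected_component_sym connected_component_trans)
        then show ?thesis using hx True x z by simp
      next
        case False
        \<comment> \<open>A component that does not contain the cell is disjoint from it, so drawing
          the arrow leaves the component intact and \<open>g\<close> is constant on it
          already.\<close>
        let ?C = "connected_component_set (- G A) x"
        have "?C \<inter> cell a = {}"
        proof (rule ccontr)
          assume "?C \<inter> cell a \<noteq> {}"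
          then obtain q where q: "connected_component (- G A) x q" "q \<in> cell a" by auto
          have "connected_component (- G A) q p"
            using near_cell_connected[OF a q(2) p] by (metis centre_in_ball)
          then show False using q False connected_component_trans by metis
        qed
        moreover have "?C \<subseteq> - G A" by (rule connected_component_subset)
        ultimately have "?C \<subseteq> - G (insert a A)" unfolding G_insert_cell[OF a(1)] by blast
        moreover have "x \<in> ?C" using c connected_component_refl connected_component_in by blast
        ultimately have "connected_component (- G (insert a A)) x z"
          using connected_component_maximal[of x ?C "- G (insert a A)"] connected_connected_component[of "- G A" x] c
          by blast
        then show ?thesis unfolding h_def using g[of x z] y0(5)[of x z] by simp
      qed
      then obtain g' where g': "\<And>x z. connected_component (- G A) x z \<Longrightarrow> g' x = g' z"
        "\<And>x. x \<notin> G (insert a A) \<Longrightarrow> g' x = h x" using extend_over_arrow[OF a, of h] by metis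
      from insert.IH[of g', OF a(2) g'(1)] obtain c y where
        y: "\<forall>v. net_flow y v = 0" "\<forall>x. x \<notin> G A \<longrightarrow> complex_of_real (g' x) = c + flow_wn y x" by blast
      have "complex_of_real (g x) = c + flow_wn (\<lambda>b. y b + l * y0 b) x" if x: "x \<notin> G (insert a A)" for x
      proof -
        have "complex_of_real (Re (flow_wn y0 x)) = flow_wn y0 x" using y0(3)[OF x] by auto
        moreover have "complex_of_real (h x) = c + flow_wn y x"
          using y(2) g'(2)[OF x] G_mono[of A "insert a A"] x by (metis subset_insertI subsetD)
        ultimately show ?thesis unfolding flow_wn_add h_def by (simp add: algebra_simps)
      qed
      moreover have "net_flow (\<lambda>b. y b + l * y0 b) v = 0" for v
        unfolding net_flow_add using y(1) y0(1) by simp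
      ultimately show ?thesis by blast
    qed
  qed
qed

section \<open>Faces and the two sides of an arrow\<close>

text \<open>An integer version of \<open>face_sign\<close>, so that the same matrix can be read over
  \<open>'k\<close> and over the reals.\<close>

definition fsign :: "'a \<Rightarrow> complex set \<Rightarrow> int" where
  "fsign a f = of_bool (face_right_of Q vpos earc a f) - of_bool (face_left_of Q vpos earc a f)"

lemma face_sign_fsign: "face_sign Q vpos earc a f = of_int (fsign a f)"
  unfolding face_sign_def fsign_def by simp

lemma face_mem_iff:
  assumes "f \<in> faces Q vpos earc" "connected_component (- G E) x z"
  shows "x \<in> f \<longleftrightarrow> z \<in> f"
proof -
  obtain u where f: "f = connected_component_set (- G E) u"
    using assms(1) unfolding faces_def emb_image_G components_def by auto
  show ?thesis unfolding f using assms(2)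
    by (metis connected_component_sym connected_component_trans mem_Collect_eq)
qed

lemma face_subset: "f \<in> faces Q vpos earc \<Longrightarrow> x \<in> f \<Longrightarrow> x \<notin> G E"
  unfolding faces_def emb_image_G using in_components_subset by blast

text \<open>Sum the net flow over the vertices on the source side of the bridge: the contributions
  of all other arrows cancel, leaving \<open>y a\<close>.\<close>

lemma circulation_bridge:
  assumes "a \<in> E" "(src a, tgt a) \<notin> reach (E - {a})" "\<And>v. net_flow y v = 0"
  shows "y a = 0"
proof -
  define V1 where "V1 = {v\<in>V. (src a, v) \<in> reach (E - {a})}"
  have nbr: "(src b, tgt b) \<in> reach (E - {a})" "(tgt b, src b) \<in> reach (E - {a})" if "b \<in> E - {a}" for b
    unfolding reach_def using that by (auto intro: r_into_rtrancl)
  have tr: "(u, w) \<in> reach A" if "(u, v) \<in> reach A" "(v, w) \<in> reach A" for u v w A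
    using that unfolding reach_def by (rule rtrancl_trans)
  have iff: "src b \<in> V1 \<longleftrightarrow> tgt b \<in> V1" if "b \<in> E - {a}" for b
    using nbr[OF that] tr that src_V tgt_V unfolding V1_def by blast
  have in1: "src a \<in> V1" "tgt a \<notin> V1"
    using assms src_V unfolding V1_def reach_def by auto
  have finV1: "finite V1" unfolding V1_def using finite_V by simp
  have "(\<Sum>v\<in>V1. net_flow y v) = (\<Sum>b\<in>E. \<Sum>v\<in>V1. y b * (of_bool (src b = v) - of_bool (tgt b = v)))"
    unfolding net_flow_def by (rule sum.swap)
  also have "\<dots> = (\<Sum>b\<in>E. if b = a then y a else 0)"
  proof (rule sum.cong[OF refl])
    fix b assume b: "b \<in> E"
    have "(\<Sum>v\<in>V1. y b * (of_bool (src b = v) - of_bool (tgt b = v)))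
      = y b * ((\<Sum>v\<in>V1. if src b = v then 1 else 0) - (\<Sum>v\<in>V1. if tgt b = v then 1 else 0))"
      unfolding sum_subtractf[symmetric] sum_distrib_left by (rule sum.cong) auto
    also have "\<dots> = y b * (of_bool (src b \<in> V1) - of_bool (tgt b \<in> V1))"
      using finV1 by simp
    also have "\<dots> = (if b = a then y a else 0)" using iff[of b] in1 b by auto
    finally show "(\<Sum>v\<in>V1. y b * (of_bool (src b = v) - of_bool (tgt b = v))) = (if b = a then y a else 0)" .
  qed
  also have "\<dots> = y a" using assms(1) finite_E by simp
  finally show ?thesis using assms(3) by simp
qed

text \<open>A base point in the unbounded face. It fixes the additive constant of locally constant
  functions, since every indicator of a bounded face vanishes there.\<close>

lemma ex_far_point:
  obtains x where "x \<notin> G E" "\<And>f. f \<in> bounded_faces Q vpos earc \<Longrightarrow> x \<notin> f"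
    "\<And>z. z \<notin> G E \<Longrightarrow> \<not> (\<exists>f\<in>bounded_faces Q vpos earc. z \<in> f) \<Longrightarrow> connected_component (- G E) z x"
proof -
  have bnd: "bounded (G E)" using compact_G[of E] compact_imp_bounded by auto
  then have "outside (G E) \<noteq> {}" by (rule outside_bounded_nonempty)
  then obtain x where x: "x \<in> outside (G E)" by auto
  then have ub: "\<not> bounded (connected_component_set (- G E) x)" unfolding outside by auto
  then have xG: "x \<notin> G E" using connected_component_eq_empty[of "- G E" x] bounded_empty by (metis ComplD)
  show ?thesis
  proof (rule that[OF xG])
    fix f assume f: "f \<in> bounded_faces Q vpos earc"
    show "x \<notin> f"
    proof
      assume xf: "x \<in> f"
      obtain u where u: "f = connected_component_set (- G E) u"
        using f unfolding bounded_faces_def faces_def emb_image_G components_def by auto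
      then have "f = connected_component_set (- G E) x" using xf connected_component_eq by blast
      then show False using f ub unfolding bounded_faces_def by auto
    qed
  next
    fix z assume z: "z \<notin> G E" "\<not> (\<exists>f\<in>bounded_faces Q vpos earc. z \<in> f)"
    let ?f = "connected_component_set (- G E) z"
    have "z \<in> ?f" "?f \<in> faces Q vpos earc"
      using z(1) unfolding faces_def emb_image_G by (auto simp: componentsI)
    then have "\<not> bounded ?f" using z(2) unfolding bounded_faces_def by blast
    then have "connected_component_set (- G E) z = connected_component_set (- G E) x"
      using cobounded_unique_unbounded_component[of "- G E" z x] ub bnd by simp
    moreover have "x \<in> connected_component_set (- G E) x" using xG by simp
    ultimately show "connected_component (- G E) z x" by (metis mem_Collect_eq)
  qed
qed

text \<open>Two points, right and left of \<open>a\<close>, compute all signs of \<open>a\<close>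
  and the jump of every circulation. For a cycle through \<open>a\<close>, its winding number and
  that of \<open>a\<close> differ by a function continuous across the cell. So the approximate jump
  of 1 in the definition of sides becomes an exact jump of an integer-valued function, and the sides
  become components.\<close>

lemma arrow_sides:
  assumes a: "a \<in> E"
  shows "\<exists>r l. r \<notin> G E \<and> l \<notin> G E \<and>
    (\<forall>f\<in>faces Q vpos earc. fsign a f = of_bool (r \<in> f) - of_bool (l \<in> f)) \<and>
    (\<forall>y. (\<forall>v. net_flow y v = 0) \<longrightarrow> flow_wn y l - flow_wn y r = complex_of_real (y a))"
proof -
  define A where "A = E - {a}"
  have A: "a \<in> E" "A \<subseteq> E" "a \<notin> A" using a unfolding A_def by auto
  have E: "insert a A = E" using a unfolding A_def by auto
  have cell: "earc a s \<in> cell a" if "s \<in> {0<..<1}" for s using that unfolding cell_def by auto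
  show ?thesis
  proof (cases "(src a, tgt a) \<in> reach A")
    case False
    \<comment> \<open>For a bridge all quantities in the claim are zero, so one arbitrary point off
      the drawing can play both \<open>r\<close> and \<open>l\<close>.\<close>
    obtain x where x: "x \<notin> G E" using ex_far_point by metis
    have y0: "y a = 0" if "\<forall>v. net_flow y v = 0" for y
      using circulation_bridge[OF a] False that unfolding A_def by blast
    have same: "w \<in> f" if e: "\<And>u. u \<in> ball p e \<Longrightarrow> connected_component (- G A) u p"
        and zw: "z \<in> f" "dist z p < e" "dist w p < e" "w \<notin> G E" and f: "f \<in> faces Q vpos earc" for p e z w f
    proof -
      have "connected_component (- G A) z p" "connected_component (- G A) w p"
        using zw e by (auto simp: dist_commute)
      then have "connected_component (- G A) z w"
        by (meson connected_component_sym connected_component_trans)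
      then have "connected_component (- G E) z w"
        using bridge_separates_nothing[OF A False] zw face_subset[OF f] unfolding E by blast
      then show ?thesis using face_mem_iff[OF f] zw by blast
    qed
    \<comment> \<open>Both nearby points lie in the same face because a bridge separates nothing;
      exchanging them turns a witness for one side into a witness for the other.\<close>
    have "face_right_of Q vpos earc a f \<longleftrightarrow> face_left_of Q vpos earc a f" if f: "f \<in> faces Q vpos earc" for f
    proof
      assume "face_right_of Q vpos earc a f"
      then obtain s where s: "s \<in> {0<..<1}" and H: "\<forall>e>0. \<exists>z\<in>f. \<exists>w. w \<notin> G E \<and> dist z (earc a s) < e \<and>
        dist w (earc a s) < e \<and> cmod (wn a w - wn a z - 1) < 1/2"
        unfolding face_right_of_def emb_image_G by blast
      obtain e0 where e0: "e0 > 0" "\<And>x. x \<in> ball (earc a s) e0 \<Longrightarrow> connected_component (- G A) x (earc a s)"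
        using near_cell_connected[OF A cell[OF s] cell[OF s]] by blast
      show "face_left_of Q vpos earc a f" unfolding face_left_of_def emb_image_G
      proof (intro bexI[OF _ s] allI impI)
        fix e :: real assume "e > 0"
        then obtain z w where zw: "z \<in> f" "w \<notin> G E" "dist z (earc a s) < min e e0"
           "dist w (earc a s) < min e e0" "cmod (wn a w - wn a z - 1) < 1/2"
          using H e0(1) by (metis min_less_iff_conj)
        have "w \<in> f" using same[OF e0(2)] zw f by auto
        then show "\<exists>z\<in>f. \<exists>w. w \<notin> G E \<and> dist z (earc a s) < e \<and> dist w (earc a s) < e \<and>
          cmod (wn a z - wn a w - 1) < 1/2"
          using zw face_subset[OF f zw(1)] by (intro bexI[of _ w] exI[of _ z]) auto
      qed
    next
      assume "face_left_of Q vpos earc a f"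
      then obtain s where s: "s \<in> {0<..<1}" and H: "\<forall>e>0. \<exists>z\<in>f. \<exists>w. w \<notin> G E \<and> dist z (earc a s) < e \<and>
        dist w (earc a s) < e \<and> cmod (wn a z - wn a w - 1) < 1/2"
        unfolding face_left_of_def emb_image_G by blast
      obtain e0 where e0: "e0 > 0" "\<And>x. x \<in> ball (earc a s) e0 \<Longrightarrow> connected_component (- G A) x (earc a s)"
        using near_cell_connected[OF A cell[OF s] cell[OF s]] by blast
      show "face_right_of Q vpos earc a f" unfolding face_right_of_def emb_image_G
      proof (intro bexI[OF _ s] allI impI)
        fix e :: real assume "e > 0"
        then obtain z w where zw: "z \<in> f" "w \<notin> G E" "dist z (earc a s) < min e e0"
           "dist w (earc a s) < min e e0" "cmod (wn a z - wn a w - 1) < 1/2"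
          using H e0(1) by (metis min_less_iff_conj)
        have "w \<in> f" using same[OF e0(2)] zw f by auto
        then show "\<exists>z\<in>f. \<exists>w. w \<notin> G E \<and> dist z (earc a s) < e \<and> dist w (earc a s) < e \<and>
          cmod (wn a w - wn a z - 1) < 1/2"
          using zw face_subset[OF f zw(1)] by (intro bexI[of _ w] exI[of _ z]) auto
      qed
    qed
    then show ?thesis using x y0 by (intro exI[of _ x]) (auto simp: fsign_def)
  next
    case True
    obtain y0 \<sigma> where bc: "bounding_cycle a A y0 \<sigma>" using cycle_through_arrow[OF A True] by blast
    note y0 = bounding_cycleD[OF bc, unfolded E]
    \<comment> \<open>The smaller of the two values 0 and \<open>\<sigma>\<close>, taken on the
      right of \<open>a\<close>; the value on the left is \<open>\<tau> + 1\<close> for either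
      orientation of the cycle.\<close>
    define \<tau> where "\<tau> = (if \<sigma> = 1 then 0 else - 1 :: complex)"
    have vals: "{0, complex_of_real \<sigma>} = {\<tau>, \<tau> + 1}" using y0(3) unfolding \<tau>_def by auto
    define p where "p = earc a (1/2)"
    have p: "p \<in> cell a" unfolding p_def by (rule cell) simp
    obtain e0 where e0: "e0 > 0" "\<And>x. x \<in> ball p e0 \<Longrightarrow> connected_component (- G A) x p"
      using near_cell_connected[OF A p p] by blast
    obtain r where r: "r \<in> ball p e0" "r \<notin> G E" "flow_wn y0 r = \<tau>"
      using y0(7)[OF p e0(1), of \<tau>] vals by auto
    obtain l where l: "l \<in> ball p e0" "l \<notin> G E" "flow_wn y0 l = \<tau> + 1"
      using y0(7)[OF p e0(1), of "\<tau> + 1"] vals by auto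
    have toR: "connected_component (- G E) x r"
      if "x \<notin> G E" "connected_component (- G A) x p" "flow_wn y0 x = \<tau>" for x
      using y0(5)[OF that(1) r(2)] that r e0(2) by (metis connected_component_sym connected_component_trans)
    have toL: "connected_component (- G E) x l"
      if "x \<notin> G E" "connected_component (- G A) x p" "flow_wn y0 x = \<tau> + 1" for x
      using y0(5)[OF that(1) l(2)] that l e0(2) by (metis connected_component_sym connected_component_trans)
    \<comment> \<open>The cycle without \<open>a\<close>: its function is continuous across the
      cell, so \<open>wn a\<close> and \<open>flow_wn y0\<close> have almost the same difference
      between nearby points.\<close>
    define y1 where "y1 b = y0 b - (if b = a then 1 else 0)" for b
    have y1: "flow_wn y0 x = flow_wn y1 x + wn a x" for x
    proof -
      have "flow_wn y1 x = flow_wn y0 x - (\<Sum>b\<in>E. if b = a then wn a x else 0)"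
        unfolding flow_wn_def y1_def sum_subtractf[symmetric] by (rule sum.cong) (auto simp: ring_distribs)
      then show ?thesis using a finite_E by simp
    qed
    have local: "\<exists>e>0. \<forall>x z. dist x q < e \<and> dist z q < e \<longrightarrow> connected_component (- G A) x p \<and>
        cmod ((wn a x - wn a z) - (flow_wn y0 x - flow_wn y0 z)) < 1/2" if q: "q \<in> cell a" for q
    proof -
      have "continuous (at q) (flow_wn y1)"
        using continuous_flow_wn[OF a q] y0(1) unfolding y1_def by simp
      then obtain e1 where e1: "e1 > 0" "\<forall>x. dist x q < e1 \<longrightarrow> dist (flow_wn y1 x) (flow_wn y1 q) < 1/4"
        unfolding continuous_at_eps_delta by (metis zero_less_divide_1_iff zero_less_numeral)
      obtain e2 where e2: "e2 > 0" "\<And>x. x \<in> ball q e2 \<Longrightarrow> connected_component (- G A) x p"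
        using near_cell_connected[OF A q p] by blast
      show ?thesis
      proof (intro exI[of _ "min e1 e2"] conjI allI impI)
        fix x z assume xz: "dist x q < min e1 e2 \<and> dist z q < min e1 e2"
        then show "connected_component (- G A) x p" using e2(2) by (auto simp: dist_commute)
        have "dist (flow_wn y1 x) (flow_wn y1 z) < 1/2"
          using xz e1(2) dist_triangle_half_l[of "flow_wn y1 x" "flow_wn y1 q" "1/2" "flow_wn y1 z"] by auto
        then show "cmod ((wn a x - wn a z) - (flow_wn y0 x - flow_wn y0 z)) < 1/2"
          unfolding y1 dist_norm by (simp add: norm_minus_commute)
      qed (use e1 e2 in auto)
    qed
    have jump: "flow_wn y0 z = \<tau> \<and> flow_wn y0 w = \<tau> + 1"
      if zw: "z \<notin> G E" "w \<notin> G E" and d: "cmod ((wn a w - wn a z) - (flow_wn y0 w - flow_wn y0 z)) < 1/2"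
        "cmod (wn a w - wn a z - 1) < 1/2" for z w
    proof -
      \<comment> \<open>Two errors below 1/2 add up to less than 1, and among the possible
        differences -1, 0 and 1 only 1 is that close to 1.\<close>
      have "cmod (flow_wn y0 w - flow_wn y0 z - 1) < 1"
      proof -
        have "flow_wn y0 w - flow_wn y0 z - 1 =
          (wn a w - wn a z - 1) - ((wn a w - wn a z) - (flow_wn y0 w - flow_wn y0 z))" by simp
        then have "cmod (flow_wn y0 w - flow_wn y0 z - 1) \<le> cmod (wn a w - wn a z - 1) +
          cmod ((wn a w - wn a z) - (flow_wn y0 w - flow_wn y0 z))" using norm_triangle_ineq4 by metis
        then show ?thesis using d by linarith
      qed
      moreover have "flow_wn y0 z \<in> {\<tau>, \<tau> + 1}" "flow_wn y0 w \<in> {\<tau>, \<tau> + 1}"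
        using y0(4) zw unfolding vals[symmetric] by auto
      ultimately show ?thesis by auto
    qed
    have pair: "\<exists>z w. z \<notin> G E \<and> w \<notin> G E \<and> dist z p < e \<and> dist w p < e \<and>
       flow_wn y0 z = \<tau> \<and> flow_wn y0 w = \<tau> + 1 \<and>
       connected_component (- G E) z r \<and> connected_component (- G E) w l" if "e > 0" for e
    proof -
      have m: "min e e0 > 0" using that e0 by simp
      obtain z where z: "z \<in> ball p (min e e0)" "z \<notin> G E" "flow_wn y0 z = \<tau>"
        using y0(7)[OF p m, of \<tau>] vals by auto
      obtain w where w: "w \<in> ball p (min e e0)" "w \<notin> G E" "flow_wn y0 w = \<tau> + 1"
        using y0(7)[OF p m, of "\<tau> + 1"] vals by auto
      show ?thesis using z w toR[of z] toL[of w] e0(2)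
        by (intro exI[of _ z] exI[of _ w]) (auto simp: dist_commute)
    qed
    have half: "(1/2::real) \<in> {0<..<1}" by simp
    have right: "face_right_of Q vpos earc a f \<longleftrightarrow> r \<in> f" if f: "f \<in> faces Q vpos earc" for f
    proof
      assume "face_right_of Q vpos earc a f"
      then obtain s where s: "s \<in> {0<..<1}" and H: "\<forall>e>0. \<exists>z\<in>f. \<exists>w. w \<notin> G E \<and> dist z (earc a s) < e \<and>
        dist w (earc a s) < e \<and> cmod (wn a w - wn a z - 1) < 1/2"
        unfolding face_right_of_def emb_image_G by blast
      obtain e where e: "e > 0" "\<forall>x z. dist x (earc a s) < e \<and> dist z (earc a s) < e \<longrightarrow>
        connected_component (- G A) x p \<and>
        cmod ((wn a x - wn a z) - (flow_wn y0 x - flow_wn y0 z)) < 1/2" using local[OF cell[OF s]] by blast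
      obtain z w where zw: "z \<in> f" "w \<notin> G E" "dist z (earc a s) < e" "dist w (earc a s) < e"
        "cmod (wn a w - wn a z - 1) < 1/2" using H e(1) by blast
      have zG: "z \<notin> G E" using face_subset[OF f zw(1)] .
      have "flow_wn y0 z = \<tau>" using jump[OF zG zw(2)] e(2) zw by blast
      then have "connected_component (- G E) z r" using toR[OF zG] e(2) zw by blast
      then show "r \<in> f" using face_mem_iff[OF f] zw(1) by blast
    next
      assume rf: "r \<in> f"
      obtain e' where e': "e' > 0" "\<forall>x z. dist x p < e' \<and> dist z p < e' \<longrightarrow>
        connected_component (- G A) x p \<and>
        cmod ((wn a x - wn a z) - (flow_wn y0 x - flow_wn y0 z)) < 1/2" using local[OF p] by blast
      show "face_right_of Q vpos earc a f" unfolding face_right_of_def emb_image_G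
      proof (intro bexI[OF _ half] allI impI)
        fix e :: real assume "e > 0"
        then obtain z w where zw: "z \<notin> G E" "w \<notin> G E" "dist z p < min e e'" "dist w p < min e e'"
          "flow_wn y0 z = \<tau>" "flow_wn y0 w = \<tau> + 1" "connected_component (- G E) z r"
          using pair[of "min e e'"] e'(1) by (metis min_less_iff_conj)
        have "cmod ((wn a w - wn a z) - (flow_wn y0 w - flow_wn y0 z)) < 1/2" using e'(2) zw(3,4) by auto
        then have "cmod (wn a w - wn a z - 1) < 1/2" unfolding zw(5,6) by (simp add: algebra_simps)
        moreover have "z \<in> f" using face_mem_iff[OF f zw(7)] rf by blast
        ultimately show "\<exists>z\<in>f. \<exists>w. w \<notin> G E \<and> dist z (earc a (1/2)) < e \<and> dist w (earc a (1/2)) < e \<and>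
          cmod (wn a w - wn a z - 1) < 1/2"
          using zw unfolding p_def by auto
      qed
    qed
    have left: "face_left_of Q vpos earc a f \<longleftrightarrow> l \<in> f" if f: "f \<in> faces Q vpos earc" for f
    proof
      assume "face_left_of Q vpos earc a f"
      then obtain s where s: "s \<in> {0<..<1}" and H: "\<forall>e>0. \<exists>z\<in>f. \<exists>w. w \<notin> G E \<and> dist z (earc a s) < e \<and>
        dist w (earc a s) < e \<and> cmod (wn a z - wn a w - 1) < 1/2"
        unfolding face_left_of_def emb_image_G by blast
      obtain e where e: "e > 0" "\<forall>x z. dist x (earc a s) < e \<and> dist z (earc a s) < e \<longrightarrow>
        connected_component (- G A) x p \<and>
        cmod ((wn a x - wn a z) - (flow_wn y0 x - flow_wn y0 z)) < 1/2" using local[OF cell[OF s]] by blast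
      obtain z w where zw: "z \<in> f" "w \<notin> G E" "dist z (earc a s) < e" "dist w (earc a s) < e"
        "cmod (wn a z - wn a w - 1) < 1/2" using H e(1) by blast
      have zG: "z \<notin> G E" using face_subset[OF f zw(1)] .
      have "flow_wn y0 z = \<tau> + 1" using jump[OF zw(2) zG] e(2) zw by blast
      then have "connected_component (- G E) z l" using toL[OF zG] e(2) zw by blast
      then show "l \<in> f" using face_mem_iff[OF f] zw(1) by blast
    next
      assume lf: "l \<in> f"
      obtain e' where e': "e' > 0" "\<forall>x z. dist x p < e' \<and> dist z p < e' \<longrightarrow>
        connected_component (- G A) x p \<and>
        cmod ((wn a x - wn a z) - (flow_wn y0 x - flow_wn y0 z)) < 1/2" using local[OF p] by blast
      show "face_left_of Q vpos earc a f" unfolding face_left_of_def emb_image_G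
      proof (intro bexI[OF _ half] allI impI)
        fix e :: real assume "e > 0"
        then obtain w z where zw: "w \<notin> G E" "z \<notin> G E" "dist w p < min e e'" "dist z p < min e e'"
          "flow_wn y0 w = \<tau>" "flow_wn y0 z = \<tau> + 1" "connected_component (- G E) z l"
          using pair[of "min e e'"] e'(1) by (metis min_less_iff_conj)
        have "cmod ((wn a z - wn a w) - (flow_wn y0 z - flow_wn y0 w)) < 1/2" using e'(2) zw(3,4) by auto
        then have "cmod (wn a z - wn a w - 1) < 1/2" unfolding zw(5,6) by (simp add: algebra_simps)
        moreover have "z \<in> f" using face_mem_iff[OF f zw(7)] lf by blast
        ultimately show "\<exists>z\<in>f. \<exists>w. w \<notin> G E \<and> dist z (earc a (1/2)) < e \<and> dist w (earc a (1/2)) < e \<and>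
          cmod (wn a z - wn a w - 1) < 1/2"
          using zw unfolding p_def by auto
      qed
    qed
    have flow: "flow_wn y l - flow_wn y r = complex_of_real (y a)" if y: "\<forall>v. net_flow y v = 0" for y
    proof (rule ccontr)
      define d where "d = cmod (flow_wn y l - flow_wn y r - complex_of_real (y a))"
      assume "\<not> ?thesis"
      then have d: "d > 0" unfolding d_def by auto
      \<comment> \<open>The weight on \<open>a\<close> is cancelled, so \<open>flow_wn y2\<close> is
        continuous across the cell. The jump of \<open>y\<close> is therefore \<open>y a\<close>
        times that of \<open>y0\<close>, which is 1; a discrepancy \<open>d\<close> would contradict
        continuity.\<close>
      define y2 where "y2 b = y b - y a * y0 b" for b
      have "continuous (at p) (flow_wn y2)"
        using continuous_flow_wn[OF a p, of y2] y0(1) unfolding y2_def by simp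
      then obtain e where e: "e > 0" "\<forall>x. dist x p < e \<longrightarrow> dist (flow_wn y2 x) (flow_wn y2 p) < d/2"
        unfolding continuous_at_eps_delta using d by (metis half_gt_zero)
      obtain z w where zw: "dist z p < e" "dist w p < e" "flow_wn y0 z = \<tau>" "flow_wn y0 w = \<tau> + 1"
          "connected_component (- G E) z r" "connected_component (- G E) w l"
        using pair[OF e(1)] by blast
      have "flow_wn y2 w - flow_wn y2 z = flow_wn y l - flow_wn y r - complex_of_real (y a)"
        using locally_constant_flow_wn[of y, OF _ zw(5)] locally_constant_flow_wn[of y, OF _ zw(6)] y zw(3,4)
        unfolding y2_def flow_wn_diff by (simp add: algebra_simps)
      moreover have "dist (flow_wn y2 w) (flow_wn y2 z) < d"
        using e(2) zw(1,2) dist_triangle_half_l[of "flow_wn y2 w" "flow_wn y2 p" d "flow_wn y2 z"] by auto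
      ultimately show False unfolding d_def dist_norm by simp
    qed
    show ?thesis using r(2) l(2) flow right left
      by (intro exI[of _ r] exI[of _ l]) (auto simp: fsign_def)
  qed
qed

section \<open>Independence and spanning over the reals\<close>

text \<open>The function with value \<open>c f\<close> on \<open>f\<close> comes from a circulation
  whose weights are the jumps across arrows, here minus the coboundary of \<open>\<phi>\<close>.
  Being orthogonal to coboundaries, the circulation is orthogonal to itself and vanishes, so the
  function is constant, and zero as it is zero in the unbounded face. It is stated for a finite set
  \<open>F\<close> because finiteness of the set of all bounded faces is derived from it.\<close>

lemma face_combination:
  fixes c :: "complex set \<Rightarrow> real"
  assumes F: "finite F" "F \<subseteq> bounded_faces Q vpos earc"
    and c: "\<And>a. a \<in> E \<Longrightarrow> (\<Sum>f\<in>F. c f * of_int (fsign a f)) = \<phi> (src a) - \<phi> (tgt a)"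
    and f: "f \<in> F"
  shows "c f = 0"
proof -
  define g where "g x = (\<Sum>f\<in>F. c f * of_bool (x \<in> f))" for x
  have FF: "f \<in> faces Q vpos earc" if "f \<in> F" for f using that F unfolding bounded_faces_def by auto
  have lc: "g x = g z" if "connected_component (- G E) x z" for x z
    unfolding g_def using face_mem_iff[OF FF that] by (intro sum.cong) auto
  obtain k y where y: "\<forall>v. net_flow y v = 0" "\<forall>x. x \<notin> G E \<longrightarrow> complex_of_real (g x) = k + flow_wn y x"
    using locally_constant_imp_flow_wn[of E g] lc by auto
  \<comment> \<open>The minus sign arises because \<open>fsign\<close> counts right minus left,
    whereas the jump is taken left minus right.\<close>
  have J: "y a = - (\<Sum>f\<in>F. c f * of_int (fsign a f))" if a: "a \<in> E" for a
  proof -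
    obtain r l where rl: "r \<notin> G E" "l \<notin> G E"
      "\<forall>f\<in>faces Q vpos earc. fsign a f = of_bool (r \<in> f) - of_bool (l \<in> f)"
      "flow_wn y l - flow_wn y r = complex_of_real (y a)" using arrow_sides[OF a] y(1) by blast
    have "complex_of_real (g l - g r) = complex_of_real (y a)" using y(2) rl by simp
    then have "g l - g r = y a" using of_real_eq_iff by blast
    moreover have "(\<Sum>f\<in>F. c f * of_int (fsign a f)) = g r - g l"
      unfolding g_def sum_subtractf[symmetric] by (intro sum.cong refl) (simp add: rl(3)[rule_format] FF right_diff_distrib)
    ultimately show ?thesis by simp
  qed
  have "(\<Sum>a\<in>E. y a * y a) = - (\<Sum>a\<in>E. y a * (\<phi> (src a) - \<phi> (tgt a)))"
    unfolding sum_negf[symmetric]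
  proof (rule sum.cong[OF refl])
    fix a assume "a \<in> E"
    then have "y a = - (\<phi> (src a) - \<phi> (tgt a))" using J c by simp
    then show "y a * y a = - (y a * (\<phi> (src a) - \<phi> (tgt a)))" by (metis mult_minus_right)
  qed
  also have "(\<Sum>a\<in>E. y a * (\<phi> (src a) - \<phi> (tgt a))) =
     (\<Sum>a\<in>E. \<Sum>v\<in>V. \<phi> v * (y a * (of_bool (src a = v) - of_bool (tgt a = v))))"
  proof (rule sum.cong[OF refl])
    fix a assume a: "a \<in> E"
    have "(\<Sum>v\<in>V. \<phi> v * (y a * (of_bool (src a = v) - of_bool (tgt a = v)))) =
      y a * ((\<Sum>v\<in>V. if src a = v then \<phi> v else 0) - (\<Sum>v\<in>V. if tgt a = v then \<phi> v else 0))"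
      unfolding sum_subtractf[symmetric] sum_distrib_left by (rule sum.cong) auto
    then show "y a * (\<phi> (src a) - \<phi> (tgt a)) =
      (\<Sum>v\<in>V. \<phi> v * (y a * (of_bool (src a = v) - of_bool (tgt a = v))))"
      using src_V[OF a] tgt_V[OF a] finite_V by simp
  qed
  also have "\<dots> = (\<Sum>v\<in>V. \<phi> v * net_flow y v)"
    unfolding net_flow_def sum_distrib_left by (rule sum.swap)
  also have "\<dots> = 0" using y(1) by simp
  finally have "(\<Sum>a\<in>E. y a * y a) = 0" by simp
  then have "\<forall>a\<in>E. y a = 0" using finite_E by (subst (asm) sum_nonneg_eq_0_iff) auto
  then have "flow_wn y x = 0" for x unfolding flow_wn_def by simp
  then have gk: "complex_of_real (g x) = k" if "x \<notin> G E" for x using y(2) that by simp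
  obtain x0 where x0: "x0 \<notin> G E" "\<And>f. f \<in> bounded_faces Q vpos earc \<Longrightarrow> x0 \<notin> f" using ex_far_point by metis
  have "g x0 = 0" unfolding g_def using x0 F by (intro sum.neutral) auto
  then have k0: "k = 0" using gk[OF x0(1)] by simp
  obtain x where x: "x \<in> f" using FF[OF f] in_components_nonempty unfolding faces_def by blast
  have "x \<notin> f'" if "f' \<in> F" "f' \<noteq> f" for f'
    using that FF f x components_nonoverlap unfolding faces_def by blast
  then have "g x = (\<Sum>f'\<in>F. if f' = f then c f else 0)"
    unfolding g_def using x by (intro sum.cong) auto
  then have "g x = c f" using F(1) f by simp
  moreover have "g x = 0" using gk[OF face_subset[OF FF[OF f] x]] k0 by simp
  ultimately show ?thesis by simp
qed

text \<open>A bounded face with sign zero at every arrow would be a nontrivial relation on its own.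
  So each bounded face contains one of the finitely many side points, and a point lies in at most
  one face.\<close>

lemma finite_bounded_faces: "finite (bounded_faces Q vpos earc)"
proof -
  have "\<exists>r l. \<forall>f\<in>faces Q vpos earc. fsign a f = of_bool (r \<in> f) - of_bool (l \<in> f)" if "a \<in> E" for a
    using arrow_sides[OF that] by blast
  then obtain r l where rl: "\<And>a f. a \<in> E \<Longrightarrow> f \<in> faces Q vpos earc \<Longrightarrow> fsign a f = of_bool (r a \<in> f) - of_bool (l a \<in> f)"
    by metis
  have one: "{f \<in> faces Q vpos earc. x \<in> f} \<subseteq> {connected_component_set (- G E) x}" for x
    proof (intro subsetI CollectI)
    fix f assume "f \<in> {f \<in> faces Q vpos earc. x \<in> f}"
    then obtain u where "f = connected_component_set (- G E) u" "x \<in> connected_component_set (- G E) u"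
      unfolding faces_def emb_image_G components_iff by auto
    then show "f \<in> {connected_component_set (- G E) x}" using connected_component_eq by blast
  qed
  have "bounded_faces Q vpos earc \<subseteq> (\<Union>a\<in>E. {f \<in> faces Q vpos earc. r a \<in> f} \<union> {f \<in> faces Q vpos earc. l a \<in> f})"
  proof
    fix f assume f: "f \<in> bounded_faces Q vpos earc"
    then have ff: "f \<in> faces Q vpos earc" unfolding bounded_faces_def by auto
    show "f \<in> (\<Union>a\<in>E. {f \<in> faces Q vpos earc. r a \<in> f} \<union> {f \<in> faces Q vpos earc. l a \<in> f})"
    proof (rule ccontr)
      assume "\<not> ?thesis"
      then have "fsign a f = 0" if "a \<in> E" for a using that rl[OF that ff] ff by auto
      then show False using face_combination[of "{f}" "\<lambda>_. 1" "\<lambda>_. 0" f] f by simp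
    qed
  qed
  moreover have "finite (\<Union>a\<in>E. {f \<in> faces Q vpos earc. r a \<in> f} \<union> {f \<in> faces Q vpos earc. l a \<in> f})"
    using finite_E one finite_subset by (intro finite_UN_I finite_UnI) (auto intro: finite_subset[OF one])
  ultimately show ?thesis by (rule finite_subset)
qed

text \<open>Normalised to vanish in the unbounded face, \<open>flow_wn y\<close> is a combination of
  indicators of bounded faces. Comparing jumps makes \<open>y\<close> a combination of face
  boundaries, to which it is orthogonal, so its sum of squares is zero.\<close>

lemma circulation_orthogonal_faces:
  assumes y: "\<And>v. net_flow y v = 0"
    and o: "\<And>f. f \<in> bounded_faces Q vpos earc \<Longrightarrow> (\<Sum>a\<in>E. y a * of_int (fsign a f)) = 0"
    and a: "a \<in> E"
  shows "y a = 0"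
proof -
  let ?F = "bounded_faces Q vpos earc"
  have FF: "f \<in> faces Q vpos earc" if "f \<in> ?F" for f using that unfolding bounded_faces_def by auto
  obtain x0 where x0: "x0 \<notin> G E" "\<And>f. f \<in> ?F \<Longrightarrow> x0 \<notin> f"
    "\<And>z. z \<notin> G E \<Longrightarrow> \<not> (\<exists>f\<in>?F. z \<in> f) \<Longrightarrow> connected_component (- G E) z x0"
    using ex_far_point by blast
  define g where "g x = Re (flow_wn y x - flow_wn y x0)" for x
  \<comment> \<open>Any point of the face gives the same value, as \<open>g\<close> is constant on
    faces.\<close>
  define c where "c f = g (SOME x. x \<in> f)" for f
  have lc: "g x = g z" if "connected_component (- G E) x z" for x z
    unfolding g_def using locally_constant_flow_wn[OF y that] by simp
  have gc: "g x = (\<Sum>f\<in>?F. c f * of_bool (x \<in> f))" if x: "x \<notin> G E" for x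
  proof (cases "\<exists>f\<in>?F. x \<in> f")
    case True
    then obtain f where f: "f \<in> ?F" "x \<in> f" by auto
    have "x \<notin> f'" if "f' \<in> ?F" "f' \<noteq> f" for f'
      using that FF f components_nonoverlap unfolding faces_def by blast
    then have "(\<Sum>f\<in>?F. c f * of_bool (x \<in> f)) = (\<Sum>f'\<in>?F. if f' = f then c f else 0)"
      using f by (intro sum.cong) auto
    also have "\<dots> = c f" using f(1) finite_bounded_faces by simp
    also have "\<dots> = g x"
    proof -
      have "(SOME x. x \<in> f) \<in> f" using f(2) by (rule someI)
      moreover have "connected f" "f \<subseteq> - G E"
        using FF[OF f(1)] in_components_connected in_components_subset unfolding faces_def emb_image_G by blast+
      ultimately show ?thesis unfolding c_def
        by (intro lc) (use f(2) in \<open>auto simp: connected_component_def\<close>)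
    qed
    finally show ?thesis by simp
  next
    case False
    then have "(\<Sum>f\<in>?F. c f * of_bool (x \<in> f)) = 0" by (intro sum.neutral) auto
    moreover have "g x = 0" using lc[OF x0(3)[OF x False]] unfolding g_def by simp
    ultimately show ?thesis by simp
  qed
  have J: "y a = - (\<Sum>f\<in>?F. c f * of_int (fsign a f))" if a: "a \<in> E" for a
  proof -
    obtain r l where rl: "r \<notin> G E" "l \<notin> G E"
      "\<forall>f\<in>faces Q vpos earc. fsign a f = of_bool (r \<in> f) - of_bool (l \<in> f)"
      "flow_wn y l - flow_wn y r = complex_of_real (y a)" using arrow_sides[OF a] y by blast
    have "g l - g r = Re (flow_wn y l - flow_wn y r)" unfolding g_def by simp
    then have "g l - g r = y a" unfolding rl(4) by simp
    moreover have "(\<Sum>f\<in>?F. c f * of_int (fsign a f)) = g r - g l"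
      unfolding gc[OF rl(1)] gc[OF rl(2)] sum_subtractf[symmetric]
      by (intro sum.cong refl) (simp add: rl(3)[rule_format] FF right_diff_distrib)
    ultimately show ?thesis by simp
  qed
  have "(\<Sum>a\<in>E. y a * y a) = - (\<Sum>a\<in>E. \<Sum>f\<in>?F. c f * (y a * of_int (fsign a f)))"
    unfolding sum_negf[symmetric] using J by (intro sum.cong) (auto simp: sum_distrib_left sum_negf algebra_simps)
  also have "\<dots> = - (\<Sum>f\<in>?F. c f * (\<Sum>a\<in>E. y a * of_int (fsign a f)))"
    unfolding sum_distrib_left by (subst sum.swap) simp
  also have "\<dots> = 0" using o by simp
  finally have "(\<Sum>a\<in>E. y a * y a) = 0" .
  then show ?thesis using finite_E a by (subst (asm) sum_nonneg_eq_0_iff) auto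
qed

section \<open>Transfer to fields of characteristic zero\<close>

text \<open>The additive map is chosen to be nonzero at a supposedly nonzero coefficient; applied to
  \<open>c\<close> and \<open>\<phi>\<close> simultaneously, it yields a real relation with a
  nonzero coefficient.\<close>

lemma face_combination_field:
  fixes c :: "complex set \<Rightarrow> 'k::field_char_0"
  assumes c: "\<And>a. a \<in> E \<Longrightarrow> (\<Sum>f\<in>bounded_faces Q vpos earc. c f * of_int (fsign a f)) = \<phi> (src a) - \<phi> (tgt a)"
    and f: "f \<in> bounded_faces Q vpos earc"
  shows "c f = 0"
proof (rule ccontr)
  assume "c f \<noteq> 0"
  then obtain \<pi> :: "'k \<Rightarrow> real" where \<pi>: "Modules.additive \<pi>" "\<And>n u. \<pi> (of_int n * u) = of_int n * \<pi> u" "\<pi> (c f) \<noteq> 0"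
    using additive_functional_nonzero by blast
  interpret Modules.additive \<pi> by fact
  have "(\<Sum>f\<in>bounded_faces Q vpos earc. \<pi> (c f) * of_int (fsign a f)) = \<pi> (\<phi> (src a)) - \<pi> (\<phi> (tgt a))"
    if "a \<in> E" for a
  proof -
    have "\<pi> (c f * of_int (fsign a f)) = \<pi> (c f) * of_int (fsign a f)" for f
      using \<pi>(2)[of "fsign a f" "c f"] by (simp add: mult.commute)
    then show ?thesis using arg_cong[OF c[OF that], of \<pi>] by (simp add: sum diff)
  qed
  then have "\<pi> (c f) = 0"
    using face_combination[of "bounded_faces Q vpos earc" "\<lambda>f. \<pi> (c f)" "\<lambda>v. \<pi> (\<phi> v)" f] finite_bounded_faces f by simp
  then show False using \<pi>(3) by simp
qed

text \<open>Duality over \<open>'k\<close>: a vector outside the span is detected by a functional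
  that kills the span. The coordinates of this functional form a circulation orthogonal to all
  faces, and an additive map nonzero at one coordinate makes it a nonzero real one.\<close>

lemma faces_and_coboundaries_span:
  fixes x :: "'a \<Rightarrow> 'k::field_char_0"
  shows "\<exists>c \<phi>. \<forall>a\<in>E. x a = (\<Sum>f\<in>bounded_faces Q vpos earc. c f * of_int (fsign a f)) + (\<phi> (src a) - \<phi> (tgt a))"
proof -
  let ?F = "bounded_faces Q vpos earc"
  interpret fs: vector_space "\<lambda>k (g :: 'a \<Rightarrow> 'k) a. k * g a"
    by unfold_locales (rule ext; simp add: ring_distribs mult.assoc; fail)+
  interpret vector_space_pair "\<lambda>k (g :: 'a \<Rightarrow> 'k) a. k * g a" "(*) :: 'k \<Rightarrow> 'k \<Rightarrow> 'k"
    by (intro vector_space_pair.intro fs.vector_space_axioms) (unfold_locales, auto simp: ring_distribs mult.assoc)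
  define u where "u f a = (if a \<in> E then of_int (fsign a f) else 0 :: 'k)" for f a
  define w where "w v a = (if a \<in> E then of_bool (src a = v) - of_bool (tgt a = v) else 0 :: 'k)" for v a
  \<comment> \<open>All vectors are cut off outside \<open>E\<close>, so that a functional on
    functions over the whole type is determined on them by finitely many coordinates.\<close>
  define x' where "x' a = (if a \<in> E then x a else 0)" for a
  define S where "S = u ` ?F \<union> w ` V"
  define T where "T = {g. \<exists>c \<phi>. \<forall>a\<in>E. g a = (\<Sum>f\<in>?F. c f * of_int (fsign a f)) + (\<phi> (src a) - \<phi> (tgt a) :: 'k)}"
  have "fs.subspace T"
  proof (rule fs.subspaceI)
    show "0 \<in> T" unfolding T_def by (auto intro!: exI[of _ "\<lambda>_. 0"])
  next
    fix g h assume "g \<in> T" "h \<in> T"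
    then obtain c \<phi> c' \<phi>' where "\<forall>a\<in>E. g a = (\<Sum>f\<in>?F. c f * of_int (fsign a f)) + (\<phi> (src a) - \<phi> (tgt a))"
      "\<forall>a\<in>E. h a = (\<Sum>f\<in>?F. c' f * of_int (fsign a f)) + (\<phi>' (src a) - \<phi>' (tgt a))" unfolding T_def by blast
    then show "g + h \<in> T" unfolding T_def
      by (intro CollectI exI[of _ "\<lambda>f. c f + c' f"] exI[of _ "\<lambda>v. \<phi> v + \<phi>' v"])
        (simp add: ring_distribs sum.distrib)
  next
    fix k g assume "g \<in> T"
    then obtain c \<phi> where "\<forall>a\<in>E. g a = (\<Sum>f\<in>?F. c f * of_int (fsign a f)) + (\<phi> (src a) - \<phi> (tgt a))"
      unfolding T_def by blast
    then show "(\<lambda>a. k * g a) \<in> T" unfolding T_def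
      by (intro CollectI exI[of _ "\<lambda>f. k * c f"] exI[of _ "\<lambda>v. k * \<phi> v"])
        (simp add: ring_distribs sum_distrib_left mult.assoc)
  qed
  moreover have "S \<subseteq> T"
  proof
    fix g assume "g \<in> S"
    then consider f where "f \<in> ?F" "g = u f" | v where "v \<in> V" "g = w v" unfolding S_def by auto
    then show "g \<in> T"
    proof cases
      case 1
      have "u f a = (\<Sum>f'\<in>?F. (if f' = f then 1 else 0) * of_int (fsign a f')) + (0 - 0)" if "a \<in> E" for a
        using 1(1) that finite_bounded_faces unfolding u_def
        by (simp add: if_distrib[of "\<lambda>t. t * _"] sum.delta cong: if_cong)
      then show ?thesis unfolding T_def 1(2)
        by (intro CollectI exI[of _ "\<lambda>f'. if f' = f then 1 else 0"] exI[of _ "\<lambda>_. 0"]) blast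
    next
      case 2
      then show ?thesis unfolding T_def 2(2) w_def
        by (intro CollectI exI[of _ "\<lambda>_. 0"] exI[of _ "\<lambda>v'. of_bool (v' = v)"]) simp
    qed
  qed
  ultimately have sub: "fs.span S \<subseteq> T" using fs.span_minimal by blast
  have "x' \<in> fs.span S"
  proof (rule ccontr)
    assume nx: "x' \<notin> fs.span S"
    \<comment> \<open>A basis of the span stays independent after adding \<open>x'\<close>, so a
      functional can be prescribed to be 1 at \<open>x'\<close> and 0 on the basis.\<close>
    obtain B where B: "B \<subseteq> S" "\<not> fs.dependent B" "S \<subseteq> fs.span B"
      using fs.maximal_independent_subset by blast
    have sp: "fs.span B = fs.span S" using B by (metis fs.span_eq fs.span_superset subset_trans)
    then have "\<not> fs.dependent (insert x' B)" using B(2) nx by (simp add: fs.independent_insert)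
    then obtain h where h: "Vector_Spaces.linear (\<lambda>k (g :: 'a \<Rightarrow> 'k) a. k * g a) (*) h"
      "\<forall>g\<in>insert x' B. h g = (if g = x' then 1 else 0)"
      using linear_independent_extend[of "insert x' B" "\<lambda>g. if g = x' then 1 else 0"] by auto
    have "x' \<notin> B" using nx sp fs.span_base by metis
    then have "h g = 0" if "g \<in> fs.span B" for g
      using linear_eq_0_on_span[OF h(1) _ that] h(2) by (metis insertI2)
    then have hS: "h g = 0" if "g \<in> S" for g using that B(3) by blast
    define y where "y a = h (\<lambda>b. if b = a then 1 else 0)" for a
    have exp: "h (\<lambda>b. if b \<in> A then g b else 0) = (\<Sum>a\<in>A. g a * y a)" if "finite A" for A g
      using that
    proof (induction A rule: finite_induct)
      case empty
      have "(\<lambda>b::'a. 0::'k) = 0" by (simp add: fun_eq_iff)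
      then show ?case using linear_0[OF h(1)] by simp
    next
      case (insert a A)
      have "(\<lambda>b. if b \<in> insert a A then g b else 0) =
        (\<lambda>b. g a * (if b = a then 1 else 0)) + (\<lambda>b. if b \<in> A then g b else 0)"
        using insert.hyps(2) by (auto simp: fun_eq_iff)
      then show ?case
        using insert linear_add[OF h(1)] linear_scale[OF h(1), of "g a" "\<lambda>b. if b = a then 1 else 0"]
        unfolding y_def by simp
    qed
    have "\<exists>a\<in>E. y a \<noteq> 0"
    proof (rule ccontr)
      assume "\<not> ?thesis"
      then have "h x' = 0" using exp[OF finite_E, of x] unfolding x'_def by simp
      then show False using h(2) by simp
    qed
    then obtain a where a: "a \<in> E" "y a \<noteq> 0" by blast
    then obtain \<pi> :: "'k \<Rightarrow> real" where \<pi>: "Modules.additive \<pi>" "\<And>n u. \<pi> (of_int n * u) = of_int n * \<pi> u" "\<pi> (y a) \<noteq> 0"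
      using additive_functional_nonzero by blast
    interpret ad: Modules.additive \<pi> by fact
    have \<pi>c: "\<pi> (of_int n * u) = \<pi> u * of_int n" for n u using \<pi>(2) by (simp add: mult.commute)
    \<comment> \<open>Vanishing of the functional on the coboundary of the indicator of
      \<open>v\<close> is zero net flow at \<open>v\<close>; the coefficients are integers, so
      \<open>\<pi>\<close> preserves the equation.\<close>
    have "net_flow (\<lambda>a. \<pi> (y a)) v = 0" for v
    proof (cases "v \<in> V")
      case True
      have "h (w v) = 0" using hS True unfolding S_def by auto
      then have "(\<Sum>a\<in>E. (of_bool (src a = v) - of_bool (tgt a = v)) * y a) = 0"
        using exp[OF finite_E, of "\<lambda>a. of_bool (src a = v) - of_bool (tgt a = v)"] unfolding w_def by simp
      then have "\<pi> (\<Sum>a\<in>E. of_int (of_bool (src a = v) - of_bool (tgt a = v)) * y a) = 0"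
        using ad.zero by simp
      then show ?thesis unfolding net_flow_def ad.sum \<pi>c by simp
    next
      case False
      then show ?thesis unfolding net_flow_def using src_V tgt_V by (intro sum.neutral) auto
    qed
    moreover have "(\<Sum>a\<in>E. \<pi> (y a) * of_int (fsign a f)) = 0" if "f \<in> ?F" for f
    proof -
      have "h (u f) = 0" using hS that unfolding S_def by auto
      then have "(\<Sum>a\<in>E. of_int (fsign a f) * y a) = 0"
        using exp[OF finite_E, of "\<lambda>a. of_int (fsign a f)"] unfolding u_def by simp
      then have "\<pi> (\<Sum>a\<in>E. of_int (fsign a f) * y a) = 0" using ad.zero by simp
      then show ?thesis unfolding ad.sum \<pi>c .
    qed
    ultimately show False using circulation_orthogonal_faces[of "\<lambda>a. \<pi> (y a)" a] a(1) \<pi>(3) by blast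
  qed
  then have "x' \<in> T" using sub by blast
  then obtain c \<phi> where "\<forall>a\<in>E. x' a = (\<Sum>f\<in>?F. c f * of_int (fsign a f)) + (\<phi> (src a) - \<phi> (tgt a))"
    unfolding T_def by blast
  then show ?thesis unfolding x'_def by auto
qed

end

theorem theorem4p7:
  fixes Q :: "('v,'a) quiver"
    and I :: "(('v,'a) qpath \<Rightarrow> 'k::field_char_0) set"
    and vpos :: "'v \<Rightarrow> complex"
    and earc :: "'a \<Rightarrow> real \<Rightarrow> complex"
  assumes "quiver_wf Q"
    and "quiver_connected Q"
    and "is_plane_embedding Q vpos earc"
    and "is_ideal Q I"
    and "path_generated Q I"
    and "I \<subseteq> Rad2 Q"
    and "complete_rel Q I"
    and "acyclic_rel Q I"
  shows "hh1_basis Q I ((B2 Q I - BE Q I) \<union> BP Q I vpos earc)"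
proof -
  interpret plane: plane_quiver Q vpos earc using assms by unfold_locales
  interpret alg: monomial_quotient Q I using assms by unfold_locales
  show ?thesis
  proof (rule alg.hh1_basis_S)
    show "finite (bounded_faces Q vpos earc)" by (rule plane.finite_bounded_faces)
  next
    fix c :: "complex set \<Rightarrow> 'k" and \<phi> f
    assume "\<And>a. a \<in> qarrs Q \<Longrightarrow>
      (\<Sum>f\<in>bounded_faces Q vpos earc. c f * face_sign Q vpos earc a f) = \<phi> (qsrc Q a) - \<phi> (qtgt Q a)"
      and "f \<in> bounded_faces Q vpos earc"
    then show "c f = 0" unfolding plane.face_sign_fsign by (rule plane.face_combination_field)
  next
    fix x :: "'a \<Rightarrow> 'k"
    show "\<exists>c \<phi>. \<forall>a\<in>qarrs Q. x a = (\<Sum>f\<in>bounded_faces Q vpos earc. c f * face_sign Q vpos earc a f) +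
      (\<phi> (qsrc Q a) - \<phi> (qtgt Q a))"
      unfolding plane.face_sign_fsign by (rule plane.faces_and_coboundaries_span)
  qed
qed

end
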